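(* Let $A$ be a C*-algebra and $I$ a closed two-sided ideal of $A$. Let $M$ and $N$ be countably generated right Hilbert C*-modules over $A$ and let $\phi\in B(M/MI,N/NI)$ be an adjointable operator. Then there exists an adjointable operator $\Phi\in B(M,N)$ inducing $\phi$ on the quotients, i.e. $\Phi(m)+NI=\phi(m+MI)$ for all $m\in M$.
   Context: For Hilbert modules $M,N$, $B(M,N)$ denotes the adjointable operators from $M$ to $N$. For a Hilbert $A$-module $M$, $MI$ is the closed submodule spanned by $\{mi:m\in M,i\in I\}$, and $M/MI$ is a Hilbert $A/I$-module with inner product $\langle x+MI,y+MI\rangle=\langle x,y\rangle+I$. Every $T\in B(M,N)$ satisfies $T(MI)\subseteq NI$ and induces an operator in $B(M/MI,N/NI)$. A Hilbert module is countably generated if it has a countable subset with dense span. *)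

theory Defs
  imports Complex_Main "HOL-Library.Countable_Set"
begin

definition cstar_algebra ::
  "(complex \<Rightarrow> 'a::{real_normed_algebra,banach} \<Rightarrow> 'a) \<Rightarrow> ('a \<Rightarrow> 'a) \<Rightarrow> bool" where
  "cstar_algebra sc st \<longleftrightarrow>
     (\<forall>x. sc 1 x = x) \<and>
     (\<forall>c d x. sc c (sc d x) = sc (c * d) x) \<and>
     (\<forall>c x y. sc c (x + y) = sc c x + sc c y) \<and>
     (\<forall>c d x. sc (c + d) x = sc c x + sc d x) \<and>
     (\<forall>r x. sc (complex_of_real r) x = scaleR r x) \<and>
     (\<forall>c x y. sc c (x * y) = sc c x * y \<and> sc c (x * y) = x * sc c y) \<and>
     (\<forall>c x. norm (sc c x) = cmod c * norm x) \<and>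
     (\<forall>x. st (st x) = x) \<and>
     (\<forall>x y. st (x + y) = st x + st y) \<and>
     (\<forall>c x. st (sc c x) = sc (cnj c) (st x)) \<and>
     (\<forall>x y. st (x * y) = st y * st x) \<and>
     (\<forall>x. norm (st x * x) = (norm x)\<^sup>2)"

definition cpos :: "('a::ring \<Rightarrow> 'a) \<Rightarrow> 'a \<Rightarrow> bool" where
  "cpos st a \<longleftrightarrow> (\<exists>b. a = st b * b)"

definition closed_ideal :: "(complex \<Rightarrow> 'a::{real_normed_algebra} \<Rightarrow> 'a) \<Rightarrow> 'a set \<Rightarrow> bool" where
  "closed_ideal sc I \<longleftrightarrow>
     0 \<in> I \<and> (\<forall>x\<in>I. \<forall>y\<in>I. x + y \<in> I) \<and> (\<forall>c. \<forall>x\<in>I. sc c x \<in> I) \<and>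
     (\<forall>a. \<forall>x\<in>I. a * x \<in> I \<and> x * a \<in> I) \<and> closed I"

definition hnorm :: "('m \<Rightarrow> 'm \<Rightarrow> 'a::real_normed_vector) \<Rightarrow> 'm \<Rightarrow> real" where
  "hnorm ip x = sqrt (norm (ip x x))"

definition hilbert_module ::
  "(complex \<Rightarrow> 'a::{real_normed_algebra,banach} \<Rightarrow> 'a) \<Rightarrow> ('a \<Rightarrow> 'a) \<Rightarrow>
   (complex \<Rightarrow> 'm::ab_group_add \<Rightarrow> 'm) \<Rightarrow> ('m \<Rightarrow> 'a \<Rightarrow> 'm) \<Rightarrow> ('m \<Rightarrow> 'm \<Rightarrow> 'a) \<Rightarrow> bool" where
  "hilbert_module sc st scM act ip \<longleftrightarrow>
     cstar_algebra sc st \<and>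
     (\<forall>x. scM 1 x = x) \<and>
     (\<forall>c d x. scM c (scM d x) = scM (c * d) x) \<and>
     (\<forall>c x y. scM c (x + y) = scM c x + scM c y) \<and>
     (\<forall>c d x. scM (c + d) x = scM c x + scM d x) \<and>
     (\<forall>x a b. act x (a + b) = act x a + act x b) \<and>
     (\<forall>x y a. act (x + y) a = act x a + act y a) \<and>
     (\<forall>x a b. act x (a * b) = act (act x a) b) \<and>
     (\<forall>c x a. scM c (act x a) = act (scM c x) a \<and> scM c (act x a) = act x (sc c a)) \<and>
     (\<forall>x y z. ip x (y + z) = ip x y + ip x z) \<and>
     (\<forall>c x y. ip x (scM c y) = sc c (ip x y)) \<and>
     (\<forall>x y a. ip x (act y a) = ip x y * a) \<and>
     (\<forall>x y. ip y x = st (ip x y)) \<and>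
     (\<forall>x. cpos st (ip x x)) \<and>
     (\<forall>x. ip x x = 0 \<longrightarrow> x = 0) \<and>
     (\<forall>X :: nat \<Rightarrow> 'm.
        (\<forall>e>0. \<exists>N. \<forall>m\<ge>N. \<forall>n\<ge>N. hnorm ip (X m - X n) < e) \<longrightarrow>
        (\<exists>L. \<forall>e>0. \<exists>N. \<forall>n\<ge>N. hnorm ip (X n - L) < e))"

inductive_set cspan :: "(complex \<Rightarrow> 'm::ab_group_add \<Rightarrow> 'm) \<Rightarrow> 'm set \<Rightarrow> 'm set"
  for scM S where
  cspan_zero: "0 \<in> cspan scM S"
| cspan_base: "x \<in> S \<Longrightarrow> x \<in> cspan scM S"
| cspan_add: "x \<in> cspan scM S \<Longrightarrow> y \<in> cspan scM S \<Longrightarrow> x + y \<in> cspan scM S"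
| cspan_scale: "x \<in> cspan scM S \<Longrightarrow> scM c x \<in> cspan scM S"

definition hclosure :: "('m::ab_group_add \<Rightarrow> 'm \<Rightarrow> 'a::real_normed_vector) \<Rightarrow> 'm set \<Rightarrow> 'm set" where
  "hclosure ip S = {x. \<forall>e>0. \<exists>y\<in>S. hnorm ip (x - y) < e}"

definition submodI ::
  "(complex \<Rightarrow> 'm::ab_group_add \<Rightarrow> 'm) \<Rightarrow> ('m \<Rightarrow> 'a \<Rightarrow> 'm) \<Rightarrow> ('m \<Rightarrow> 'm \<Rightarrow> 'a::real_normed_vector)
   \<Rightarrow> 'a set \<Rightarrow> 'm set" where
  "submodI scM act ip I = hclosure ip (cspan scM {act m i | m i. i \<in> I})"

definition countably_generated ::
  "(complex \<Rightarrow> 'm::ab_group_add \<Rightarrow> 'm) \<Rightarrow> ('m \<Rightarrow> 'a \<Rightarrow> 'm) \<Rightarrow> ('m \<Rightarrow> 'm \<Rightarrow> 'a::real_normed_vector)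
   \<Rightarrow> bool" where
  "countably_generated scM act ip \<longleftrightarrow>
     (\<exists>G. countable G \<and> hclosure ip (cspan scM (G \<union> {act g a | g a. g \<in> G})) = UNIV)"

definition adjointable :: "('m \<Rightarrow> 'm \<Rightarrow> 'a) \<Rightarrow> ('n \<Rightarrow> 'n \<Rightarrow> 'a) \<Rightarrow> ('m \<Rightarrow> 'n) \<Rightarrow> bool" where
  "adjointable ipM ipN T \<longleftrightarrow> (\<exists>T'. \<forall>x y. ipN (T x) y = ipM x (T' y))"

text \<open>A map f : M -> N representing (via lifting) an adjointable operator
  phi in B(M/MI, N/NI): f respects the cosets, and phi has an adjoint on the quotients,
  where the quotient inner product is ip x y + I.\<close>
definition quot_adjointable ::
  "'a::ab_group_add set \<Rightarrow> 'm::ab_group_add set \<Rightarrow> 'n::ab_group_add set \<Rightarrow>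
   ('m \<Rightarrow> 'm \<Rightarrow> 'a) \<Rightarrow> ('n \<Rightarrow> 'n \<Rightarrow> 'a) \<Rightarrow> ('m \<Rightarrow> 'n) \<Rightarrow> bool" where
  "quot_adjointable I MI NI ipM ipN f \<longleftrightarrow>
     (\<forall>x x'. x - x' \<in> MI \<longrightarrow> f x - f x' \<in> NI) \<and>
     (\<exists>g. (\<forall>y y'. y - y' \<in> NI \<longrightarrow> g y - g y' \<in> MI) \<and>
          (\<forall>x y. ipN (f x) y - ipM x (g y) \<in> I))"

end

theory Submission
  imports Defs "HOL-Analysis.Analysis"
begin

text \<open>
  Replacing $\phi$ by $(m,n) \mapsto (\phi^* n, \phi m)$ on $E = M \oplus N$ makes it self-adjoint.
  Let $h = \sum_k c_k \theta_{g_k,g_k}$ for generators $g_k$ of $E$ with weights $c_k$ so small that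
  $F = \sum_k c_k \theta_{\phi g_k,g_k}$ converges too; then $F$ lifts $\phi h$, and the approximate unit
  $e_n = h(h+\varepsilon_n)^{-1}$ has the lifts $F(h+\varepsilon_n)^{-1}$ of $\phi e_n$.  If $\varepsilon_n$
  decreases fast enough, $\phi$ is tridiagonal with respect to the blocks $e_{n+1}-e_n$ up to an
  absolutely summable error.  Any operator that is bounded by $C$ modulo $I$ has a lift bounded by $2C$,
  so the diagonal blocks and the errors can be lifted with control of the norms, and the block sum
  converges strictly to the desired operator.

  Cauchy--Schwarz and monotonicity of the norm rest on the positivity of $b^*b$, which is derived
  without spectral theory from a convergent iteration for square roots.
\<close>

section \<open>Positivity in unital operator algebras\<close>

text \<open>The map \<open>f\<close> is only a set-theoretic representative of \<phi>, not assumed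
  linear or bounded, and the quotient modules are never formed. Everything is stated through inner
  products modulo \<open>I\<close>: linearity modulo \<open>I\<close> follows from the adjoint
  relation, boundedness from the Baire category theorem. The obstacle is that the available bounds
  for the lifts of \<phi> e_n grow like 1/\<epsilon>_n; only their classes modulo \<open>I\<close>
  are uniformly bounded. Replacing each lift by one controlled by the quotient norm destroys its
  relation to the neighbouring lifts. Therefore the blocks are cut out on both sides and the
  discrepancies are lifted separately: block sums converge when the middle factors are merely
  bounded, whereas the discrepancies need summable bounds. The factor 2 in the bound 2C is harmless,
  so norm-preserving lifts and a functional calculus are avoided; resolvents, obtained from Neumann
  series, suffice. Self-adjointness of \<phi> lets the smallness of (1 - e_n) \<phi> e_j serve on
  the other side as well.\<close>

locale star_ops =
  fixes adj :: "'u::{real_normed_algebra,banach,monoid_mult} \<Rightarrow> 'u \<Rightarrow> bool" and J :: 'u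
  assumes adj_add: "adj x x' \<Longrightarrow> adj y y' \<Longrightarrow> adj (x + y) (x' + y')"
    and adj_scale: "adj x x' \<Longrightarrow> adj (scaleR r x) (scaleR r x')"
    and adj_mult: "adj x x' \<Longrightarrow> adj y y' \<Longrightarrow> adj (x * y) (y' * x')"
    and adj_one: "adj 1 1"
    and adj_sym: "adj x x' \<Longrightarrow> adj x' x"
    and adj_J: "adj J (- J)"
    and J_sq: "J * J = - 1"
    and J_central: "adj x x' \<Longrightarrow> J * x = x * J"
    and cstar_id: "adj x x' \<Longrightarrow> norm (x' * x) = (norm x)\<^sup>2"
    and adj_limit: "(\<And>n. adj (X n) (X n)) \<Longrightarrow> X \<longlonglongrightarrow> x \<Longrightarrow> adj x x"
    and norm_one_le: "norm (1::'u) \<le> 1"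
begin

text \<open>In spectral terms the norm condition places the spectrum in \<open>[0, 2 t]\<close>.
  This form is visibly stable under sums and nonnegative multiples; by \<open>pos_norm_diff\<close>
  the choice \<open>t = norm x\<close> always works.\<close>

definition pos :: "'u \<Rightarrow> bool" where
  "pos x \<longleftrightarrow> adj x x \<and> (\<exists>t\<ge>0. norm (t *\<^sub>R 1 - x) \<le> t)"

lemma adj_diff: "adj x x' \<Longrightarrow> adj y y' \<Longrightarrow> adj (x - y) (x' - y')"
  using adj_add[of x x' "(-1) *\<^sub>R y" "(-1) *\<^sub>R y'"] adj_scale[of y y' "-1"] by simp

text \<open>The iteration $y_{n+1} = (z + y_n^2)/2$ converges to $1 - \sqrt{1-z}$ when $\|z\| \le 1$; its increments are
  dominated by those of the scalar case $z = 1$.\<close>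

primrec bseq :: "nat \<Rightarrow> real" where
  "bseq 0 = 0"
| "bseq (Suc n) = (1 + (bseq n)\<^sup>2) / 2"

lemma bseq_bounds: "0 \<le> bseq n \<and> bseq n \<le> 1"
proof (induction n)
  case (Suc n)
  then have "(bseq n)\<^sup>2 \<le> 1" by (simp add: power_le_one)
  then show ?case by simp
qed simp

lemma bseq_mono: "bseq n \<le> bseq (Suc n)"
proof -
  have "0 \<le> (1 - bseq n)\<^sup>2" by simp
  then show ?thesis by (simp add: power2_eq_square algebra_simps)
qed

lemma bseq_Cauchy: "Cauchy bseq"
proof -
  have "incseq bseq" using bseq_mono by (rule incseq_SucI)
  moreover have "\<forall>n. \<bar>bseq n\<bar> \<le> 1" using bseq_bounds by (auto simp: abs_le_iff order_trans[of "- bseq _" 0])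
  then have "Bseq bseq" by (intro BseqI'[of _ 1]) auto
  ultimately have "convergent bseq" by (intro Bseq_monoseq_convergent) (auto simp: incseq_imp_monoseq)
  then show ?thesis by (rule convergent_Cauchy)
qed

context
  fixes z :: 'u
begin

primrec visser :: "nat \<Rightarrow> 'u" where
  "visser 0 = 0"
| "visser (Suc n) = (1/2) *\<^sub>R (z + visser n * visser n)"

end

lemma visser_adj: "adj z z \<Longrightarrow> adj (visser z n) (visser z n)"
proof (induction n)
  case 0
  show ?case using adj_scale[OF adj_one, of 0] by simp
next
  case (Suc n)
  then show ?case by (auto intro!: adj_scale adj_add adj_mult)
qed

lemma visser_commute: "w * z = z * w \<Longrightarrow> w * visser z n = visser z n * w"
proof (induction n)
  case (Suc n)
  have "w * (visser z n * visser z n) = visser z n * visser z n * w"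
    using Suc by (metis mult.assoc)
  then show ?case using Suc by (simp add: distrib_left distrib_right)
qed simp

lemma visser_norm: "norm z \<le> 1 \<Longrightarrow> norm (visser z n) \<le> bseq n"
proof (induction n)
  case (Suc n)
  have "norm (z + visser z n * visser z n) \<le> norm z + norm (visser z n) * norm (visser z n)"
    by (rule order_trans[OF norm_triangle_ineq]) (simp add: norm_mult_ineq)
  also have "\<dots> \<le> 1 + bseq n * bseq n"
    using Suc bseq_bounds[of n] by (intro add_mono mult_mono) auto
  finally show ?case by (simp add: power2_eq_square)
qed simp

lemma visser_diff:
  assumes "norm z \<le> 1"
  shows "norm (visser z (Suc n) - visser z n) \<le> bseq (Suc n) - bseq n"
proof (induction n)
  case 0
  then show ?case using assms by simp
next
  case (Suc n)
  let ?a = "visser z (Suc n)" and ?b = "visser z n"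
  \<comment> \<open>The iterates are polynomials in \<open>z\<close> and hence commute, so the
    difference of squares factors exactly as in the scalar recursion.\<close>
  have comm: "?a * ?b = ?b * ?a"
    by (metis visser_commute)
  have "visser z (Suc (Suc n)) - ?a = (1/2) *\<^sub>R (?a * ?a - ?b * ?b)"
    by (simp add: algebra_simps)
  also have "?a * ?a - ?b * ?b = (?a + ?b) * (?a - ?b)"
    using comm by (simp add: algebra_simps del: visser.simps)
  finally have "norm (visser z (Suc (Suc n)) - ?a) = (1/2) * norm ((?a + ?b) * (?a - ?b))"
    by simp
  also have "\<dots> \<le> (1/2) * ((bseq (Suc n) + bseq n) * (bseq (Suc n) - bseq n))"
  proof -
    have "norm (?a + ?b) \<le> bseq (Suc n) + bseq n"
      using norm_triangle_ineq[of ?a ?b] visser_norm[OF assms, of n] visser_norm[OF assms, of "Suc n"] by linarith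
    then have "norm (?a + ?b) * norm (?a - ?b) \<le> (bseq (Suc n) + bseq n) * (bseq (Suc n) - bseq n)"
      using Suc bseq_bounds[of n] bseq_bounds[of "Suc n"] by (intro mult_mono) auto
    then show ?thesis using norm_mult_ineq[of "?a + ?b" "?a - ?b"] by linarith
  qed
  also have "\<dots> = bseq (Suc (Suc n)) - bseq (Suc n)"
    by (simp add: power2_eq_square field_simps)
  finally show ?case .
qed

lemma visser_limit:
  assumes z: "adj z z" "norm z \<le> 1"
  obtains y where "adj y y" "norm y \<le> 1" "z + y * y = 2 *\<^sub>R y" "\<And>w. w * z = z * w \<Longrightarrow> w * y = y * w"
proof -
  have d: "norm (visser z n - visser z m) \<le> bseq n - bseq m" if "m \<le> n" for m n
    using that
  proof (induction n rule: dec_induct)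
    case (step n)
    have "norm (visser z (Suc n) - visser z m)
        \<le> norm (visser z (Suc n) - visser z n) + norm (visser z n - visser z m)"
      by (rule norm_diff_triangle_le[OF order_refl order_refl])
    then show ?case using visser_diff[OF z(2), of n] step by linarith
  qed simp
  have "Cauchy (visser z)"
  proof (rule CauchyI)
    fix e :: real assume "e > 0"
    then obtain M where M: "\<And>m n. m \<ge> M \<Longrightarrow> n \<ge> M \<Longrightarrow> norm (bseq m - bseq n) < e"
      using bseq_Cauchy by (meson CauchyD)
    have "norm (visser z m - visser z n) < e" if "m \<ge> M" "n \<ge> M" for m n
    proof (cases "m \<le> n")
      case True
      then show ?thesis using d[OF True] M[OF that] by (simp add: norm_minus_commute)
    next
      case False
      then show ?thesis using d[of n m] M[OF that] by simp
    qed
    then show "\<exists>M. \<forall>m\<ge>M. \<forall>n\<ge>M. norm (visser z m - visser z n) < e" by blast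
  qed
  then obtain y where y: "visser z \<longlonglongrightarrow> y"
    using Cauchy_convergent convergent_def by blast
  have "(\<lambda>n. visser z (Suc n)) \<longlonglongrightarrow> (1/2) *\<^sub>R (z + y * y)"
    unfolding visser.simps by (intro tendsto_intros y)
  then have "y = (1/2) *\<^sub>R (z + y * y)"
    using LIMSEQ_unique LIMSEQ_Suc[OF y] by blast
  then have eq: "z + y * y = 2 *\<^sub>R y"
    by (metis (no_types, lifting) divide_eq_1_iff mult_numeral_1_right numeral_One scaleR_one scaleR_scaleR
        times_divide_eq_right zero_neq_numeral)
  have "norm (visser z n) \<le> 1" for n
    using visser_norm[OF z(2), of n] bseq_bounds[of n] by linarith
  then have n1: "norm y \<le> 1" using y by (intro lim_mono[OF _ tendsto_norm[OF y] tendsto_const, of 0 1]) auto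
  have "w * y = y * w" if "w * z = z * w" for w
  proof -
    have "(\<lambda>n. w * visser z n) \<longlonglongrightarrow> w * y" by (intro tendsto_intros y)
    moreover have "(\<lambda>n. w * visser z n) \<longlonglongrightarrow> y * w"
      unfolding visser_commute[OF that] by (intro tendsto_intros y)
    ultimately show ?thesis by (rule LIMSEQ_unique)
  qed
  then show ?thesis using that eq n1 adj_limit[OF visser_adj[OF z(1)] y] by blast
qed

text \<open>After division by \<open>t\<close> the condition in \<open>pos\<close> says that
  \<open>z = 1 - x/t\<close> has norm at most one, which is the range of the iteration. The bound
  \<open>norm y \<le> 1\<close> then makes the root itself positive, with constant
  \<open>sqrt t\<close>.\<close>

lemma pos_sqrt:
  assumes "pos x"
  obtains s where "pos s" "s * s = x" "\<And>w. w * x = x * w \<Longrightarrow> w * s = s * w"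
proof -
  from assms obtain t where x: "adj x x" and t: "t \<ge> 0" "norm (t *\<^sub>R 1 - x) \<le> t"
    by (auto simp: pos_def)
  show ?thesis
  proof (cases "t = 0")
    case True
    then have "x = 0" using t by simp
    then show ?thesis using that[of 0] assms by auto
  next
    case False
    then have t0: "t > 0" using t by simp
    define z where "z = 1 - (1/t) *\<^sub>R x"
    have z: "adj z z" unfolding z_def by (intro adj_diff adj_one adj_scale x)
    have "z = (1/t) *\<^sub>R (t *\<^sub>R 1 - x)" using t0 by (simp add: z_def scaleR_diff_right)
    then have "norm z \<le> 1" using t t0 by simp
    then obtain y where y: "adj y y" "norm y \<le> 1" "z + y * y = 2 *\<^sub>R y" "\<And>w. w * z = z * w \<Longrightarrow> w * y = y * w"
      using visser_limit z by blast
    define s where "s = sqrt t *\<^sub>R (1 - y)"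
    have "(1 - y) * (1 - y) = 1 - 2 *\<^sub>R y + y * y" by (simp add: algebra_simps scaleR_2)
    also have "\<dots> = 1 - z" using y(3) by (metis add_diff_cancel_right' diff_add_eq diff_diff_eq2)
    finally have "s * s = (sqrt t * sqrt t) *\<^sub>R (1 - z)" by (simp add: s_def)
    then have ss: "s * s = x" using t0 by (simp add: z_def)
    have "sqrt t *\<^sub>R 1 - s = sqrt t *\<^sub>R y" by (simp add: s_def scaleR_diff_right)
    then have "norm (sqrt t *\<^sub>R 1 - s) \<le> sqrt t" using y(2) t0 by (simp add: mult_left_le)
    moreover have "adj s s" unfolding s_def by (intro adj_scale adj_diff adj_one y)
    ultimately have "pos s" unfolding pos_def using t0 by (intro conjI exI[of _ "sqrt t"]) auto
    moreover have "w * s = s * w" if "w * x = x * w" for w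
    proof -
      have "w * z = z * w" using that by (simp add: z_def algebra_simps)
      then show ?thesis using y(4)[of w] by (simp add: s_def algebra_simps)
    qed
    ultimately show ?thesis using that ss by blast
  qed
qed

lemma norm_J: "norm J \<le> 1"
proof -
  have "(norm J)\<^sup>2 = norm (1::'u)" using cstar_id[OF adj_J] J_sq by simp
  then have "(norm J)\<^sup>2 \<le> 1\<^sup>2" using norm_one_le by simp
  then show ?thesis by (rule power2_le_imp_le) simp
qed

text \<open>For commuting self-adjoint $s$, $w$ the element $s + iw$ satisfies $(s+iw)^*(s+iw) = s^2+w^2$.\<close>

lemma norm_le_sum_squares:
  assumes s: "adj s s" and w: "adj w w" and c: "s * w = w * s" and sw: "s * s + w * w = r *\<^sub>R 1" and r: "r \<ge> 0"
  shows "norm s \<le> sqrt r" "norm w \<le> sqrt r"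
proof -
  define u where "u = s + J * w"
  define u' where "u' = s - J * w"
  have Jw: "J * w = w * J" and Js: "J * s = s * J" using J_central s w by auto
  have "adj (J * w) (w * (- J))" by (rule adj_mult[OF adj_J w])
  then have "adj (J * w) (- (J * w))" using Jw by simp
  then have uu: "adj u u'" unfolding u_def u'_def using adj_add[OF s] by fastforce
  have jw: "J * w * (J * w) = - (w * w)"
    using Jw J_sq by (metis mult.assoc mult_1 mult_minus_left)
  have sj: "s * (J * w) = J * w * s" using Js c by (metis mult.assoc)
  have "u' * u = r *\<^sub>R 1" "u * u' = r *\<^sub>R 1"
    using jw sj sw by (simp_all add: u_def u'_def algebra_simps)
  then have "(norm u)\<^sup>2 = r * norm (1::'u)" "(norm u')\<^sup>2 = r * norm (1::'u)"
    using cstar_id[OF uu] cstar_id[OF adj_sym[OF uu]] r by auto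
  then have "(norm u)\<^sup>2 \<le> r" "(norm u')\<^sup>2 \<le> r"
    using mult_left_le[OF norm_one_le r] by simp_all
  then have nu: "norm u \<le> sqrt r" "norm u' \<le> sqrt r" by (simp_all add: real_le_rsqrt)
  have "2 *\<^sub>R s = u + u'" by (simp add: u_def u'_def scaleR_2)
  then have "2 * norm s = norm (u + u')" by (metis abs_numeral norm_scaleR)
  then show "norm s \<le> sqrt r" using norm_triangle_ineq[of u u'] nu by linarith
  have "2 *\<^sub>R w = - (J * (u - u'))"
  proof -
    have "J * (u - u') = 2 *\<^sub>R (J * (J * w))" by (simp add: u_def u'_def algebra_simps scaleR_2)
    also have "J * (J * w) = - w" using J_sq by (metis mult.assoc mult_1 mult_minus_left)
    finally show ?thesis by simp
  qed
  then have "2 * norm w = norm (J * (u - u'))" by (metis abs_numeral norm_scaleR norm_minus_cancel)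
  also have "\<dots> \<le> norm J * norm (u - u')" by (rule norm_mult_ineq)
  also have "\<dots> \<le> norm (u - u')" using norm_J by (simp add: mult_left_le_one_le)
  finally show "norm w \<le> sqrt r" using norm_triangle_ineq4[of u u'] nu by linarith
qed

text \<open>The iteration applied to \<open>s * s\<close> yields \<open>w\<close> with
  \<open>w * w = 1 - s * s\<close> that commutes with \<open>s\<close>; since the two squares add up
  to one, \<open>norm_le_sum_squares\<close> bounds \<open>w\<close>.\<close>

lemma norm_one_minus_square:
  assumes s: "adj s s" and n: "norm s \<le> 1"
  shows "norm (1 - s * s) \<le> 1"
proof -
  have "norm (s * s) \<le> 1"
    using cstar_id[OF s] n by (simp add: power_le_one)
  then obtain y where y: "adj y y" "norm y \<le> 1" "s * s + y * y = 2 *\<^sub>R y"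
      "\<And>w. w * (s * s) = s * s * w \<Longrightarrow> w * y = y * w"
    using visser_limit[OF adj_mult[OF s s]] by blast
  define w where "w = 1 - y"
  have w: "adj w w" unfolding w_def by (intro adj_diff adj_one y)
  have "s * y = y * s" by (rule y(4)) (simp add: mult.assoc)
  then have "s * w = w * s" by (simp add: w_def algebra_simps)
  moreover have ww: "w * w = 1 - s * s"
    using y(3) by (simp add: w_def algebra_simps scaleR_2)
  ultimately have "norm w \<le> sqrt 1"
    using norm_le_sum_squares(2)[OF s w, of 1] by simp
  then have "norm w * norm w \<le> 1" by (simp add: mult_le_one)
  then show ?thesis using norm_mult_ineq[of w w] ww by simp
qed

lemma norm_diff_square:
  assumes s: "adj s s"
  shows "norm ((norm (s * s)) *\<^sub>R 1 - s * s) \<le> norm (s * s)"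
proof (cases "s = 0")
  case False
  define t where "t = norm s"
  have t: "t > 0" using False by (simp add: t_def)
  have "norm (1 - ((1/t) *\<^sub>R s) * ((1/t) *\<^sub>R s)) \<le> 1"
    using t by (intro norm_one_minus_square adj_scale s) (simp add: t_def)
  moreover have "t\<^sup>2 *\<^sub>R (1 - ((1/t) *\<^sub>R s) * ((1/t) *\<^sub>R s)) = t\<^sup>2 *\<^sub>R 1 - s * s"
    using t by (simp add: scaleR_diff_right power2_eq_square)
  ultimately have "norm (t\<^sup>2 *\<^sub>R 1 - s * s) \<le> t\<^sup>2"
    by (metis abs_power2 mult_left_le norm_scaleR zero_le_power2)
  then show ?thesis using cstar_id[OF s] by (simp add: t_def)
qed simp

lemma pos_square: "adj s s \<Longrightarrow> pos (s * s)"
  unfolding pos_def using norm_diff_square adj_mult by (metis norm_ge_zero)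

text \<open>A canonical witness in place of the existential one in \<open>pos\<close>. It depends
  continuously on \<open>x\<close>, which later makes the positive cone closed.\<close>

lemma pos_norm_diff:
  assumes "pos x" shows "norm (norm x *\<^sub>R 1 - x) \<le> norm x"
proof -
  obtain s where "pos s" "s * s = x" using pos_sqrt[OF assms] by blast
  then show ?thesis using norm_diff_square[of s] by (simp add: pos_def)
qed

lemma pos_add:
  assumes "pos x" "pos y" shows "pos (x + y)"
proof -
  from assms obtain t r where x: "adj x x" and t: "t \<ge> 0" "norm (t *\<^sub>R 1 - x) \<le> t"
    and y: "adj y y" and r: "r \<ge> 0" "norm (r *\<^sub>R 1 - y) \<le> r"
    by (auto simp: pos_def)
  have "(t + r) *\<^sub>R 1 - (x + y) = (t *\<^sub>R 1 - x) + (r *\<^sub>R 1 - y)" by (simp add: algebra_simps)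
  then have "norm ((t + r) *\<^sub>R 1 - (x + y)) \<le> t + r"
    using t r by (metis norm_triangle_mono)
  then show ?thesis unfolding pos_def using t r adj_add[OF x y] by (metis add_nonneg_nonneg)
qed

lemma pos_scale:
  assumes "pos x" "c \<ge> 0" shows "pos (c *\<^sub>R x)"
proof -
  from assms obtain t where x: "adj x x" and t: "t \<ge> 0" "norm (t *\<^sub>R 1 - x) \<le> t"
    by (auto simp: pos_def)
  have "(c * t) *\<^sub>R 1 - c *\<^sub>R x = c *\<^sub>R (t *\<^sub>R 1 - x)" by (simp add: algebra_simps)
  then have "norm ((c * t) *\<^sub>R 1 - c *\<^sub>R x) \<le> c * t"
    using t assms by (simp add: mult_left_mono)
  then show ?thesis unfolding pos_def using t assms adj_scale[OF x] by (metis mult_nonneg_nonneg)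
qed

lemma pos_const_minus: "adj x x \<Longrightarrow> norm x \<le> t \<Longrightarrow> pos (t *\<^sub>R 1 - x)"
  unfolding pos_def by (intro conjI adj_diff adj_scale adj_one exI[of _ t]) (auto intro: order_trans[OF norm_ge_zero])

text \<open>The roots of \<open>x\<close> and \<open>r - x\<close> commute because each commutes
  with everything that commutes with \<open>x\<close>, and their squares add up to
  \<open>r\<close>.\<close>

lemma norm_le_of_pos:
  assumes x: "pos x" and rx: "pos (r *\<^sub>R 1 - x)" and r: "r \<ge> 0"
  shows "norm x \<le> r"
proof -
  obtain s where s: "pos s" "s * s = x" "\<And>w. w * x = x * w \<Longrightarrow> w * s = s * w"
    using pos_sqrt[OF x] by blast
  obtain w where w: "pos w" "w * w = r *\<^sub>R 1 - x"
    "\<And>v. v * (r *\<^sub>R 1 - x) = (r *\<^sub>R 1 - x) * v \<Longrightarrow> v * w = w * v"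
    using pos_sqrt[OF rx] by blast
  have "s * x = x * s" using s(2) by (metis mult.assoc)
  then have "s * w = w * s" by (intro w(3)) (simp add: algebra_simps)
  moreover have "adj s s" "adj w w" using s(1) w(1) by (simp_all add: pos_def)
  moreover have "s * s + w * w = r *\<^sub>R 1" using s(2) w(2) by simp
  ultimately have "norm s \<le> sqrt r" using norm_le_sum_squares(1) r by blast
  then have "(norm s)\<^sup>2 \<le> r" using r
    by (metis norm_ge_zero power_mono real_sqrt_pow2)
  then show ?thesis using s(2) norm_mult_ineq[of s s] by (simp add: power2_eq_square)
qed

text \<open>If $-c^*c$ and $cc^*$ are both positive and $\|c\|=1$, then $p=-c^*c$ satisfies
  $\|p+p^2\| = \|c^*(1-cc^*)c\| \le 1$, which forces $\|p\| \le 5/8$.\<close>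

lemma no_negative_norm_one:
  assumes c: "adj c c'" and p: "pos (- (c' * c))" and q: "pos (c * c')" and n: "norm c = 1"
  shows False
proof -
  define p where "p = - (c' * c)"
  have pp: "pos p" and sp: "adj p p" using p by (auto simp: p_def pos_def)
  have np: "norm p = 1" using cstar_id[OF c] n by (simp add: p_def)
  have "norm (c' * c) = 1" using cstar_id[OF c] n by simp
  then have "1 \<le> norm c'" using norm_mult_ineq[of c' c] n by simp
  have "norm (c * c') = norm c' * norm c'"
    using cstar_id[OF adj_sym[OF c]] by (simp add: power2_eq_square)
  moreover have "norm (c * c') \<le> norm c'" using norm_mult_ineq[of c c'] n by simp
  moreover have "norm c' \<le> norm c' * norm c'"
    using mult_right_mono[OF \<open>1 \<le> norm c'\<close>, of "norm c'"] by simp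
  ultimately have "norm c' * norm c' = norm c' * 1" by simp
  then have "norm c' = 1" using \<open>1 \<le> norm c'\<close> by auto
  then have nq: "norm (c * c') = 1" "norm c' = 1"
    using \<open>norm (c * c') = norm c' * norm c'\<close> by simp_all
  then have nq1: "norm (1 - c * c') \<le> 1" using pos_norm_diff[OF q] by simp
  have "p + p * p = - (c' * (1 - c * c') * c)" by (simp add: p_def algebra_simps)
  then have "norm (p + p * p) = norm (c' * (1 - c * c') * c)" by (metis norm_minus_cancel)
  also have "\<dots> \<le> norm c' * norm (1 - c * c') * norm c"
    by (intro order_trans[OF norm_mult_ineq] mult_right_mono norm_mult_ineq) auto
  finally have le1: "norm (p + p * p) \<le> 1" using n nq nq1 by simp
  \<comment> \<open>Completing the square: \<open>y * y\<close> exceeds \<open>p + p * p\<close> by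
    1/4, so its norm is at most 5/4. The number 9/8 is a rational upper bound for the root of 5/4,
    and 5/8 = 9/8 - 1/2.\<close>
  define y where "y = p + (1/2) *\<^sub>R 1"
  have sy: "adj y y" unfolding y_def by (intro adj_add adj_scale adj_one sp)
  have "y * y = (p + p * p) + (1/4) *\<^sub>R 1" by (simp add: y_def algebra_simps flip: scaleR_add_left)
  then have "norm (y * y) \<le> 1 + 1/4"
    using norm_triangle_ineq[of "p + p * p" "(1/4) *\<^sub>R 1"] le1 norm_one_le by simp
  then have "(norm y)\<^sup>2 \<le> (9/8)\<^sup>2" using cstar_id[OF sy] by (simp add: power2_eq_square)
  then have "norm y \<le> 9/8" by (rule power2_le_imp_le) simp
  then have "pos ((9/8) *\<^sub>R 1 - y)" by (rule pos_const_minus[OF sy])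
  moreover have "(9/8) *\<^sub>R 1 - y = (5/8) *\<^sub>R 1 - p"
    by (simp add: y_def algebra_simps flip: scaleR_add_left)
  ultimately have "norm p \<le> 5/8" using norm_le_of_pos[OF pp, of "5/8"] by simp
  then show False using np by simp
qed

text \<open>Twice the real and imaginary parts of \<open>d\<close>, namely \<open>h\<close> and (up
  to sign) \<open>k\<close>, satisfy \<open>h * h + k * k = 2 (d d' + d' d)\<close>. Hence
  negativity of \<open>d' d\<close> forces \<open>d d'\<close> to be positive, and for norm one
  \<open>no_negative_norm_one\<close> excludes this pair of signs.\<close>

lemma no_negative:
  assumes c: "adj c c'" and p: "pos (- (c' * c))"
  shows "c = 0"
proof (rule ccontr)
  assume "c \<noteq> 0"
  define t where "t = 1 / norm c"
  have t: "t > 0" using \<open>c \<noteq> 0\<close> by (simp add: t_def)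
  define d d' where "d = t *\<^sub>R c" and "d' = t *\<^sub>R c'"
  have d: "adj d d'" unfolding d_def d'_def by (rule adj_scale[OF c])
  have "norm d = 1" using \<open>c \<noteq> 0\<close> by (simp add: d_def t_def)
  moreover have pd: "pos (- (d' * d))"
    using pos_scale[OF p, of "t * t"] t by (simp add: d_def d'_def)
  moreover have "pos (d * d')"
  proof -
    define h k where "h = d + d'" and "k = J * (d - d')"
    have h: "adj h h" unfolding h_def using adj_add[OF d adj_sym[OF d]] by (simp add: add.commute)
    have "adj (J * (d - d')) ((d' - d) * (- J))" by (intro adj_mult adj_J adj_diff d adj_sym[OF d])
    moreover have Jd: "J * d = d * J" "J * d' = d' * J" using J_central d adj_sym[OF d] by blast+
    ultimately have k: "adj k k" unfolding k_def by (simp add: algebra_simps)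
    have JJ: "J * x * (J * y) = - (x * y)" if "J * x = x * J" for x y
      using that J_sq by (metis mult.assoc mult_1_right mult_minus_left mult_minus_right)
    have "k * k = - ((d - d') * (d - d'))" unfolding k_def
      by (rule JJ) (simp add: algebra_simps Jd)
    then have "h * h + k * k = 2 *\<^sub>R (d * d' + d' * d)"
      by (simp add: h_def algebra_simps scaleR_2)
    then have "d * d' = (1/2) *\<^sub>R (h * h + k * k) + - (d' * d)" by (simp add: algebra_simps)
    then show ?thesis using pos_add pos_scale pos_square h k pd by (metis zero_le_divide_1_iff zero_le_numeral)
  qed
  ultimately show False using no_negative_norm_one d by blast
qed

text \<open>Here \<open>m\<close> is the absolute value of \<open>a\<close>, and
  \<open>n = m - a\<close> is twice its negative part. Since \<open>a n = - m n\<close>, the element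
  \<open>- (b n)' (b n)\<close> equals \<open>n m n\<close>, which the root \<open>r\<close> of
  \<open>m\<close> exhibits as the square of \<open>r n\<close>. So \<open>b n = 0\<close> by
  \<open>no_negative\<close>, and the negative part vanishes.\<close>

theorem pos_adj_mult:
  assumes b: "adj b b'"
  shows "pos (b' * b)"
proof -
  define a where "a = b' * b"
  have a: "adj a a" unfolding a_def using adj_mult[OF adj_sym[OF b] b] .
  obtain m where m: "pos m" "m * m = a * a" "\<And>w. w * (a * a) = a * a * w \<Longrightarrow> w * m = m * w"
    using pos_sqrt[OF pos_square[OF a]] by blast
  obtain r where r: "pos r" "r * r = m" "\<And>w. w * m = m * w \<Longrightarrow> w * r = r * w"
    using pos_sqrt[OF m(1)] by blast
  have sm: "adj m m" and sr: "adj r r" using m(1) r(1) by (simp_all add: pos_def)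
  have am: "a * m = m * a" by (rule m(3)) (simp add: mult.assoc)
  have ar: "a * r = r * a" by (rule r(3)[OF am])
  have mr: "m * r = r * m" using r(2) by (metis mult.assoc)
  define n where "n = m - a"
  have n: "adj n n" unfolding n_def by (intro adj_diff sm a)
  have rn: "r * n = n * r" using ar mr by (simp add: n_def algebra_simps)
  have mn: "m * n = n * m" using am by (simp add: n_def algebra_simps)
  have an: "a * n = - (m * n)" using am m(2) by (simp add: n_def algebra_simps)
  have "adj (b * n) (n * b')" by (rule adj_mult[OF b n])
  moreover have "- (n * b' * (b * n)) = (r * n) * (r * n)"
  proof -
    have "n * b' * (b * n) = n * (a * n)" by (simp add: a_def mult.assoc)
    also have "\<dots> = - (n * (r * (r * n)))" using an by (simp add: mult.assoc flip: r(2))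
    also have "n * (r * (r * n)) = (r * n) * (r * n)" using rn by (metis mult.assoc)
    finally show ?thesis by simp
  qed
  moreover have "adj (r * n) (r * n)" using adj_mult[OF sr n] rn by simp
  ultimately have "b * n = 0" using no_negative pos_square by metis
  then have "a * n = 0" by (simp add: a_def mult.assoc)
  then have "n * n = 0" using an mn by (simp add: n_def algebra_simps)
  then have "n = 0" using cstar_id[OF n] by simp
  then have "a = m" by (simp add: n_def)
  then show ?thesis using m(1) by (simp add: a_def)
qed

end

section \<open>The positive cone of a C*-algebra\<close>

text \<open>The algebra need not have a unit, so the unital theory is applied to bounded operators on it.
  The unit of \<open>endo\<close> vanishes on the zero space, hence \<open>monoid_mult\<close> instead of \<open>real_normed_algebra_1\<close>.\<close>

typedef (overloaded) 'a endo = "UNIV :: ('a::real_normed_vector \<Rightarrow>\<^sub>L 'a) set" ..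

setup_lifting type_definition_endo

instantiation endo :: (real_normed_vector) real_normed_algebra
begin
lift_definition zero_endo :: "'a endo" is 0 .
lift_definition plus_endo :: "'a endo \<Rightarrow> 'a endo \<Rightarrow> 'a endo" is "(+)" .
lift_definition minus_endo :: "'a endo \<Rightarrow> 'a endo \<Rightarrow> 'a endo" is "(-)" .
lift_definition uminus_endo :: "'a endo \<Rightarrow> 'a endo" is "uminus" .
lift_definition scaleR_endo :: "real \<Rightarrow> 'a endo \<Rightarrow> 'a endo" is "scaleR" .
lift_definition times_endo :: "'a endo \<Rightarrow> 'a endo \<Rightarrow> 'a endo" is "blinfun_compose" .
lift_definition norm_endo :: "'a endo \<Rightarrow> real" is "norm" .
lift_definition dist_endo :: "'a endo \<Rightarrow> 'a endo \<Rightarrow> real" is "dist" .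
lift_definition sgn_endo :: "'a endo \<Rightarrow> 'a endo" is "sgn" .
definition uniformity_endo :: "('a endo \<times> 'a endo) filter" where
  "uniformity_endo = (INF e\<in>{0 <..}. principal {(x, y). dist x y < e})"
definition open_endo :: "'a endo set \<Rightarrow> bool" where
  "open_endo S = (\<forall>x\<in>S. \<forall>\<^sub>F (x', y) in uniformity. x' = x \<longrightarrow> y \<in> S)"
instance
proof
  fix a b c :: "'a endo" and r s :: real
  show "dist a b = norm (a - b)" by transfer (rule dist_norm)
  show "norm (a * b) \<le> norm a * norm b" by transfer (rule norm_blinfun_compose)
  show "sgn a = inverse (norm a) *\<^sub>R a" by transfer (rule sgn_div_norm)
  show "norm (a + b) \<le> norm a + norm b" by transfer (rule norm_triangle_ineq)
  show "norm (r *\<^sub>R a) = \<bar>r\<bar> * norm a" by transfer simp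
  show "(norm a = 0) = (a = 0)" by transfer simp
  show "uniformity = (INF e\<in>{0 <..}. principal {(x, y :: 'a endo). dist x y < e})"
    by (rule uniformity_endo_def)
  show "open U = (\<forall>x\<in>U. \<forall>\<^sub>F (x', y) in uniformity. x' = x \<longrightarrow> y \<in> U)" for U :: "'a endo set"
    by (rule open_endo_def)
qed (transfer, rule blinfun_eqI, simp add: blinfun.bilinear_simps algebra_simps)+
end

instantiation endo :: (real_normed_vector) monoid_mult
begin
lift_definition one_endo :: "'a endo" is id_blinfun .
instance by standard (transfer, rule blinfun_eqI, simp)+
end

instance endo :: (banach) banach
proof
  fix X :: "nat \<Rightarrow> 'a endo" assume "Cauchy X"
  then have "Cauchy (\<lambda>n. Rep_endo (X n))" unfolding Cauchy_def dist_endo.rep_eq .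
  then obtain L where "(\<lambda>n. Rep_endo (X n)) \<longlonglongrightarrow> L" by (auto simp: convergent_eq_Cauchy[symmetric])
  then have "X \<longlonglongrightarrow> Abs_endo L"
    unfolding lim_sequentially dist_endo.rep_eq by (simp add: Abs_endo_inverse)
  then show "convergent X" by (auto simp: convergent_def)
qed

lift_definition ap :: "'a::real_normed_vector endo \<Rightarrow> 'a \<Rightarrow> 'a" is blinfun_apply .

lemma ap_simps [simp]:
  "ap (T + S) x = ap T x + ap S x" "ap (T - S) x = ap T x - ap S x" "ap (- T) x = - ap T x"
  "ap (r *\<^sub>R T) x = r *\<^sub>R ap T x" "ap (T * S) x = ap T (ap S x)" "ap 1 x = x" "ap 0 x = 0"
  "ap T (x + y) = ap T x + ap T y" "ap T (x - y) = ap T x - ap T y" "ap T (r *\<^sub>R x) = r *\<^sub>R ap T x"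
  by (transfer; simp add: blinfun.bilinear_simps)+

lemma ap_norm: "norm (ap T x) \<le> norm T * norm x"
  by transfer (rule norm_blinfun)

lemma endo_eqI: "(\<And>x. ap T x = ap S x) \<Longrightarrow> T = S"
  by transfer (rule blinfun_eqI)

lemma endo_norm_le: "0 \<le> b \<Longrightarrow> (\<And>x. norm (ap T x) \<le> b * norm x) \<Longrightarrow> norm T \<le> b"
  by transfer (rule norm_blinfun_bound)

lemma tendsto_ap: "T \<longlonglongrightarrow> S \<Longrightarrow> (\<lambda>n. ap (T n) x) \<longlonglongrightarrow> ap S x"
proof -
  assume "T \<longlonglongrightarrow> S"
  then have "(\<lambda>n. Rep_endo (T n)) \<longlonglongrightarrow> Rep_endo S"
    unfolding lim_sequentially dist_endo.rep_eq .
  then show ?thesis unfolding ap.rep_eq by (intro tendsto_intros)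
qed

lift_definition lmul :: "'a::real_normed_algebra \<Rightarrow> 'a endo" is "blinfun_mult_right"
  .

lemma ap_lmul [simp]: "ap (lmul a) x = a * x"
  by transfer simp

locale cstar =
  fixes sc :: "complex \<Rightarrow> 'a::{real_normed_algebra,banach} \<Rightarrow> 'a" and st :: "'a \<Rightarrow> 'a"
  assumes cstar: "cstar_algebra sc st"
begin

lemma sc_one [simp]: "sc 1 x = x"
  and sc_sc: "sc c (sc d x) = sc (c * d) x"
  and sc_add: "sc c (x + y) = sc c x + sc c y"
  and sc_of_real: "sc (complex_of_real r) x = scaleR r x"
  and norm_sc: "norm (sc c x) = cmod c * norm x"
  and st_st [simp]: "st (st x) = x"
  and st_add: "st (x + y) = st x + st y"
  and st_sc: "st (sc c x) = sc (cnj c) (st x)"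
  and st_mult: "st (x * y) = st y * st x"
  and norm_st_mult: "norm (st x * x) = (norm x)\<^sup>2"
  using cstar[unfolded cstar_algebra_def] by simp_all

lemma sc_mult_left: "sc c (x * y) = sc c x * y"
  and sc_mult_right: "sc c (x * y) = x * sc c y"
  using cstar unfolding cstar_algebra_def by metis+

lemma st_scaleR: "st (r *\<^sub>R x) = r *\<^sub>R st x"
  using st_sc[of "complex_of_real r" x] by (simp add: sc_of_real)

lemma st_minus: "st (- x) = - st x"
  using st_scaleR[of "-1" x] by simp

lemma st_diff: "st (x - y) = st x - st y"
  using st_add[of x "- y"] by (simp add: st_minus)

lemma st_zero [simp]: "st 0 = 0"
  using st_scaleR[of 0 0] by simp

lemma norm_st [simp]: "norm (st x) = norm x"
proof -
  have le: "norm y \<le> norm (st y)" for y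
  proof (cases "y = 0")
    case False
    have "norm y * norm y \<le> norm (st y) * norm y"
      using norm_mult_ineq[of "st y" y] norm_st_mult[of y] by (simp add: power2_eq_square)
    then show ?thesis using False by simp
  qed simp
  show ?thesis using le[of x] le[of "st x"] by simp
qed

lemma norm_mult_st: "norm (x * st x) = (norm x)\<^sup>2"
  using norm_st_mult[of "st x"] by simp

lemma st_tendsto: "X \<longlonglongrightarrow> x \<Longrightarrow> (\<lambda>n. st (X n)) \<longlonglongrightarrow> st x"
  by (simp add: lim_sequentially dist_norm flip: st_diff)

lemma st_eqI: "(\<And>y. st y * a = st y * b) \<Longrightarrow> a = b"
proof -
  assume "\<And>y. st y * a = st y * b"
  then have "st (a - b) * (a - b) = 0" by (simp add: algebra_simps)
  then show ?thesis using norm_st_mult[of "a - b"] by simp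
qed

text \<open>Adjoints with respect to the algebra-valued inner product \<open>st x * y\<close>. A
  relation is used instead of an involution because a bounded operator on the algebra need not have
  an adjoint.\<close>

definition adjE :: "'a endo \<Rightarrow> 'a endo \<Rightarrow> bool" where
  "adjE T T' \<longleftrightarrow> (\<forall>x y. st (ap T x) * y = st x * ap T' y)"

lift_definition imE :: "'a endo" is "Blinfun (sc \<i>)" .

lemma ap_imE [simp]: "ap imE x = sc \<i> x"
proof -
  have "bounded_linear (sc \<i>)"
  proof (rule bounded_linear_intro[where K = 1])
    fix r and x :: 'a
    show "sc \<i> (r *\<^sub>R x) = r *\<^sub>R sc \<i> x"
      unfolding sc_of_real[symmetric] sc_sc by (simp add: mult.commute)
  qed (auto simp: sc_add norm_sc)
  then show ?thesis by transfer (simp add: bounded_linear_Blinfun_apply)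
qed

lemma adjE_sym: "adjE T T' \<Longrightarrow> adjE T' T"
  unfolding adjE_def by (metis st_mult st_st)

lemma adjE_norm_sq: "adjE T T' \<Longrightarrow> (norm T)\<^sup>2 \<le> norm (T' * T)"
proof -
  assume T: "adjE T T'"
  have "norm (ap T x) \<le> sqrt (norm (T' * T)) * norm x" for x
  proof -
    have "(norm (ap T x))\<^sup>2 = norm (st x * ap (T' * T) x)"
      using T by (simp add: adjE_def flip: norm_st_mult)
    also have "\<dots> \<le> norm x * (norm (T' * T) * norm x)"
      by (rule order_trans[OF norm_mult_ineq]) (simp add: mult_left_mono ap_norm del: ap_simps)
    also have "\<dots> = (sqrt (norm (T' * T)) * norm x)\<^sup>2"
      by (simp add: power_mult_distrib) (simp add: power2_eq_square)
    finally show ?thesis by (rule power2_le_imp_le) simp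
  qed
  then have "norm T \<le> sqrt (norm (T' * T))" by (intro endo_norm_le) auto
  then show ?thesis by (metis norm_ge_zero real_sqrt_le_iff real_sqrt_power real_sqrt_pow2 power_mono)
qed

lemma adjE_norm: "adjE T T' \<Longrightarrow> norm (T' * T) = (norm T)\<^sup>2"
proof -
  assume T: "adjE T T'"
  have le: "norm S \<le> norm S'" if "adjE S S'" for S S'
  proof (cases "S = 0")
    case False
    have "norm S * norm S \<le> norm S' * norm S"
      using adjE_norm_sq[OF that] norm_mult_ineq[of S' S] by (simp add: power2_eq_square)
    then show ?thesis using False by simp
  qed simp
  have "norm T' = norm T" using le[OF T] le[OF adjE_sym[OF T]] by simp
  then show ?thesis using adjE_norm_sq[OF T] norm_mult_ineq[of T' T] by (simp add: power2_eq_square)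
qed

text \<open>Elements of \<open>endo\<close> are only real linear. Having an adjoint forces complex
  linearity, and this is what makes \<open>imE\<close> central in the sense of
  \<open>J_central\<close>.\<close>

lemma adjE_sc: "adjE T T' \<Longrightarrow> ap T (sc c x) = sc c (ap T x)"
proof (rule st_eqI)
  fix y assume T: "adjE T T'"
  have "st y * ap T (sc c x) = st (ap T' y) * sc c x"
    using adjE_sym[OF T] by (simp add: adjE_def)
  also have "\<dots> = sc c (st y * ap T x)"
    using adjE_sym[OF T] by (simp add: adjE_def flip: sc_mult_right)
  finally show "st y * ap T (sc c x) = st y * sc c (ap T x)" by (simp add: sc_mult_right)
qed

sublocale E: star_ops adjE imE
proof
  fix x x' y y' :: "'a endo" and r :: real
  show "adjE x x' \<Longrightarrow> adjE y y' \<Longrightarrow> adjE (x + y) (x' + y')"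
    by (simp add: adjE_def st_add algebra_simps)
  show "adjE x x' \<Longrightarrow> adjE (r *\<^sub>R x) (r *\<^sub>R x')"
    by (simp add: adjE_def st_scaleR)
  show "adjE x x' \<Longrightarrow> adjE y y' \<Longrightarrow> adjE (x * y) (y' * x')"
    by (simp add: adjE_def)
  show "adjE 1 1" by (simp add: adjE_def)
  show "adjE x x' \<Longrightarrow> adjE x' x" by (rule adjE_sym)
  show "adjE imE (- imE)"
    unfolding adjE_def
  proof (intro allI)
    fix x y
    have "sc (- \<i>) (st x * y) = - sc \<i> (st x * y)"
      using sc_sc[of "-1" \<i>] sc_of_real[of "-1"] by simp
    then show "st (ap imE x) * y = st x * ap (- imE) y"
      by (simp add: st_sc sc_mult_left[symmetric] sc_mult_right[symmetric])
  qed
  show "imE * imE = (- 1 :: 'a endo)"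
    using sc_of_real[of "-1"] by (intro endo_eqI) (simp add: sc_sc)
  show "adjE x x' \<Longrightarrow> imE * x = x * imE"
    by (intro endo_eqI) (simp add: adjE_sc)
  show "adjE x x' \<Longrightarrow> norm (x' * x) = (norm x)\<^sup>2" by (rule adjE_norm)
  show "norm (1 :: 'a endo) \<le> 1" by (rule endo_norm_le) auto
next
  fix X and x :: "'a endo"
  assume X: "\<And>n. adjE (X n) (X n)" and lim: "X \<longlonglongrightarrow> x"
  show "adjE x x" unfolding adjE_def
  proof (intro allI)
    fix v w
    have "(\<lambda>n. st (ap (X n) v) * w) \<longlonglongrightarrow> st (ap x v) * w"
      by (intro tendsto_intros st_tendsto tendsto_ap lim)
    moreover have "(\<lambda>n. st (ap (X n) v) * w) \<longlonglongrightarrow> st v * ap x w"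
      using X unfolding adjE_def by (simp, intro tendsto_intros tendsto_ap lim)
    ultimately show "st (ap x v) * w = st v * ap x w" by (rule LIMSEQ_unique)
  qed
qed

lemma adjE_lmul: "adjE (lmul a) (lmul (st a))"
  by (simp add: adjE_def st_mult mult.assoc)

lemma norm_lmul: "norm (lmul (a::'a)) = norm a"
proof (rule antisym)
  show "norm (lmul a) \<le> norm a" by (rule endo_norm_le) (auto simp: norm_mult_ineq)
  show "norm a \<le> norm (lmul a)"
  proof (cases "a = 0")
    case False
    have "norm a * norm a \<le> norm (lmul a) * norm a"
      using ap_norm[of "lmul a" "st a"] norm_mult_st[of a] by (simp add: power2_eq_square)
    then show ?thesis using False by simp
  qed simp
qed

lemma lmul_add: "lmul (a + b) = lmul a + lmul b"
  and lmul_diff: "lmul (a - b) = lmul a - lmul b"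
  and lmul_scaleR: "lmul (r *\<^sub>R a) = r *\<^sub>R lmul a"
  and lmul_mult: "lmul (a * b) = lmul a * lmul b"
  by (rule endo_eqI, simp add: algebra_simps)+

section \<open>Positive elements of the algebra itself\<close>

definition pos :: "'a \<Rightarrow> bool" where "pos a \<longleftrightarrow> E.pos (lmul a)"

lemma pos_st: "pos a \<Longrightarrow> st a = a"
proof -
  assume "pos a"
  then have "\<forall>x y. st (a * x) * y = st x * (a * y)" by (simp add: pos_def E.pos_def adjE_def)
  then have "st x * (st a * y) = st x * (a * y)" for x y by (simp add: st_mult mult.assoc)
  then have "st a * y = a * y" for y using st_eqI by blast
  then have "(st a - a) * st (st a - a) = 0" by (simp add: algebra_simps)
  then show ?thesis using norm_mult_st[of "st a - a"] by simp
qed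

lemma pos_st_mult: "pos (st b * b)"
  unfolding pos_def lmul_mult using E.pos_adj_mult[OF adjE_lmul] .

lemma cpos_pos: "cpos st a \<Longrightarrow> pos a"
  using pos_st_mult by (auto simp: cpos_def)

lemma pos_zero [simp]: "pos 0" using pos_st_mult[of 0] by simp

lemma pos_add: "pos a \<Longrightarrow> pos b \<Longrightarrow> pos (a + b)"
  unfolding pos_def lmul_add by (rule E.pos_add)

lemma pos_scale: "pos a \<Longrightarrow> r \<ge> 0 \<Longrightarrow> pos (r *\<^sub>R a)"
  unfolding pos_def lmul_scaleR by (rule E.pos_scale)

lemma pos_sum: "(\<And>i. i \<in> S \<Longrightarrow> pos (f i)) \<Longrightarrow> pos (sum f S)"
  by (induction S rule: infinite_finite_induct) (auto intro: pos_add)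

text \<open>In the operator algebra \<open>norm b - a\<close> is the sum of the positive elements
  \<open>norm b - b\<close> and \<open>b - a\<close>.\<close>

lemma pos_mono_norm:
  assumes "pos a" "pos (b - a)" shows "norm a \<le> norm b"
proof -
  have "pos b" using pos_add[OF assms] by simp
  have "E.pos (norm b *\<^sub>R 1 - lmul b)"
    using \<open>pos b\<close> by (intro E.pos_const_minus) (auto simp: pos_def E.pos_def norm_lmul)
  from E.pos_add[OF this] assms(2) have "E.pos (norm b *\<^sub>R 1 - lmul b + lmul (b - a))" by (simp add: pos_def)
  then have "E.pos (norm b *\<^sub>R 1 - lmul a)" by (simp add: lmul_diff)
  then show ?thesis using E.norm_le_of_pos[of "lmul a" "norm b"] assms(1) by (simp add: pos_def norm_lmul)
qed

text \<open>The root \<open>k\<close> of \<open>norm a - a\<close> exists only in the unital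
  operator algebra, but its value \<open>ap k c\<close> lies in the algebra, and the claimed element
  is \<open>st (ap k c) * ap k c\<close>.\<close>

lemma pos_congruence:
  assumes "pos a" shows "pos (norm a *\<^sub>R (st c * c) - st c * a * c)"
proof -
  have "E.pos (norm a *\<^sub>R 1 - lmul a)"
    using assms by (intro E.pos_const_minus) (auto simp: pos_def E.pos_def norm_lmul)
  then obtain k where k: "E.pos k" "k * k = norm a *\<^sub>R 1 - lmul a" using E.pos_sqrt by blast
  have "st (ap k c) * ap k c = st c * ap (k * k) c"
    using k(1) by (simp add: E.pos_def adjE_def)
  also have "\<dots> = norm a *\<^sub>R (st c * c) - st c * a * c"
    by (simp add: k(2) algebra_simps)
  finally show ?thesis using pos_st_mult by metis
qed

text \<open>With an arbitrary witness \<open>t\<close> for each term nothing would pass to the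
  limit; the witness \<open>norm (X n)\<close> converges.\<close>

lemma pos_limit:
  assumes X: "\<And>n. pos (X n)" and lim: "X \<longlonglongrightarrow> a"
  shows "pos a"
proof -
  have lm: "(\<lambda>n. lmul (X n)) \<longlonglongrightarrow> lmul a"
    using lim by (simp add: lim_sequentially dist_norm norm_lmul flip: lmul_diff)
  have "adjE (lmul a) (lmul a)"
    by (rule E.adj_limit[OF _ lm]) (use X in \<open>simp add: pos_def E.pos_def\<close>)
  moreover have "norm (norm a *\<^sub>R 1 - lmul a) \<le> norm a"
  proof (rule LIMSEQ_le)
    show "(\<lambda>n. norm (norm (X n) *\<^sub>R 1 - lmul (X n))) \<longlonglongrightarrow> norm (norm a *\<^sub>R 1 - lmul a)"
      by (intro tendsto_intros lm lim)
    show "(\<lambda>n. norm (X n)) \<longlonglongrightarrow> norm a" by (rule tendsto_norm[OF lim])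
    show "\<exists>N. \<forall>n\<ge>N. norm (norm (X n) *\<^sub>R 1 - lmul (X n)) \<le> norm (X n)"
      using E.pos_norm_diff[OF X[unfolded pos_def]] by (simp add: norm_lmul)
  qed
  ultimately show ?thesis unfolding pos_def E.pos_def using norm_ge_zero by blast
qed

text \<open>Taking $c = a$ and $r$ slightly larger than $\|\alpha\|$ in the hypothesis gives $a^*a \le r\beta$.\<close>

lemma cauchy_schwarz_alg:
  assumes \<alpha>: "pos \<alpha>"
    and all: "\<And>c r. pos (st c * \<alpha> * c - r *\<^sub>R (st c * a + st a * c) + r\<^sup>2 *\<^sub>R \<beta>)"
  shows "pos (norm \<alpha> *\<^sub>R \<beta> - st a * a)"
proof -
  have *: "pos (r *\<^sub>R \<beta> - st a * a)" if r: "r > norm \<alpha>" for r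
  proof -
    have r0: "r > 0" using r norm_ge_zero order.strict_trans1 by blast
    have p1: "pos (norm \<alpha> *\<^sub>R (st a * a) - st a * \<alpha> * a)" by (rule pos_congruence[OF \<alpha>])
    have p2: "pos ((r - norm \<alpha>) *\<^sub>R (st a * a))" using r by (intro pos_scale pos_st_mult) simp
    have "pos (r\<^sup>2 *\<^sub>R \<beta> - r *\<^sub>R (st a * a))"
      using pos_add[OF pos_add[OF p1 p2] all[of a r]] by (simp add: algebra_simps)
    then have "pos ((1/r) *\<^sub>R (r\<^sup>2 *\<^sub>R \<beta> - r *\<^sub>R (st a * a)))" using r0 by (intro pos_scale) auto
    then show ?thesis using r0 by (simp add: scaleR_diff_right power2_eq_square)
  qed
  \<comment> \<open>At \<open>r = norm \<alpha>\<close> itself the division by \<open>r\<close>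
    could fail, since \<alpha> may be zero; hence the approach from above.\<close>
  show ?thesis
  proof (rule pos_limit)
    show "pos ((norm \<alpha> + inverse (real (Suc n))) *\<^sub>R \<beta> - st a * a)" for n by (rule *) simp
    have "(\<lambda>n. (norm \<alpha> + inverse (real (Suc n))) *\<^sub>R \<beta> - st a * a) \<longlonglongrightarrow> (norm \<alpha> + 0) *\<^sub>R \<beta> - st a * a"
      by (intro tendsto_intros LIMSEQ_inverse_real_of_nat)
    then show "(\<lambda>n. (norm \<alpha> + inverse (real (Suc n))) *\<^sub>R \<beta> - st a * a) \<longlonglongrightarrow> norm \<alpha> *\<^sub>R \<beta> - st a * a" by simp
  qed
qed

end

section \<open>Hilbert modules and order-bounded operators\<close>

locale hmod = cstar sc st
  for sc :: "complex \<Rightarrow> 'a::{real_normed_algebra,banach} \<Rightarrow> 'a" and st :: "'a \<Rightarrow> 'a" +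
  fixes scE :: "complex \<Rightarrow> 'e::ab_group_add \<Rightarrow> 'e" and act :: "'e \<Rightarrow> 'a \<Rightarrow> 'e"
    and ip :: "'e \<Rightarrow> 'e \<Rightarrow> 'a"
  assumes ip_add_right: "ip x (y + z) = ip x y + ip x z"
    and ip_scE_right: "ip x (scE c y) = sc c (ip x y)"
    and ip_act_right: "ip x (act y a) = ip x y * a"
    and ip_st: "ip y x = st (ip x y)"
    and ip_pos: "pos (ip x x)"
    and ip_definite: "ip x x = 0 \<Longrightarrow> x = 0"
    and complete_ex: "\<And>X :: nat \<Rightarrow> 'e. (\<And>e. e > 0 \<Longrightarrow> \<exists>N. \<forall>m\<ge>N. \<forall>n\<ge>N. hnorm ip (X m - X n) < e) \<Longrightarrow>
      \<exists>L. \<forall>e>0. \<exists>N. \<forall>n\<ge>N. hnorm ip (X n - L) < e"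

lemma (in cstar) hilbert_module_hmod:
  assumes "hilbert_module sc st scE act ip"
  shows "hmod sc st scE act ip"
proof -
  note hm = assms[unfolded hilbert_module_def]
  have h: "\<forall>x y z. ip x (y + z) = ip x y + ip x z" "\<forall>c x y. ip x (scE c y) = sc c (ip x y)"
    "\<forall>x y a. ip x (act y a) = ip x y * a" "\<forall>x y. ip y x = st (ip x y)" "\<forall>x. cpos st (ip x x)"
    "\<forall>x. ip x x = 0 \<longrightarrow> x = 0"
    and complete: "\<forall>X. (\<forall>e>0. \<exists>N. \<forall>m\<ge>N. \<forall>n\<ge>N. hnorm ip (X m - X n) < e) \<longrightarrow>
        (\<exists>L. \<forall>e>0. \<exists>N::nat. \<forall>n\<ge>N. hnorm ip (X n - L) < e)"
    by (insert hm, elim conjE, assumption)+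
  show ?thesis
  proof
    show "\<exists>L. \<forall>e>0. \<exists>N. \<forall>n\<ge>N. hnorm ip (X n - L) < e"
      if "\<And>e. e > 0 \<Longrightarrow> \<exists>N. \<forall>m\<ge>N. \<forall>n\<ge>N. hnorm ip (X m - X n) < e" for X :: "nat \<Rightarrow> _"
      using complete[THEN spec, of X] that by simp
  qed (rule h(1-4)[rule_format] cpos_pos[OF h(5)[rule_format]] h(6)[rule_format]; assumption?)+
qed

context hmod
begin

section \<open>Inner product and norm of the module\<close>

abbreviation nrm :: "'e \<Rightarrow> real" where "nrm \<equiv> hnorm ip"

definition rs :: "real \<Rightarrow> 'e \<Rightarrow> 'e" where "rs r x = scE (complex_of_real r) x"

lemma ip_add_left: "ip (x + y) z = ip x z + ip y z"
  by (metis ip_st ip_add_right st_add)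

lemma ip_act_left: "ip (act x a) y = st a * ip x y"
  by (metis ip_st ip_act_right st_mult)

lemma ip_zero_right [simp]: "ip x 0 = 0"
  using ip_add_right[of x 0 0] by simp

lemma ip_zero_left [simp]: "ip 0 x = 0"
  using ip_add_left[of 0 0 x] by simp

lemma ip_minus_right: "ip x (- y) = - ip x y"
  using ip_add_right[of x y "- y"] by (simp add: minus_unique)

lemma ip_minus_left: "ip (- x) y = - ip x y"
  using ip_add_left[of x "- x" y] by (simp add: minus_unique)

lemma ip_diff_right: "ip x (y - z) = ip x y - ip x z"
  using ip_add_right[of x y "- z"] by (simp add: ip_minus_right)

lemma ip_diff_left: "ip (x - y) z = ip x z - ip y z"
  using ip_add_left[of x "- y" z] by (simp add: ip_minus_left)

lemma ip_rs_right: "ip x (rs r y) = r *\<^sub>R ip x y"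
  by (simp add: rs_def ip_scE_right sc_of_real)

lemma ip_rs_left: "ip (rs r x) y = r *\<^sub>R ip x y"
  by (metis ip_st ip_rs_right st_scaleR)

lemmas ip_simps = ip_add_left ip_add_right ip_minus_left ip_minus_right ip_diff_left ip_diff_right
  ip_rs_left ip_rs_right ip_act_left ip_act_right

lemma ip_sum_right: "ip x (sum f S) = (\<Sum>i\<in>S. ip x (f i))"
  by (induction S rule: infinite_finite_induct) (auto simp: ip_simps)

lemma ip_sum_left: "ip (sum f S) x = (\<Sum>i\<in>S. ip (f i) x)"
  by (induction S rule: infinite_finite_induct) (auto simp: ip_simps)

text \<open>Testing against all \<open>z\<close> reduces identities in the module to identities in
  the algebra. The laws of \<open>rs\<close> and the linearity of adjointable maps are obtained in
  this way.\<close>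

lemma ip_eqI: "(\<And>z. ip z x = ip z y) \<Longrightarrow> x = y"
  using ip_definite[of "x - y"] by (simp add: ip_simps)

lemma rs_one [simp]: "rs 1 x = x" by (rule ip_eqI) (simp add: ip_simps)
lemma rs_zero_left [simp]: "rs 0 x = 0" by (rule ip_eqI) (simp add: ip_simps)
lemma rs_zero_right [simp]: "rs r 0 = 0" by (rule ip_eqI) (simp add: ip_simps)
lemma rs_rs [simp]: "rs r (rs s x) = rs (r * s) x" by (rule ip_eqI) (simp add: ip_simps)
lemma rs_add: "rs r (x + y) = rs r x + rs r y" by (rule ip_eqI) (simp add: ip_simps algebra_simps)
lemma rs_diff: "rs r (x - y) = rs r x - rs r y" by (rule ip_eqI) (simp add: ip_simps algebra_simps)
lemma rs_add_left: "rs (r + s) x = rs r x + rs s x" by (rule ip_eqI) (simp add: ip_simps algebra_simps)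

lemma nrm_nonneg [simp]: "0 \<le> nrm x" by (simp add: hnorm_def)

lemma nrm_sq: "(nrm x)\<^sup>2 = norm (ip x x)" by (simp add: hnorm_def)

text \<open>This is the inequality in the direct sum of copies of the module indexed by
  \<open>S\<close>. One-element sums give the usual form; the strict convergence of block sums
  relies on longer ones.\<close>

lemma cauchy_schwarz_order:
  "pos (norm (\<Sum>i\<in>S. ip (u i) (u i)) *\<^sub>R (\<Sum>i\<in>S. ip (v i) (v i))
     - st (\<Sum>i\<in>S. ip (u i) (v i)) * (\<Sum>i\<in>S. ip (u i) (v i)))"
proof (rule cauchy_schwarz_alg)
  show "pos (\<Sum>i\<in>S. ip (u i) (u i))" by (intro pos_sum ip_pos)
  fix c r
  have "pos (\<Sum>i\<in>S. ip (act (u i) c - rs r (v i)) (act (u i) c - rs r (v i)))"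
    by (intro pos_sum ip_pos)
  moreover have "st (\<Sum>i\<in>S. ip (u i) (v i)) = (\<Sum>i\<in>S. ip (v i) (u i))"
    by (induction S rule: infinite_finite_induct) (auto simp: st_add ip_st[symmetric])
  then have "(\<Sum>i\<in>S. ip (act (u i) c - rs r (v i)) (act (u i) c - rs r (v i))) =
     st c * (\<Sum>i\<in>S. ip (u i) (u i)) * c - r *\<^sub>R (st c * (\<Sum>i\<in>S. ip (u i) (v i)) + st (\<Sum>i\<in>S. ip (u i) (v i)) * c)
     + r\<^sup>2 *\<^sub>R (\<Sum>i\<in>S. ip (v i) (v i))"
    by (simp add: ip_simps algebra_simps sum.distrib sum_subtractf sum_distrib_left sum_distrib_right
        scaleR_sum_right power2_eq_square)
  ultimately show "pos (st c * (\<Sum>i\<in>S. ip (u i) (u i)) * c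
     - r *\<^sub>R (st c * (\<Sum>i\<in>S. ip (u i) (v i)) + st (\<Sum>i\<in>S. ip (u i) (v i)) * c)
     + r\<^sup>2 *\<^sub>R (\<Sum>i\<in>S. ip (v i) (v i)))" by simp
qed

lemma cauchy_schwarz_sum:
  "(norm (\<Sum>i\<in>S. ip (u i) (v i)))\<^sup>2 \<le> norm (\<Sum>i\<in>S. ip (u i) (u i)) * norm (\<Sum>i\<in>S. ip (v i) (v i))"
  using pos_mono_norm[OF pos_st_mult cauchy_schwarz_order, of u v S] by (simp add: norm_st_mult)

lemma cauchy_schwarz: "norm (ip x y) \<le> nrm x * nrm y"
proof (rule power2_le_imp_le)
  show "(norm (ip x y))\<^sup>2 \<le> (nrm x * nrm y)\<^sup>2"
    using cauchy_schwarz_sum[of "\<lambda>_. x" "\<lambda>_. y" "{()}"] by (simp add: power_mult_distrib nrm_sq)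
qed simp

lemma nrm_triangle: "nrm (x + y) \<le> nrm x + nrm y"
proof (rule power2_le_imp_le)
  have "(nrm (x + y))\<^sup>2 = norm (ip x x + ip x y + (ip y x + ip y y))" by (simp add: nrm_sq ip_simps algebra_simps)
  also have "\<dots> \<le> norm (ip x x) + norm (ip x y) + (norm (ip y x) + norm (ip y y))"
    by (meson add_mono norm_triangle_ineq order_trans)
  also have "\<dots> \<le> (nrm x)\<^sup>2 + nrm x * nrm y + (nrm y * nrm x + (nrm y)\<^sup>2)"
    unfolding nrm_sq by (intro add_mono cauchy_schwarz order_refl)
  also have "\<dots> = (nrm x + nrm y)\<^sup>2" by (simp add: power2_eq_square algebra_simps)
  finally show "(nrm (x + y))\<^sup>2 \<le> (nrm x + nrm y)\<^sup>2" .
qed simp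

lemma nrm_zero [simp]: "nrm 0 = 0" by (simp add: hnorm_def)

lemma nrm_eq_zero: "nrm x = 0 \<Longrightarrow> x = 0"
  using ip_definite by (simp add: hnorm_def)

lemma nrm_minus [simp]: "nrm (- x) = nrm x" by (simp add: hnorm_def ip_simps)

lemma nrm_minus_commute: "nrm (x - y) = nrm (y - x)" using nrm_minus[of "x - y"] by simp

lemma nrm_diff_triangle: "nrm (x - y) \<le> nrm x + nrm y" using nrm_triangle[of x "- y"] by simp

lemma nrm_triangle3: "nrm (x - z) \<le> nrm (x - y) + nrm (y - z)"
  using nrm_triangle[of "x - y" "y - z"] by simp

lemma nrm_rs: "nrm (rs r x) = \<bar>r\<bar> * nrm x"
  by (simp add: hnorm_def ip_simps real_sqrt_mult flip: abs_mult)

lemma nrm_act: "nrm (act x a) \<le> nrm x * norm a"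
proof (rule power2_le_imp_le)
  have "(nrm (act x a))\<^sup>2 = norm (st a * ip x x * a)" by (simp add: nrm_sq ip_simps mult.assoc)
  also have "\<dots> \<le> norm a * norm (ip x x) * norm a"
    by (rule order_trans[OF norm_mult_ineq])
       (metis mult_right_mono norm_ge_zero norm_mult_ineq norm_st)
  finally show "(nrm (act x a))\<^sup>2 \<le> (nrm x * norm a)\<^sup>2"
    by (simp add: power_mult_distrib nrm_sq power2_eq_square[of "norm a"] algebra_simps)
qed simp

lemma nrm_sum: "nrm (sum f S) \<le> (\<Sum>i\<in>S. nrm (f i))"
  by (induction S rule: infinite_finite_induct) (auto intro: order_trans[OF nrm_triangle])

text \<open>The type of the module carries only a group structure, and its norm depends on
  \<open>ip\<close>; convergence is therefore expressed by a real sequence.\<close>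

definition cv :: "(nat \<Rightarrow> 'e) \<Rightarrow> 'e \<Rightarrow> bool" where
  "cv X L \<longleftrightarrow> (\<lambda>n. nrm (X n - L)) \<longlonglongrightarrow> 0"

lemma cv_const: "cv (\<lambda>n. x) x" by (simp add: cv_def)

lemma cv_add: "cv X L \<Longrightarrow> cv Y K \<Longrightarrow> cv (\<lambda>n. X n + Y n) (L + K)"
  unfolding cv_def
proof -
  assume *: "(\<lambda>n. nrm (X n - L)) \<longlonglongrightarrow> 0" "(\<lambda>n. nrm (Y n - K)) \<longlonglongrightarrow> 0"
  show "(\<lambda>n. nrm (X n + Y n - (L + K))) \<longlonglongrightarrow> 0"
  proof (rule tendsto_sandwich[OF _ _ tendsto_const])
    show "(\<lambda>n. nrm (X n - L) + nrm (Y n - K)) \<longlonglongrightarrow> 0" using tendsto_add[OF *] by simp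
    show "\<forall>\<^sub>F n in sequentially. nrm (X n + Y n - (L + K)) \<le> nrm (X n - L) + nrm (Y n - K)"
      using nrm_triangle by (intro always_eventually allI) (metis add_diff_add)
  qed simp
qed

lemma cv_ip_right: "cv X L \<Longrightarrow> (\<lambda>n. ip y (X n)) \<longlonglongrightarrow> ip y L"
proof -
  assume X: "cv X L"
  have "(\<lambda>n. ip y (X n) - ip y L) \<longlonglongrightarrow> 0"
  proof (rule Lim_null_comparison)
    show "(\<lambda>n. nrm y * nrm (X n - L)) \<longlonglongrightarrow> 0"
      using X tendsto_mult_right_zero unfolding cv_def by blast
    show "\<forall>\<^sub>F n in sequentially. norm (ip y (X n) - ip y L) \<le> nrm y * nrm (X n - L)"
      by (simp add: cauchy_schwarz flip: ip_diff_right)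
  qed
  then show ?thesis by (simp add: LIM_zero_iff)
qed

lemma cv_ip_left: "cv X L \<Longrightarrow> (\<lambda>n. ip (X n) y) \<longlonglongrightarrow> ip L y"
  using st_tendsto[OF cv_ip_right] by (simp flip: ip_st)

lemma cv_nrm: "cv X L \<Longrightarrow> (\<lambda>n. nrm (X n)) \<longlonglongrightarrow> nrm L"
proof -
  assume X: "cv X L"
  have "(\<lambda>n. nrm (X n) - nrm L) \<longlonglongrightarrow> 0"
  proof (rule Lim_null_comparison)
    show "(\<lambda>n. nrm (X n - L)) \<longlonglongrightarrow> 0" using X unfolding cv_def .
    have "\<bar>nrm x - nrm y\<bar> \<le> nrm (x - y)" for x y
      using nrm_triangle[of "x - y" y] nrm_triangle[of "y - x" x] nrm_minus_commute[of x y] by simp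
    then show "\<forall>\<^sub>F n in sequentially. norm (nrm (X n) - nrm L) \<le> nrm (X n - L)" by simp
  qed
  then show ?thesis by (simp add: LIM_zero_iff)
qed

lemma cv_unique: "cv X L \<Longrightarrow> cv X K \<Longrightarrow> L = K"
  using cv_ip_right LIMSEQ_unique ip_eqI by metis

lemma cv_Suc: "cv X L \<Longrightarrow> cv (\<lambda>n. X (Suc n)) L"
  unfolding cv_def by (rule LIMSEQ_Suc)

lemma cv_ip_diag:
  assumes "cv X L" "cv Y K" shows "(\<lambda>n. ip (X n) (Y n)) \<longlonglongrightarrow> ip L K"
proof -
  have "(\<lambda>n. ip (X n) (Y n) - ip (X n) K) \<longlonglongrightarrow> 0"
  proof (rule Lim_null_comparison)
    show "(\<lambda>n. nrm (X n) * nrm (Y n - K)) \<longlonglongrightarrow> 0"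
      using tendsto_mult[OF cv_nrm[OF assms(1)] assms(2)[unfolded cv_def]] by simp
    show "\<forall>\<^sub>F n in sequentially. norm (ip (X n) (Y n) - ip (X n) K) \<le> nrm (X n) * nrm (Y n - K)"
      by (simp add: cauchy_schwarz flip: ip_diff_right)
  qed
  from tendsto_add[OF this cv_ip_left[OF assms(1), of K]] show ?thesis by simp
qed

lemma cv_complete:
  assumes "\<And>e. e > 0 \<Longrightarrow> \<exists>N. \<forall>m\<ge>N. \<forall>n\<ge>m. nrm (X n - X m) < e"
  obtains L where "cv X L"
proof -
  have "\<exists>N. \<forall>m\<ge>N. \<forall>n\<ge>N. nrm (X m - X n) < e" if "e > 0" for e
    using assms[OF that] by (metis nrm_minus_commute nle_le)
  from complete_ex[of X, OF this] obtain L where "\<forall>e>0. \<exists>N. \<forall>n\<ge>N. nrm (X n - L) < e" by blast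
  then have "cv X L" unfolding cv_def lim_sequentially by simp
  then show ?thesis using that by blast
qed

lemma cv_summable:
  assumes b: "summable b" and le: "\<And>n. nrm (Y n) \<le> b n"
  obtains L where "cv (\<lambda>n. \<Sum>k<n. Y k) L"
proof (rule cv_complete[of "\<lambda>n. \<Sum>k<n. Y k"])
  fix e :: real assume "e > 0"
  then obtain N where N: "\<And>m n. m \<ge> N \<Longrightarrow> norm (sum b {m..<n}) < e"
    using b unfolding summable_Cauchy by blast
  have "nrm ((\<Sum>k<n. Y k) - (\<Sum>k<m. Y k)) < e" if "m \<ge> N" "n \<ge> m" for m n
  proof -
    have "(\<Sum>k<n. Y k) - (\<Sum>k<m. Y k) = sum Y {m..<n}"
      using that sum_diff_nat_ivl[of 0 m n Y] by (simp add: atLeast0LessThan)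
    then have "nrm ((\<Sum>k<n. Y k) - (\<Sum>k<m. Y k)) \<le> sum b {m..<n}"
      using nrm_sum[of Y "{m..<n}"] sum_mono[of "{m..<n}" "\<lambda>k. nrm (Y k)" b] le by force
    also have "\<dots> < e" using N[OF that(1), of n] by simp
    finally show ?thesis .
  qed
  then show "\<exists>N. \<forall>m\<ge>N. \<forall>n\<ge>m. nrm ((\<Sum>k<n. Y k) - (\<Sum>k<m. Y k)) < e" by blast
qed

section \<open>Adjointable operators and bounds in the order of the algebra\<close>

definition adj :: "('e \<Rightarrow> 'e) \<Rightarrow> ('e \<Rightarrow> 'e) \<Rightarrow> bool" where
  "adj T T' \<longleftrightarrow> (\<forall>x y. ip (T x) y = ip x (T' y))"

lemma adjD: "adj T T' \<Longrightarrow> ip (T x) y = ip x (T' y)" by (simp add: adj_def)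

lemma adj_sym: "adj T T' \<Longrightarrow> adj T' T"
  unfolding adj_def by (metis ip_st)

lemma adjD': "adj T T' \<Longrightarrow> ip (T' x) y = ip x (T y)"
  by (rule adjD[OF adj_sym])

lemma adj_op_add: assumes "adj T T'" shows "T (x + y) = T x + T y"
  by (rule ip_eqI) (simp add: ip_simps flip: adjD'[OF assms])

lemma adj_op_diff: assumes "adj T T'" shows "T (x - y) = T x - T y"
  by (rule ip_eqI) (simp add: ip_simps flip: adjD'[OF assms])

lemma adj_op_rs: assumes "adj T T'" shows "T (rs r x) = rs r (T x)"
  by (rule ip_eqI) (simp add: ip_simps flip: adjD'[OF assms])

lemma adj_op_act: assumes "adj T T'" shows "T (act x a) = act (T x) a"
  by (rule ip_eqI) (simp add: ip_simps flip: adjD'[OF assms])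

lemma adj_op_zero: "adj T T' \<Longrightarrow> T 0 = 0"
  using adj_op_rs[of T T' 0 0] by simp

lemma adj_op_sum: "adj T T' \<Longrightarrow> T (sum f S) = (\<Sum>i\<in>S. T (f i))"
  by (induction S rule: infinite_finite_induct) (auto simp: adj_op_zero adj_op_add)

lemma adj_plus: "adj T T' \<Longrightarrow> adj S S' \<Longrightarrow> adj (\<lambda>x. T x + S x) (\<lambda>x. T' x + S' x)"
  by (simp add: adj_def ip_simps)

lemma adj_minus: "adj T T' \<Longrightarrow> adj S S' \<Longrightarrow> adj (\<lambda>x. T x - S x) (\<lambda>x. T' x - S' x)"
  by (simp add: adj_def ip_simps)

lemma adj_comp: "adj T T' \<Longrightarrow> adj S S' \<Longrightarrow> adj (\<lambda>x. T (S x)) (\<lambda>x. S' (T' x))"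
  by (simp add: adj_def)

lemma adj_rs: "adj T T' \<Longrightarrow> adj (\<lambda>x. rs r (T x)) (\<lambda>x. rs r (T' x))"
  by (simp add: adj_def ip_simps)

lemma adj_id: "adj (\<lambda>x. x) (\<lambda>x. x)" by (simp add: adj_def)

lemma adj_zero: "adj (\<lambda>x. 0) (\<lambda>x. 0)" by (simp add: adj_def)

lemma adj_sum: "(\<And>i. i \<in> S \<Longrightarrow> adj (T i) (T' i)) \<Longrightarrow> adj (\<lambda>x. \<Sum>i\<in>S. T i x) (\<lambda>x. \<Sum>i\<in>S. T' i x)"
  by (simp add: adj_def ip_sum_left ip_sum_right)

lemma adj_limit:
  assumes "\<And>n. adj (T n) (T' n)" "\<And>x. cv (\<lambda>n. T n x) (S x)" "\<And>x. cv (\<lambda>n. T' n x) (S' x)"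
  shows "adj S S'"
  unfolding adj_def
proof (intro allI)
  fix x y
  have "(\<lambda>n. ip (T n x) y) \<longlonglongrightarrow> ip (S x) y" by (rule cv_ip_left[OF assms(2)])
  moreover have "(\<lambda>n. ip (T n x) y) \<longlonglongrightarrow> ip x (S' y)"
    using cv_ip_right[OF assms(3)] adjD[OF assms(1)] by simp
  ultimately show "ip (S x) y = ip x (S' y)" by (rule LIMSEQ_unique)
qed

text \<open>A norm bound alone gives $\langle Tx,Tx\rangle \le K^2\langle x,x\rangle$ only through a square root
  of $K^2 - T^*T$; carrying the bound in the order of the algebra avoids this.\<close>

definition obd :: "('e \<Rightarrow> 'e) \<Rightarrow> real \<Rightarrow> bool" where
  "obd T K \<longleftrightarrow> 0 \<le> K \<and> (\<forall>x. pos (K\<^sup>2 *\<^sub>R ip x x - ip (T x) (T x)))"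

lemma obd_nonneg: "obd T K \<Longrightarrow> 0 \<le> K" by (simp add: obd_def)

lemma obdD: "obd T K \<Longrightarrow> pos (K\<^sup>2 *\<^sub>R ip x x - ip (T x) (T x))" by (simp add: obd_def)

lemma obd_nrm: "obd T K \<Longrightarrow> nrm (T x) \<le> K * nrm x"
proof (rule power2_le_imp_le)
  assume T: "obd T K"
  show "(nrm (T x))\<^sup>2 \<le> (K * nrm x)\<^sup>2"
    using pos_mono_norm[OF ip_pos obdD[OF T]] by (simp add: power_mult_distrib nrm_sq)
qed (simp add: obd_def)

text \<open>Write Q for \<open>T (T' y)\<close>. Adding the square of \<open>K^2 y - Q\<close> to
  the bound for \<open>T\<close> at \<open>T' y\<close> cancels the square of Q and leaves
  \<open>K^2\<close> times the desired expression. Cancelling that factor requires the case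
  \<open>K = 0\<close> to be treated apart.\<close>

lemma obd_adj:
  assumes T: "obd T K" and a: "adj T T'"
  shows "obd T' K"
  unfolding obd_def
proof (intro conjI allI)
  show K: "0 \<le> K" using T by (simp add: obd_def)
  fix y
  show "pos (K\<^sup>2 *\<^sub>R ip y y - ip (T' y) (T' y))"
  proof (cases "K = 0")
    case True
    then have "T x = 0" for x using obd_nrm[OF T, of x] nrm_eq_zero[of "T x"] nrm_nonneg[of "T x"] by simp
    then have "T' y = 0" using adjD[OF a] by (intro ip_eqI) (metis ip_zero_left ip_zero_right)
    then show ?thesis using True by simp
  next
    case False
    let ?Q = "T (T' y)"
    have "pos (K\<^sup>2 *\<^sub>R ip (T' y) (T' y) - ip ?Q ?Q + ip (rs (K\<^sup>2) y - ?Q) (rs (K\<^sup>2) y - ?Q))"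
      by (intro pos_add ip_pos obdD[OF T])
    moreover have "ip y ?Q = ip (T' y) (T' y)" "ip ?Q y = ip (T' y) (T' y)"
      using adjD[OF a] adjD[OF adj_sym[OF a]] by simp_all
    ultimately have "pos (K\<^sup>2 *\<^sub>R (K\<^sup>2 *\<^sub>R ip y y - ip (T' y) (T' y)))"
      by (simp add: ip_simps algebra_simps)
    then have "pos ((1/K\<^sup>2) *\<^sub>R (K\<^sup>2 *\<^sub>R (K\<^sup>2 *\<^sub>R ip y y - ip (T' y) (T' y))))" by (rule pos_scale) simp
    then show ?thesis using False by simp
  qed
qed

lemma obd_mono:
  assumes "obd T K" "K \<le> L" shows "obd T L"
  unfolding obd_def
proof (intro conjI allI)
  show "0 \<le> L" using assms obd_nonneg by force
  fix x
  have "K\<^sup>2 \<le> L\<^sup>2" using assms obd_nonneg by (simp add: power_mono)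
  then have "pos ((L\<^sup>2 - K\<^sup>2) *\<^sub>R ip x x)" by (intro pos_scale ip_pos) simp
  from pos_add[OF this obdD[OF assms(1), of x]] show "pos (L\<^sup>2 *\<^sub>R ip x x - ip (T x) (T x))"
    by (simp add: algebra_simps)
qed

text \<open>The square of \<open>L T x - K S x\<close> absorbs the cross terms. Divided by
  \<open>K L\<close> it combines with the two given bounds, weighted by \<open>1 + L/K\<close> and
  \<open>1 + K/L\<close>, to exactly \<open>(K + L)^2\<close>. The divisions force strict
  positivity, which \<open>obd_closed\<close> removes in \<open>obd_add\<close>.\<close>

lemma obd_add_strict:
  assumes T: "obd T K" and S: "obd S L" and KL: "K > 0" "L > 0"
  shows "obd (\<lambda>x. T x + S x) (K + L)"
  unfolding obd_def
proof (intro conjI allI)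
  show "0 \<le> K + L" using KL by simp
  fix x
  define v where "v = rs L (T x) - rs K (S x)"
  have p: "pos ((1/(K*L)) *\<^sub>R ip v v + (1 + L/K) *\<^sub>R (K\<^sup>2 *\<^sub>R ip x x - ip (T x) (T x))
      + (1 + K/L) *\<^sub>R (L\<^sup>2 *\<^sub>R ip x x - ip (S x) (S x)))"
    using KL by (intro pos_add pos_scale ip_pos obdD[OF T] obdD[OF S]) (auto simp: add_nonneg_nonneg)
  have e1: "(1/(K*L)) *\<^sub>R ip v v =
     (L/K) *\<^sub>R ip (T x) (T x) + (K/L) *\<^sub>R ip (S x) (S x) - ip (T x) (S x) - ip (S x) (T x)"
    using KL by (simp add: v_def ip_simps scaleR_diff_right algebra_simps)
  have e2: "(1 + L/K) *\<^sub>R (K\<^sup>2 *\<^sub>R ip x x - ip (T x) (T x))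
     = (K\<^sup>2 + K * L) *\<^sub>R ip x x - ip (T x) (T x) - (L/K) *\<^sub>R ip (T x) (T x)"
    using KL by (simp add: algebra_simps power2_eq_square)
  have e3: "(1 + K/L) *\<^sub>R (L\<^sup>2 *\<^sub>R ip x x - ip (S x) (S x))
     = (L\<^sup>2 + K * L) *\<^sub>R ip x x - ip (S x) (S x) - (K/L) *\<^sub>R ip (S x) (S x)"
    using KL by (simp add: algebra_simps power2_eq_square)
  have sq: "(K + L)\<^sup>2 = (K\<^sup>2 + K * L) + (L\<^sup>2 + K * L)" by (simp add: power2_eq_square algebra_simps)
  show "pos ((K + L)\<^sup>2 *\<^sub>R ip x x - ip (T x + S x) (T x + S x))"
    using p[unfolded e1 e2 e3] unfolding sq scaleR_add_left by (simp add: ip_simps algebra_simps)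
qed

lemma obd_closed:
  assumes "\<And>d. d > 0 \<Longrightarrow> obd T (K + d)" and K: "0 \<le> K"
  shows "obd T K"
  unfolding obd_def
proof (intro conjI allI K)
  fix x
  show "pos (K\<^sup>2 *\<^sub>R ip x x - ip (T x) (T x))"
  proof (rule pos_limit)
    show "pos ((K + inverse (real (Suc n)))\<^sup>2 *\<^sub>R ip x x - ip (T x) (T x))" for n
      by (rule obdD[OF assms(1)]) simp
    have "(\<lambda>n. (K + inverse (real (Suc n)))\<^sup>2 *\<^sub>R ip x x - ip (T x) (T x))
      \<longlonglongrightarrow> (K + 0)\<^sup>2 *\<^sub>R ip x x - ip (T x) (T x)"
      by (intro tendsto_intros LIMSEQ_inverse_real_of_nat)
    then show "(\<lambda>n. (K + inverse (real (Suc n)))\<^sup>2 *\<^sub>R ip x x - ip (T x) (T x))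
      \<longlonglongrightarrow> K\<^sup>2 *\<^sub>R ip x x - ip (T x) (T x)" by simp
  qed
qed

lemma obd_add:
  assumes T: "obd T K" and S: "obd S L"
  shows "obd (\<lambda>x. T x + S x) (K + L)"
proof (rule obd_closed)
  fix d :: real assume "d > 0"
  then have "obd (\<lambda>x. T x + S x) ((K + d/2) + (L + d/2))"
    using obd_nonneg[OF T] obd_nonneg[OF S]
    by (intro obd_add_strict obd_mono[OF T] obd_mono[OF S]) auto
  then show "obd (\<lambda>x. T x + S x) (K + L + d)" by (simp add: add_ac)
qed (use obd_nonneg[OF T] obd_nonneg[OF S] in simp)

lemma obd_uminus: "obd T K \<Longrightarrow> obd (\<lambda>x. - T x) K"
  by (simp add: obd_def ip_simps)

lemma obd_diff: "obd T K \<Longrightarrow> obd S L \<Longrightarrow> obd (\<lambda>x. T x - S x) (K + L)"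
  using obd_add[OF _ obd_uminus, of T K S L] by simp

lemma obd_comp:
  assumes T: "obd T K" and S: "obd S L"
  shows "obd (\<lambda>x. T (S x)) (K * L)"
  unfolding obd_def
proof (intro conjI allI)
  show "0 \<le> K * L" using obd_nonneg T S by simp
  fix x
  have "pos ((K\<^sup>2 *\<^sub>R ip (S x) (S x) - ip (T (S x)) (T (S x))) + K\<^sup>2 *\<^sub>R (L\<^sup>2 *\<^sub>R ip x x - ip (S x) (S x)))"
    by (intro pos_add pos_scale obdD[OF T] obdD[OF S]) simp
  then show "pos ((K * L)\<^sup>2 *\<^sub>R ip x x - ip (T (S x)) (T (S x)))"
    by (simp add: algebra_simps power_mult_distrib)
qed

lemma obd_rs: "obd T K \<Longrightarrow> obd (\<lambda>x. rs r (T x)) (\<bar>r\<bar> * K)"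
proof -
  assume T: "obd T K"
  have "obd (rs r) \<bar>r\<bar>" by (simp add: obd_def ip_simps power2_eq_square)
  from obd_comp[OF this T] show ?thesis .
qed

lemma obd_id: "obd (\<lambda>x. x) 1" by (simp add: obd_def)
lemma obd_zero: "obd (\<lambda>x. 0) 0" by (simp add: obd_def)

lemma obd_limit:
  assumes "\<And>n. obd (T n) K" "\<And>x. cv (\<lambda>n. T n x) (S x)"
  shows "obd S K"
  unfolding obd_def
proof (intro conjI allI)
  show "0 \<le> K" using obd_nonneg assms by blast
  fix x
  show "pos (K\<^sup>2 *\<^sub>R ip x x - ip (S x) (S x))"
    by (rule pos_limit[OF obdD[OF assms(1)]]) (rule tendsto_diff[OF tendsto_const cv_ip_diag[OF assms(2) assms(2)]])
qed

lemma obd_sum: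
  fixes n :: nat
  assumes "\<And>k. k < n \<Longrightarrow> obd (T k) (b k)"
  shows "obd (\<lambda>x. \<Sum>k<n. T k x) (\<Sum>k<n. b k)"
  using assms
proof (induction n)
  case (Suc n)
  have "obd (\<lambda>x. (\<Sum>k<n. T k x) + T n x) ((\<Sum>k<n. b k) + b n)"
    using Suc by (intro obd_add) auto
  then show ?case by simp
qed (simp add: obd_zero)

text \<open>The tails are bounded in the order sense for every \<open>n\<close>: the case
  \<open>n = 0\<close> bounds the sum itself, and large \<open>n\<close> gives the approximation by
  finite-rank operators used in \<open>eu_compl_compact\<close>.\<close>

lemma op_series:
  assumes a: "\<And>k. adj (T k) (T' k)" and b: "\<And>k. obd (T k) (b k)" and sm: "summable b"
  shows "\<exists>S S'. adj S S' \<and> (\<forall>n. obd (\<lambda>x. S x - (\<Sum>k<n. T k x)) (\<Sum>k. b (k + n))) \<and>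
    (\<forall>x. cv (\<lambda>n. \<Sum>k<n. T k x) (S x)) \<and> (\<forall>x. cv (\<lambda>n. \<Sum>k<n. T' k x) (S' x))"
proof -
  have ex: "\<exists>L. cv (\<lambda>n. \<Sum>k<n. U k x) L" if U: "\<And>k. obd (U k) (b k)" for U :: "nat \<Rightarrow> 'e \<Rightarrow> 'e" and x
  proof -
    obtain L where "cv (\<lambda>n. \<Sum>k<n. U k x) L"
      by (rule cv_summable[OF summable_mult2[OF sm] obd_nrm[OF U]])
    then show ?thesis by blast
  qed
  obtain S where S: "\<And>x. cv (\<lambda>n. \<Sum>k<n. T k x) (S x)" using ex[OF b] by metis
  obtain S' where S': "\<And>x. cv (\<lambda>n. \<Sum>k<n. T' k x) (S' x)" using ex[OF obd_adj[OF b a]] by metis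
  have "adj S S'" by (rule adj_limit[OF adj_sum[OF a] S S'])
  moreover have "obd (\<lambda>x. S x - (\<Sum>k<n. T k x)) (\<Sum>k. b (k + n))" for n
  proof (rule obd_limit)
    have smn: "summable (\<lambda>k. b (k + n))" using sm by (simp add: summable_iff_shift)
    have "(\<Sum>k<m. b (k + n)) \<le> (\<Sum>k. b (k + n))" for m
      using obd_nonneg[OF b] by (intro sum_le_suminf[OF smn]) auto
    then show "obd (\<lambda>x. \<Sum>k<m. T (k + n) x) (\<Sum>k. b (k + n))" for m
      by (rule obd_mono[OF obd_sum[OF b]])
    fix x
    have "(\<Sum>k<m + n. T k x) + - (\<Sum>k<n. T k x) = (\<Sum>k<m. T (k + n) x)" for m
      by (induction m) (auto simp: algebra_simps)
    moreover have "cv (\<lambda>m. (\<Sum>k<m + n. T k x)) (S x)"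
      using S[of x] unfolding cv_def by (rule LIMSEQ_ignore_initial_segment)
    ultimately show "cv (\<lambda>m. \<Sum>k<m. T (k + n) x) (S x - (\<Sum>k<n. T k x))"
      using cv_add[OF _ cv_const[of "- (\<Sum>k<n. T k x)"], of "\<lambda>m. \<Sum>k<m + n. T k x" "S x"] by simp
  qed
  ultimately show ?thesis using S S' by blast
qed

lemma cv_op: "obd T K \<Longrightarrow> adj T T' \<Longrightarrow> cv X L \<Longrightarrow> cv (\<lambda>n. T (X n)) (T L)"
  unfolding cv_def
proof (rule tendsto_sandwich[OF _ _ tendsto_const])
  assume T: "obd T K" "adj T T'" and X: "(\<lambda>n. nrm (X n - L)) \<longlonglongrightarrow> 0"
  show "(\<lambda>n. K * nrm (X n - L)) \<longlonglongrightarrow> 0" using X by (rule tendsto_mult_right_zero)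
  show "\<forall>\<^sub>F n in sequentially. nrm (T (X n) - T L) \<le> K * nrm (X n - L)"
    using obd_nrm[OF T(1)] by (intro always_eventually allI) (metis adj_op_diff[OF T(2)])
qed simp

section \<open>Positive operators and their resolvents\<close>

definition posop :: "('e \<Rightarrow> 'e) \<Rightarrow> bool" where
  "posop H \<longleftrightarrow> adj H H \<and> (\<forall>x. pos (ip x (H x)))"

text \<open>The resolvent (H + e)^{-1} as a total function. It is a two-sided inverse once
  \<open>shift_inj\<close> and \<open>shift_surj\<close> are known.\<close>

definition res :: "('e \<Rightarrow> 'e) \<Rightarrow> real \<Rightarrow> 'e \<Rightarrow> 'e" where
  "res H e = inv (\<lambda>y. H y + rs e y)"

context
  fixes H :: "'e \<Rightarrow> 'e" and K e :: real
  assumes H: "posop H" and HK: "obd H K" and e: "e > 0"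
begin

lemma posop_adj: "adj H H" using H by (simp add: posop_def)

lemma ip_H_commute: "ip (H x) x = ip x (H x)" using adjD[OF posop_adj] .

lemma shift_lower_bound: "pos (ip (H y + rs e y) (H y + rs e y) - e\<^sup>2 *\<^sub>R ip y y)"
proof -
  have "pos (ip (H y) (H y) + (2 * e) *\<^sub>R ip y (H y))"
    using H e by (intro pos_add pos_scale ip_pos) (auto simp: posop_def)
  moreover have "ip (H y + rs e y) (H y + rs e y) - e\<^sup>2 *\<^sub>R ip y y = ip (H y) (H y) + (2 * e) *\<^sub>R ip y (H y)"
    by (simp add: ip_simps ip_H_commute power2_eq_square algebra_simps) (simp add: scaleR_2 flip: scaleR_scaleR scaleR_add_right)
  ultimately show ?thesis by simp
qed

lemma shift_inj: "inj (\<lambda>y. H y + rs e y)"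
proof (rule injI)
  fix x y assume "H x + rs e x = H y + rs e y"
  then have "H (x - y) + rs e (x - y) = 0" by (simp add: adj_op_diff[OF posop_adj] rs_diff add_diff_add[symmetric])
  then have "pos (- (e\<^sup>2 *\<^sub>R ip (x - y) (x - y)))" using shift_lower_bound[of "x - y"] by simp
  then have "norm (e\<^sup>2 *\<^sub>R ip (x - y) (x - y)) \<le> norm (0::'a)"
    by (intro pos_mono_norm pos_scale ip_pos) auto
  then have "ip (x - y) (x - y) = 0" using e by (simp add: mult_le_0_iff)
  then show "x = y" using ip_definite[of "x - y"] by simp
qed

text \<open>A Neumann series for \<open>t (H + e)\<close>. With
  \<open>G = 1 - t (H + e) = c - t H\<close> and \<open>c \<ge> 0\<close>, positivity of
  \<open>H\<close> gives the cross term a favourable sign, so \<open>G\<close> has norm at most the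
  root of \<open>c^2 + t^2 K^2\<close>.\<close>

lemma shift_surj: "\<exists>y. H y + rs e y = x"
proof -
  \<comment> \<open>The value \<open>t = e / D\<close> minimises
    \<open>(1 - t e)^2 + t^2 K^2\<close>; the minimum is \<open>1 - e^2 / D\<close>, which is below
    one.\<close>
  define D where "D = e\<^sup>2 + K\<^sup>2"
  define t where "t = e / D"
  define c where "c = 1 - t * e"
  define k2 where "k2 = c\<^sup>2 + t\<^sup>2 * K\<^sup>2"
  have D: "D > 0" using e by (simp add: D_def add_pos_nonneg)
  have t: "t > 0" using D e by (simp add: t_def)
  have c: "0 \<le> c" using D by (simp add: c_def t_def D_def field_simps power2_eq_square)
  have "k2 = 1 - e\<^sup>2 / D"
  proof -
    have "k2 = 1 - 2 * (t * e) + t\<^sup>2 * D" by (simp add: k2_def c_def D_def power2_eq_square algebra_simps)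
    moreover have "t\<^sup>2 * D = e\<^sup>2 / D" "t * e = e\<^sup>2 / D" using D by (simp_all add: t_def power2_eq_square)
    ultimately show ?thesis by simp
  qed
  moreover have "0 \<le> k2" by (simp add: k2_def)
  ultimately have k: "0 \<le> k2" "k2 < 1" using D e by simp_all
  define G where "G v = v - rs t (H v + rs e v)" for v
  have Gn: "nrm (G v) \<le> sqrt k2 * nrm v" for v
  proof (rule power2_le_imp_le)
    have Gv: "G v = rs c v - rs t (H v)"
      by (simp add: G_def c_def rs_add rs_diff) (rule ip_eqI, simp add: ip_simps algebra_simps)
    have "pos (t\<^sup>2 *\<^sub>R (K\<^sup>2 *\<^sub>R ip v v - ip (H v) (H v)) + (2 * c * t) *\<^sub>R ip v (H v))"
      using H c t by (intro pos_add pos_scale obdD[OF HK]) (auto simp: posop_def)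
    then have "pos (k2 *\<^sub>R ip v v - ip (G v) (G v))"
      unfolding Gv by (simp add: ip_simps ip_H_commute k2_def power2_eq_square algebra_simps)
         (simp add: scaleR_2 scaleR_add_right add_ac flip: scaleR_scaleR)
    from pos_mono_norm[OF ip_pos this] show "(nrm (G v))\<^sup>2 \<le> (sqrt k2 * nrm v)\<^sup>2"
      using k by (simp add: power_mult_distrib nrm_sq)
  qed (use k in simp)
  define g where "g n = (G ^^ n) (rs t x)" for n
  have gn: "nrm (g n) \<le> sqrt k2 ^ n * nrm (rs t x)" for n
  proof (induction n)
    case (Suc n)
    have "nrm (g (Suc n)) \<le> sqrt k2 * nrm (g n)" using Gn[of "g n"] by (simp add: g_def)
    also have "\<dots> \<le> sqrt k2 * (sqrt k2 ^ n * nrm (rs t x))" using Suc k by (intro mult_left_mono) auto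
    finally show ?case by simp
  qed (simp add: g_def)
  have sm: "summable (\<lambda>n. sqrt k2 ^ n * nrm (rs t x))" using k by (intro summable_mult2 summable_geometric) simp
  obtain y where y: "cv (\<lambda>n. \<Sum>k<n. g k) y" by (rule cv_summable[OF sm gn])
  have "rs t (H (\<Sum>k<n. g k) + rs e (\<Sum>k<n. g k)) + g n = rs t x" for n
  proof (induction n)
    case 0
    then show ?case by (simp add: g_def adj_op_zero[OF posop_adj])
  next
    case (Suc n)
    have "g (Suc n) = g n - rs t (H (g n) + rs e (g n))" by (simp add: g_def G_def)
    moreover have "rs t (H (v + w) + rs e (v + w)) = rs t (H v + rs e v) + rs t (H w + rs e w)" for v w
      by (simp add: adj_op_add[OF posop_adj] rs_add add_ac)
    ultimately show ?case using Suc by simp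
  qed
  note inv = this
  have "cv g 0"
    unfolding cv_def
  proof (rule tendsto_sandwich[OF _ _ tendsto_const])
    show "(\<lambda>n. sqrt k2 ^ n * nrm (rs t x)) \<longlonglongrightarrow> 0" by (rule summable_LIMSEQ_zero[OF sm])
  qed (use gn in auto)
  have rsop: "obd (rs r) \<bar>r\<bar>" "adj (rs r) (rs r)" for r
    using obd_rs[OF obd_id] adj_rs[OF adj_id] by simp_all
  have "cv (\<lambda>n. rs t (H (\<Sum>k<n. g k) + rs e (\<Sum>k<n. g k)) + g n) (rs t (H y + rs e y) + 0)"
    by (intro cv_add \<open>cv g 0\<close> cv_op[OF rsop] cv_op[OF HK posop_adj] y)
  then have "rs t (H y + rs e y) = rs t x" unfolding inv using cv_unique[OF _ cv_const] by simp
  then have "rs (1/t) (rs t (H y + rs e y)) = rs (1/t) (rs t x)" by simp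
  then show ?thesis using t by auto
qed

lemma res_right: "H (res H e x) + rs e (res H e x) = x"
proof -
  have "surj (\<lambda>y. H y + rs e y)" using shift_surj by (auto simp: surj_def) metis
  then show ?thesis unfolding res_def using surj_f_inv_f by fast
qed

lemma res_left: "res H e (H y + rs e y) = y"
  unfolding res_def using inv_f_f[OF shift_inj] by fast

lemma res_adj: "adj (res H e) (res H e)"
  unfolding adj_def
proof (intro allI)
  fix x y
  let ?u = "res H e x" and ?v = "res H e y"
  have "ip ?u (H ?v + rs e ?v) = ip (H ?u + rs e ?u) ?v"
    by (simp add: ip_simps adjD[OF posop_adj])
  then show "ip ?u y = ip x ?v" by (simp add: res_right)
qed

lemma res_obd: "obd (res H e) (1/e)"
  unfolding obd_def
proof (intro conjI allI)
  fix x
  let ?u = "res H e x"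
  have "pos ((1/e)\<^sup>2 *\<^sub>R (ip x x - e\<^sup>2 *\<^sub>R ip ?u ?u))"
    using shift_lower_bound[of ?u] by (intro pos_scale) (simp_all add: res_right)
  then show "pos ((1/e)\<^sup>2 *\<^sub>R ip x x - ip ?u ?u)" using e by (simp add: scaleR_diff_right power_divide)
qed (use e in simp)

end

end

section \<open>Ideals and the quotient seminorm\<close>

text \<open>Seen as a module over itself, the algebra inherits the resolvent calculus for left
  multiplications; approximate units of ideals are built from it.\<close>

lemma (in cstar) hmod_self: "hmod sc st sc (*) (\<lambda>x y. st x * y)"
proof
  have nrm: "hnorm (\<lambda>x y. st x * y) x = norm x" for x
    by (simp add: hnorm_def norm_st_mult)
  have complete: "\<exists>L. \<forall>e>0. \<exists>N. \<forall>n\<ge>N. norm (X n - L) < e"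
    if "\<forall>e>0. \<exists>N. \<forall>m\<ge>N. \<forall>n\<ge>N. norm (X m - X n) < e" for X :: "nat \<Rightarrow> 'a"
  proof -
    have "Cauchy X" using that by (auto intro: CauchyI)
    then obtain L where "X \<longlonglongrightarrow> L" using Cauchy_convergent convergent_def by blast
    then show ?thesis unfolding LIMSEQ_iff by blast
  qed
  show "x = 0" if "st x * x = 0" for x using norm_st_mult[of x] that by simp
  show "\<exists>L. \<forall>e>0. \<exists>N. \<forall>n\<ge>N. hnorm (\<lambda>x y. st x * y) (X n - L) < e"
    if "\<And>e. e > 0 \<Longrightarrow> \<exists>N. \<forall>m\<ge>N. \<forall>n\<ge>N. hnorm (\<lambda>x y. st x * y) (X m - X n) < e" for X :: "nat \<Rightarrow> 'a"
    using that complete[of X] by (simp add: nrm)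
qed (simp_all add: distrib_left mult.assoc st_mult pos_st_mult flip: sc_mult_right)

lemma (in cstar) nrm_self: "hnorm (\<lambda>x y. st x * y) x = norm x"
  by (simp add: hnorm_def norm_st_mult)

lemma (in cstar) left_faithful:
  fixes a b :: 'a
  assumes "\<And>y. a * y = b * y" shows "a = b"
proof -
  have "(a - b) * st (a - b) = 0" by (simp add: left_diff_distrib assms)
  then show ?thesis using norm_mult_st[of "a - b"] by simp
qed

locale cstar_ideal = cstar +
  fixes I :: "'a set"
  assumes ideal: "closed_ideal sc I"
begin

lemma I_zero: "0 \<in> I"
  and I_add: "x \<in> I \<Longrightarrow> y \<in> I \<Longrightarrow> x + y \<in> I"
  and I_sc: "x \<in> I \<Longrightarrow> sc c x \<in> I"
  and I_left: "x \<in> I \<Longrightarrow> a * x \<in> I"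
  and I_right: "x \<in> I \<Longrightarrow> x * a \<in> I"
  and I_closed: "closed I"
  using ideal by (simp_all add: closed_ideal_def)

lemma I_scaleR: "x \<in> I \<Longrightarrow> r *\<^sub>R x \<in> I"
  using I_sc[of x "complex_of_real r"] by (simp add: sc_of_real)

lemma I_diff: "x \<in> I \<Longrightarrow> y \<in> I \<Longrightarrow> x - y \<in> I"
  using I_add[of x "(-1) *\<^sub>R y"] I_scaleR[of y "-1"] by simp

lemma I_minus: "x \<in> I \<Longrightarrow> - x \<in> I"
  using I_scaleR[of x "-1"] by simp

lemma I_limit: "(\<And>n. X n \<in> I) \<Longrightarrow> X \<longlonglongrightarrow> x \<Longrightarrow> x \<in> I"
  using I_closed closed_sequentially by blast

lemma I_approx: "(\<And>e. e > 0 \<Longrightarrow> \<exists>i\<in>I. norm (x - i) \<le> e) \<Longrightarrow> x \<in> I"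
proof -
  assume "\<And>e. e > 0 \<Longrightarrow> \<exists>i\<in>I. norm (x - i) \<le> e"
  then have "\<forall>e>0. \<exists>i\<in>I. dist i x < e"
    by (metis dist_commute dist_norm field_lbound_gt_zero order_le_less_trans)
  then show ?thesis using I_closed closed_approachable by blast
qed

text \<open>The witness is $u = (j + \delta)^{-1} j$ with $j = i^*i$, for which $j - ju = \delta u$.\<close>

lemma approximate_unit:
  assumes i: "i \<in> I" and e: "e > 0"
  obtains u where "u \<in> I" "st u = u" "\<And>v. norm (v - u * v) \<le> norm v" "\<And>v. norm (v - v * u) \<le> norm v"
    "norm (i - i * u) \<le> e"
proof -
  interpret A: hmod sc st sc "(*)" "\<lambda>x y. st x * y" by (rule hmod_self)
  define j where "j = st i * i"
  \<comment> \<open>The error satisfies \<open>st (i - i u) (i - i u) = d (u - u u)\<close>, of norm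
    at most \<open>d\<close> times \<open>norm u\<close>. With the crude bound
    \<open>norm u \<le> 2\<close> this is at most \<open>2 d = e^2\<close>.\<close>
  define d where "d = e\<^sup>2 / 2"
  have d: "d > 0" using e by (simp add: d_def)
  define H where "H = (\<lambda>x. j * x)"
  have stj: "st j = j" by (simp add: j_def st_mult)
  have adjH: "A.adj H H" by (simp add: A.adj_def H_def st_mult stj mult.assoc)
  have "pos (st x * (j * x))" for x
    using pos_st_mult[of "i * x"] by (simp add: j_def st_mult mult.assoc)
  then have H: "A.posop H" using adjH by (simp add: A.posop_def H_def)
  have HK: "A.obd H (norm j)"
    unfolding A.obd_def
  proof (intro conjI allI)
    fix x
    show "pos ((norm j)\<^sup>2 *\<^sub>R (st x * x) - st (H x) * H x)"
      using pos_congruence[OF pos_st_mult[of j], of x] by (simp add: norm_st_mult H_def st_mult mult.assoc)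
  qed simp
  define R where "R = A.res H d"
  have Rr: "H (R x) + d *\<^sub>R R x = x" for x
    using A.res_right[OF H HK d, of x] by (simp add: R_def A.rs_def sc_of_real)
  have Rl: "R (H x + d *\<^sub>R x) = x" for x
    using A.res_left[OF H HK d, of x] by (simp add: R_def A.rs_def sc_of_real)
  have aR: "A.adj R R" unfolding R_def by (rule A.res_adj[OF H HK d])
  have RH: "R (H x) = H (R x)" for x
  proof -
    have "R (H x) + d *\<^sub>R R x = R (H x + d *\<^sub>R x)"
      using A.adj_op_add[OF aR] A.adj_op_rs[OF aR, of d x] by (simp add: A.rs_def sc_of_real)
    then show ?thesis using Rr[of x] Rl[of x] by (metis add_right_cancel)
  qed
  define u where "u = R j"
  have uv: "u * v = H (R v)" for v
    using A.adj_op_act[OF aR, of j v] RH[of v] by (simp add: u_def H_def)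
  have eq: "j * u + d *\<^sub>R u = j" using Rr[of j] by (simp add: u_def H_def)
  have jI: "j \<in> I" unfolding j_def by (rule I_left[OF i])
  have uI: "u \<in> I"
  proof -
    have "d *\<^sub>R u = j - j * u" using eq by (metis add_diff_cancel_left')
    then have "u = (1/d) *\<^sub>R (j - j * u)" using d by (metis divide_self less_irrefl scaleR_one scaleR_scaleR times_divide_eq_left mult_1)
    also have "\<dots> \<in> I" by (intro I_scaleR I_diff jI I_right)
    finally show ?thesis .
  qed
  have stu: "st u = u"
  proof (rule left_faithful)
    fix y
    have "st u * y = st j * R y" using A.adjD[OF aR, of j y] by (simp add: u_def)
    then show "st u * y = u * y" by (simp add: uv H_def stj)
  qed
  have left: "norm (v - u * v) \<le> norm v" for v
  proof -
    have "v - u * v = d *\<^sub>R R v" using Rr[of v] uv[of v] by (metis add_diff_cancel_left')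
    then have "norm (v - u * v) = d * norm (R v)" using d by simp
    also have "norm (R v) \<le> 1/d * norm v"
      using A.obd_nrm[OF A.res_obd[OF H HK d], of v] by (simp add: nrm_self R_def)
    finally show ?thesis using d by simp
  qed
  have right: "norm (v - v * u) \<le> norm v" for v
  proof -
    have "st (v - v * u) = st v - u * st v" by (simp add: st_diff st_mult stu)
    then show ?thesis using left[of "st v"] by (metis norm_st)
  qed
  have "norm u \<le> 2"
  proof (cases "u = 0")
    case False
    have "norm u * norm u = norm (u * u)" using norm_st_mult[of u] stu by (simp add: power2_eq_square)
    also have "\<dots> \<le> norm u + norm (u - u * u)" using norm_triangle_ineq4[of u "u - u * u"] by simp
    also have "\<dots> \<le> 2 * norm u" using left[of u] by simp
    finally show ?thesis using False by simp
  qed simp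
  have "(norm (i - i * u))\<^sup>2 = norm (st (i - i * u) * (i - i * u))" by (simp add: norm_st_mult)
  also have "st (i - i * u) * (i - i * u) = (j - j * u) - u * (j - j * u)"
    by (simp add: st_diff st_mult stu j_def algebra_simps)
  also have "j - j * u = d *\<^sub>R u" using eq by (metis add_diff_cancel_left')
  also have "norm (d *\<^sub>R u - u * d *\<^sub>R u) \<le> norm (d *\<^sub>R u)" by (rule left)
  also have "\<dots> \<le> e\<^sup>2" using \<open>norm u \<le> 2\<close> d by (simp add: d_def mult_left_le)
  finally have "(norm (i - i * u))\<^sup>2 \<le> e\<^sup>2" .
  then have "norm (i - i * u) \<le> e" using e by (auto intro: power2_le_imp_le)
  then show ?thesis using that uI stu left right by blast
qed

text \<open>For \<open>i\<close> close to \<open>i * u\<close> with a self-adjoint \<open>u\<close>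
  in \<open>I\<close>, the element \<open>st i\<close> is close to \<open>u * st i\<close>, which
  lies in the closed ideal because of its left factor.\<close>

lemma I_st: assumes "i \<in> I" shows "st i \<in> I"
proof (rule I_approx)
  fix e :: real assume "e > 0"
  then obtain u where u: "u \<in> I" "st u = u" "norm (i - i * u) \<le> e"
    using approximate_unit[OF assms] by metis
  have "norm (st i - u * st i) \<le> e"
    using u norm_st[of "i - i * u"] by (simp add: st_diff st_mult)
  then show "\<exists>k\<in>I. norm (st i - k) \<le> e" using I_right[OF u(1)] by blast
qed

lemma I_st_iff: "st i \<in> I \<longleftrightarrow> i \<in> I"
  using I_st[of i] I_st[of "st i"] by auto

end

locale hmod_ideal = hmod sc st scE act ip + cstar_ideal sc st I
  for sc :: "complex \<Rightarrow> 'a::{real_normed_algebra,banach} \<Rightarrow> 'a" and st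
    and scE :: "complex \<Rightarrow> 'e::ab_group_add \<Rightarrow> 'e" and act ip I
begin

text \<open>The submodule written EI in the mathematics, described by inner products instead of a
  closed span. Membership can thus be tested modulo \<open>I\<close> and is visibly preserved by
  adjointable maps; \<open>EI_subset_submodI\<close> leads back to the closed span.\<close>

definition EI :: "'e set" where "EI = {x. \<forall>y. ip y x \<in> I}"

lemma EI_ip: "x \<in> EI \<Longrightarrow> ip y x \<in> I" by (simp add: EI_def)

lemma EI_ip': "x \<in> EI \<Longrightarrow> ip x y \<in> I" using EI_ip ip_st I_st_iff by metis

lemma EI_zero: "0 \<in> EI" by (simp add: EI_def I_zero)
lemma EI_add: "x \<in> EI \<Longrightarrow> y \<in> EI \<Longrightarrow> x + y \<in> EI" by (simp add: EI_def ip_simps I_add)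
lemma EI_diff: "x \<in> EI \<Longrightarrow> y \<in> EI \<Longrightarrow> x - y \<in> EI" by (simp add: EI_def ip_simps I_diff)
lemma EI_minus: "x \<in> EI \<Longrightarrow> - x \<in> EI" by (simp add: EI_def ip_simps I_minus)
lemma EI_act: "i \<in> I \<Longrightarrow> act x i \<in> EI" by (simp add: EI_def ip_simps I_left)
lemma EI_op: assumes "adj T T'" "x \<in> EI" shows "T x \<in> EI"
  using assms(2) by (simp add: EI_def flip: adjD'[OF assms(1)])

text \<open>The square of \<open>x - x u\<close> is \<open>(1 - u) (ip x x) (1 - u)\<close>.
  Splitting \<open>ip x x\<close> into \<open>ip x x - i\<close> and \<open>i\<close>, the first
  part does not grow under multiplication by \<open>1 - u\<close>, and the second is nearly
  annihilated.\<close>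

lemma quotient_norm_approx:
  assumes i: "i \<in> I" and e: "e > 0"
  obtains u where "u \<in> I" "(nrm (x - act x u))\<^sup>2 \<le> norm (ip x x - i) + e"
proof -
  obtain u where u: "u \<in> I" "st u = u" "\<And>v. norm (v - u * v) \<le> norm v" "\<And>v. norm (v - v * u) \<le> norm v"
    "norm (i - i * u) \<le> e" using approximate_unit[OF i e] by metis
  let ?a = "ip x x - i"
  have "ip (x - act x u) (x - act x u) = ((?a - ?a * u) - u * (?a - ?a * u)) + ((i - i * u) - u * (i - i * u))"
    by (simp add: ip_simps u(2) algebra_simps)
  then have "(nrm (x - act x u))\<^sup>2 \<le> norm ((?a - ?a * u) - u * (?a - ?a * u)) + norm ((i - i * u) - u * (i - i * u))"
    by (metis nrm_sq norm_triangle_ineq)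
  also have "\<dots> \<le> norm ?a + e"
    by (meson add_mono order_trans u(3,4,5))
  finally show ?thesis using that u(1) by blast
qed

text \<open>For \<open>x\<close> in \<open>EI\<close> the element \<open>i = ip x x\<close> itself
  is admissible in \<open>quotient_norm_approx\<close>, so \<open>x\<close> is a limit of elements
  \<open>act x u\<close> with \<open>u\<close> in \<open>I\<close>.\<close>

lemma EI_subset_submodI: "x \<in> EI \<Longrightarrow> x \<in> submodI scE act ip I"
  unfolding submodI_def hclosure_def
proof (intro CollectI allI impI)
  fix e :: real assume x: "x \<in> EI" and e: "e > 0"
  have "0 < (e/2)\<^sup>2" using e by simp
  then obtain u where u: "u \<in> I" "(nrm (x - act x u))\<^sup>2 \<le> (e/2)\<^sup>2"
    using quotient_norm_approx[OF EI_ip[OF x], of "(e/2)\<^sup>2" x x] by auto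
  from u(2) have "nrm (x - act x u) \<le> e/2" by (rule power2_le_imp_le) (use e in simp)
  then show "\<exists>y\<in>cspan scE {act m i |m i. i \<in> I}. nrm (x - y) < e"
    using u(1) e by (intro bexI[of _ "act x u"] cspan_base) auto
qed

text \<open>The quotient norm, pulled back to a seminorm on the module.\<close>

definition nu :: "'e \<Rightarrow> real" where "nu x = (INF z\<in>EI. nrm (x - z))"

lemma nu_bdd: "bdd_below ((\<lambda>z. nrm (x - z)) ` EI)" by (rule bdd_belowI[of _ 0]) auto

lemma nu_le: "z \<in> EI \<Longrightarrow> nu x \<le> nrm (x - z)"
  unfolding nu_def by (rule cINF_lower[OF nu_bdd])

lemma nu_le_nrm: "nu x \<le> nrm x" using nu_le[OF EI_zero, of x] by simp

lemma nu_nonneg: "0 \<le> nu x"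
  unfolding nu_def using EI_zero by (intro cINF_greatest) auto

lemma nu_approx: "nu x < d \<Longrightarrow> \<exists>z\<in>EI. nrm (x - z) < d"
  unfolding nu_def using EI_zero by (subst (asm) cINF_less_iff[OF _ nu_bdd]) auto

lemma nu_triangle: "nu (x + y) \<le> nu x + nu y"
proof (rule field_le_epsilon)
  fix e :: real assume "e > 0"
  then obtain z w where zw: "z \<in> EI" "nrm (x - z) < nu x + e/2" "w \<in> EI" "nrm (y - w) < nu y + e/2"
    using nu_approx[of x "nu x + e/2"] nu_approx[of y "nu y + e/2"] by auto
  have "nu (x + y) \<le> nrm ((x - z) + (y - w))" using nu_le[OF EI_add[OF zw(1,3)], of "x + y"] by (simp add: algebra_simps)
  also have "\<dots> \<le> nrm (x - z) + nrm (y - w)" by (rule nrm_triangle)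
  finally show "nu (x + y) \<le> nu x + nu y + e" using zw by simp
qed

lemma nu_EI: "x \<in> EI \<Longrightarrow> nu x = 0"
  using nu_le[of x x] nu_nonneg[of x] by simp

lemma nu_cong: assumes "x - y \<in> EI" shows "nu x = nu y"
proof (rule antisym)
  show "nu x \<le> nu y" using nu_triangle[of y "x - y"] nu_EI[OF assms] by simp
  have "y - x \<in> EI" using EI_minus[OF assms] by simp
  then show "nu y \<le> nu x" using nu_triangle[of x "y - x"] nu_EI[of "y - x"] by simp
qed

text \<open>This compares the distance to \<open>EI\<close> with the norm that the quotient inner
  product defines: corrections by elements of \<open>I\<close> in the algebra are realised by
  corrections \<open>act x u\<close> in the module.\<close>

lemma nu_sq_le: assumes "i \<in> I" shows "(nu x)\<^sup>2 \<le> norm (ip x x - i)"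
proof (rule field_le_epsilon)
  fix e :: real assume "e > 0"
  then obtain u where u: "u \<in> I" "(nrm (x - act x u))\<^sup>2 \<le> norm (ip x x - i) + e"
    using quotient_norm_approx[OF assms] by metis
  have "(nu x)\<^sup>2 \<le> (nrm (x - act x u))\<^sup>2"
    using nu_le[OF EI_act[OF u(1)]] nu_nonneg by (intro power_mono) auto
  then show "(nu x)\<^sup>2 \<le> norm (ip x x - i) + e" using u by simp
qed

lemma nu_ip: assumes "nu x < d" obtains i where "i \<in> I" "norm (ip y x - i) \<le> nrm y * d"
proof -
  obtain z where z: "z \<in> EI" "nrm (x - z) < d" using nu_approx[OF assms] by blast
  have "norm (ip y x - ip y z) \<le> nrm y * nrm (x - z)" using cauchy_schwarz[of y "x - z"] by (simp add: ip_simps)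
  also have "\<dots> \<le> nrm y * d" using z by (intro mult_left_mono) auto
  finally show ?thesis using that EI_ip[OF z(1)] by blast
qed

lemma nu_zero_EI: assumes "nu x = 0" shows "x \<in> EI"
  unfolding EI_def
proof (intro CollectI allI I_approx)
  fix y and e :: real assume e: "e > 0"
  have ny: "nrm y + 1 > 0" using nrm_nonneg[of y] by linarith
  obtain i where i: "i \<in> I" "norm (ip y x - i) \<le> nrm y * (e / (nrm y + 1))"
    using nu_ip[of x "e / (nrm y + 1)" y] e ny assms by auto
  have "nrm y * (e / (nrm y + 1)) \<le> e" using e ny by (simp add: field_simps)
  then show "\<exists>i\<in>I. norm (ip y x - i) \<le> e" using i by force
qed

lemma nu_op_nu:
  assumes T: "adj T T'" and C: "\<And>x. nu (T x) \<le> C * nrm x" "0 \<le> C"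
  shows "nu (T x) \<le> C * nu x"
proof (rule field_le_epsilon)
  fix e :: real assume e: "e > 0"
  then have "nu x < nu x + e / (C + 1)" using C(2) by simp
  then obtain z where z: "z \<in> EI" "nrm (x - z) < nu x + e / (C + 1)" using nu_approx by blast
  have "T x - T (x - z) \<in> EI" using EI_op[OF T z(1)] by (simp add: adj_op_diff[OF T])
  then have "nu (T x) = nu (T (x - z))" by (rule nu_cong)
  also have "\<dots> \<le> C * nrm (x - z)" by (rule C)
  also have "\<dots> \<le> C * (nu x + e / (C + 1))" using z C(2) by (intro mult_left_mono) auto
  also have "\<dots> \<le> C * nu x + e" using C(2) e by (simp add: field_simps)
  finally show "nu (T x) \<le> C * nu x + e" .
qed

lemma nu_obd: "obd T K \<Longrightarrow> adj T T' \<Longrightarrow> nu (T x) \<le> K * nu x"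
  using nu_op_nu obd_nrm obd_nonneg nu_le_nrm order_trans by meson

lemma nu_sq_le_nu:
  assumes "ip x x = ip y z" shows "(nu x)\<^sup>2 \<le> nrm y * nu z"
proof (rule field_le_epsilon)
  fix e :: real assume e: "e > 0"
  have ny: "nrm y + 1 > 0" using nrm_nonneg[of y] by linarith
  obtain i where i: "i \<in> I" "norm (ip y z - i) \<le> nrm y * (nu z + e / (nrm y + 1))"
    using nu_ip[of z "nu z + e / (nrm y + 1)" y] e ny by auto
  have "nrm y * (e / (nrm y + 1)) \<le> e" using e ny by (simp add: field_simps)
  then show "(nu x)\<^sup>2 \<le> nrm y * nu z + e" using nu_sq_le[OF i(1), of x] i(2) assms by (simp add: distrib_left)
qed

text \<open>The usual argument for the norm of an adjoint, carried out in the quotient: the square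
  of \<open>T' y\<close> is the inner product of \<open>y\<close> with
  \<open>T (T' y)\<close>.\<close>

lemma nu_adj:
  assumes T: "adj T T'" and C: "\<And>x. nu (T x) \<le> C * nrm x" "0 \<le> C"
  shows "nu (T' y) \<le> C * nrm y"
proof (cases "nu (T' y) = 0")
  case False
  then have n0: "nu (T' y) > 0" using nu_nonneg[of "T' y"] by simp
  have "(nu (T' y))\<^sup>2 \<le> nrm y * nu (T (T' y))"
    by (rule nu_sq_le_nu) (simp add: adjD'[OF T])
  also have "\<dots> \<le> nrm y * (C * nu (T' y))"
    by (intro mult_left_mono nu_op_nu[OF T C]) auto
  finally have "nu (T' y) * nu (T' y) \<le> C * nrm y * nu (T' y)" by (simp add: power2_eq_square mult_ac)
  then show ?thesis using n0 by simp
qed (use C in simp)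

text \<open>The operator \<open>S\<close> replaces a singular value s of \<open>T\<close> by l s /
  (s^2 + l), which damps the large ones. The remainder is \<open>T T' T R\<close> with the resolvent
  \<open>R\<close>: three factors bounded by \<open>C\<close> modulo \<open>EI\<close> against one
  factor \<open>1/l\<close>.\<close>

lemma lift_step:
  assumes T: "adj T T'" "obd T K" and C: "\<And>x. nu (T x) \<le> C * nrm x" "0 < C"
  obtains S S' where "adj S S'" "obd S C" "\<And>x. nu (T x - S x) \<le> C / 2 * nrm x"
proof -
  define H where "H = (\<lambda>x. T' (T x))"
  \<comment> \<open>The remainder is at most \<open>C^3 / l\<close> modulo \<open>EI\<close>, so
    halving it asks for \<open>l \<ge> 2 C^2\<close>, whereas the estimate of \<open>S\<close> by
    \<open>C\<close> compares \<open>l^2\<close> with \<open>2 l C^2\<close> and asks for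
    \<open>l \<le> 2 C^2\<close>.\<close>
  define l where "l = 2 * C\<^sup>2"
  have l: "l > 0" using C by (simp add: l_def)
  have T': "adj T' T" "obd T' K" using adj_sym[OF T(1)] obd_adj[OF T(2,1)] by auto
  have ipH: "ip x (H x) = ip (T x) (T x)" for x using adjD[OF T(1)] by (simp add: H_def)
  have H: "posop H" unfolding posop_def ipH using adj_comp[OF T'(1) T(1)] ip_pos by (simp add: H_def)
  have HK: "obd H (K * K)" unfolding H_def by (rule obd_comp[OF T'(2) T(2)])
  define R where "R = res H l"
  have R: "adj R R" "obd R (1/l)" unfolding R_def using res_adj[OF H HK l] res_obd[OF H HK l] by auto
  have Rr: "H (R x) + rs l (R x) = x" for x unfolding R_def by (rule res_right[OF H HK l])
  define S where "S = (\<lambda>x. rs l (T (R x)))"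
  have S: "adj S (\<lambda>x. rs l (R (T' x)))"
    unfolding S_def using adj_rs[OF adj_comp[OF T(1) R(1)]] .
  moreover have "obd S C"
    unfolding obd_def
  proof (intro conjI allI)
    fix x
    let ?w = "R x"
    have "pos (C\<^sup>2 *\<^sub>R (ip (H ?w) (H ?w) + l\<^sup>2 *\<^sub>R ip ?w ?w))"
      by (intro pos_scale pos_add ip_pos) auto
    moreover have "ip x x = ip (H ?w) (H ?w) + (2 * l) *\<^sub>R ip (T ?w) (T ?w) + l\<^sup>2 *\<^sub>R ip ?w ?w"
    proof -
      have "ip (H ?w) ?w = ip (T ?w) (T ?w)" using adjD'[OF T(1)] by (simp add: H_def)
      then have "ip (H ?w + rs l ?w) (H ?w + rs l ?w)
        = ip (H ?w) (H ?w) + (l *\<^sub>R ip (T ?w) (T ?w) + l *\<^sub>R ip (T ?w) (T ?w)) + l\<^sup>2 *\<^sub>R ip ?w ?w"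
        by (simp add: ip_simps ipH power2_eq_square scaleR_add_right add_ac)
      then show ?thesis unfolding Rr by (simp add: scaleR_2 flip: scaleR_scaleR)
    qed
    moreover have "C\<^sup>2 * (2 * l) = l * l" by (simp add: l_def power2_eq_square)
    then have "ip (S x) (S x) = (C\<^sup>2 * (2 * l)) *\<^sub>R ip (T ?w) (T ?w)"
      by (simp only: S_def ip_simps scaleR_scaleR)
    ultimately show "pos (C\<^sup>2 *\<^sub>R ip x x - ip (S x) (S x))"
      by (simp add: scaleR_add_right)
  qed (use C in simp)
  moreover have "nu (T x - S x) \<le> C / 2 * nrm x" for x
  proof -
    have "T x - S x = T (T' (T (R x)))"
      using Rr[of x] adj_op_rs[OF T(1)] adj_op_add[OF T(1), of "H (R x)" "rs l (R x)"] by (simp add: S_def H_def)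
    then have "nu (T x - S x) \<le> C * nu (T' (T (R x)))" using C by (simp add: nu_op_nu[OF T(1)])
    also have "\<dots> \<le> C * (C * nu (T (R x)))"
      using C by (intro mult_left_mono nu_op_nu[OF T'(1)] nu_adj[OF T(1)]) auto
    also have "\<dots> \<le> C * (C * (C * nrm (R x)))"
      using C by (intro mult_left_mono) auto
    also have "\<dots> \<le> C * (C * (C * (1/l * nrm x)))"
      using C obd_nrm[OF R(2)] by (intro mult_left_mono) auto
    also have "\<dots> = C / 2 * nrm x" using C by (simp add: l_def power2_eq_square)
    finally show ?thesis .
  qed
  ultimately show ?thesis using that by blast
qed

text \<open>Iterating \<open>lift_step\<close> halves the remainder modulo \<open>EI\<close> each
  time, and the corrections, bounded by \<open>C / 2^n\<close>, add up to \<open>2 C\<close>. The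
  resulting bound depends only on the quotient norm, however large \<open>K\<close> is.\<close>

lemma lift_bounded:
  assumes T: "adj T T'" "obd T K" and C: "\<And>x. nu (T x) \<le> C * nrm x" "0 < C"
  shows "\<exists>S S'. adj S S' \<and> obd S (2 * C) \<and> (\<forall>x. T x - S x \<in> EI)"
proof -
  define c where "c n = C * (1/2) ^ n" for n :: nat
  have c: "0 < c n" for n using C by (simp add: c_def)
  define P where "P n TT \<longleftrightarrow> adj (fst TT) (snd TT) \<and> (\<exists>K. obd (fst TT) K) \<and> (\<forall>x. nu (fst TT x) \<le> c n * nrm x)"
    for n and TT :: "('e \<Rightarrow> 'e) \<times> ('e \<Rightarrow> 'e)"
  have "\<exists>W. W 0 = (T, T') \<and> (\<forall>n. P n (W n) \<and> obd (\<lambda>x. fst (W n) x - fst (W (Suc n)) x) (c n))"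
  proof -
    \<comment> \<open>Dependent choice leaves the first element open; the clause for
      \<open>n = 0\<close> pins it to the given pair.\<close>
    have "\<exists>W. \<forall>n. (P n (W n) \<and> (n = 0 \<longrightarrow> W n = (T, T'))) \<and> obd (\<lambda>x. fst (W n) x - fst (W (Suc n)) x) (c n)"
    proof (rule dependent_nat_choice)
      show "\<exists>x. P 0 x \<and> (0 = (0::nat) \<longrightarrow> x = (T, T'))"
        using T C by (intro exI[of _ "(T, T')"]) (auto simp: P_def c_def)
      fix TT and n :: nat assume "P n TT \<and> (n = 0 \<longrightarrow> TT = (T, T'))"
      then obtain L where TT: "adj (fst TT) (snd TT)" "obd (fst TT) L" "\<And>x. nu (fst TT x) \<le> c n * nrm x"
        by (auto simp: P_def)
      obtain S S' where S: "adj S S'" "obd S (c n)" "\<And>x. nu (fst TT x - S x) \<le> c n / 2 * nrm x"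
        using lift_step[OF TT c] by blast
      have "P (Suc n) (\<lambda>x. fst TT x - S x, \<lambda>x. snd TT x - S' x)"
        unfolding P_def using S(3) adj_minus[OF TT(1) S(1)] obd_diff[OF TT(2) S(2)] by (auto simp: c_def)
      then show "\<exists>UU. (P (Suc n) UU \<and> (Suc n = 0 \<longrightarrow> UU = (T, T'))) \<and> obd (\<lambda>x. fst TT x - fst UU x) (c n)"
        using S(2) by (intro exI[of _ "(\<lambda>x. fst TT x - S x, \<lambda>x. snd TT x - S' x)"]) auto
    qed
    then show ?thesis by blast
  qed
  then obtain W where W0: "W 0 = (T, T')" and W: "\<And>n. P n (W n)"
    "\<And>n. obd (\<lambda>x. fst (W n) x - fst (W (Suc n)) x) (c n)" by blast
  define U U' where "U n = fst (W n)" and "U' n = snd (W n)" for n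
  have U: "adj (U n) (U' n)" "nu (U n x) \<le> c n * nrm x" "obd (\<lambda>x. U n x - U (Suc n) x) (c n)" for n x
    using W[of n] by (auto simp: P_def U_def U'_def)
  have U0: "U 0 = T" "U' 0 = T'" using W0 by (auto simp: U_def U'_def)
  have sm: "summable c" unfolding c_def by (intro summable_mult summable_geometric) simp
  have csum: "suminf c = 2 * C"
    unfolding c_def by (subst suminf_mult) (auto intro: summable_geometric simp: suminf_geometric)
  have tel: "(\<Sum>k<n. U k x - U (Suc k) x) = U 0 x - U n x" for n x
    by (induction n) auto
  have adjU: "adj (\<lambda>x. U n x - U (Suc n) x) (\<lambda>x. U' n x - U' (Suc n) x)" for n
    by (rule adj_minus[OF U(1) U(1)])
  obtain S S' where SS: "adj S S'" "\<And>n. obd (\<lambda>x. S x - (\<Sum>k<n. U k x - U (Suc k) x)) (\<Sum>k. c (k + n))"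
    "\<And>x. cv (\<lambda>n. \<Sum>k<n. U k x - U (Suc k) x) (S x)"
    using op_series[OF adjU U(3) sm] by blast
  have S: "cv (\<lambda>n. U 0 x - U n x) (S x)" for x using SS(3)[of x] unfolding tel .
  have "obd S (2 * C)" using SS(2)[of 0] csum by simp
  moreover have "T x - S x \<in> EI" for x
  proof (rule nu_zero_EI, rule antisym)
    have "nu (T x - S x) \<le> c n * nrm x + nrm (U 0 x - U n x - S x)" for n
    proof -
      have "T x - S x = U n x + (U 0 x - U n x - S x)" by (simp add: U0)
      then have "nu (T x - S x) \<le> nu (U n x) + nu (U 0 x - U n x - S x)" by (metis nu_triangle)
      then show ?thesis using U(2)[of n x] nu_le_nrm[of "U 0 x - U n x - S x"] by linarith
    qed
    moreover have "(\<lambda>n. c n * nrm x + nrm (U 0 x - U n x - S x)) \<longlonglongrightarrow> 0 + 0"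
      using summable_LIMSEQ_zero[OF summable_mult2[OF sm]] S[of x] unfolding cv_def by (rule tendsto_add)
    ultimately show "nu (T x - S x) \<le> 0"
      using LIMSEQ_le_const[of "\<lambda>n. c n * nrm x + nrm (U 0 x - U n x - S x)" 0 "nu (T x - S x)"] by simp
  qed (rule nu_nonneg)
  ultimately show ?thesis using SS(1) by blast
qed

end

section \<open>Self-adjoint operators on the quotient\<close>

text \<open>The operator enters as an arbitrary map that is symmetric modulo \<open>I\<close>.
  Testing against all vectors modulo \<open>I\<close> gives additivity and homogeneity modulo
  \<open>EI\<close>.\<close>

locale quot_op = hmod_ideal sc st scE act ip I
  for sc :: "complex \<Rightarrow> 'a::{real_normed_algebra,banach} \<Rightarrow> 'a" and st
    and scE :: "complex \<Rightarrow> 'e::ab_group_add \<Rightarrow> 'e" and act ip I +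
  fixes f :: "'e \<Rightarrow> 'e"
  assumes f_ip: "ip (f x) y - ip x (f y) \<in> I"
begin

lemma f_ip': "ip y (f x) - ip (f y) x \<in> I"
  using I_minus[OF f_ip[of y x]] by simp

lemma f_add: "f (x + y) - (f x + f y) \<in> EI"
  unfolding EI_def
proof (intro CollectI allI)
  fix z
  have "ip z (f (x + y) - (f x + f y)) = (ip z (f (x + y)) - ip (f z) (x + y))
      - ((ip z (f x) - ip (f z) x) + (ip z (f y) - ip (f z) y))"
    by (simp add: ip_simps)
  then show "ip z (f (x + y) - (f x + f y)) \<in> I" using f_ip' I_add I_diff by metis
qed

lemma f_diff: "f (x - y) - (f x - f y) \<in> EI"
proof -
  have "f (x - y) - (f x - f y) = - (f ((x - y) + y) - (f (x - y) + f y))" by simp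
  then show ?thesis using EI_minus[OF f_add] by metis
qed

lemma f_rs: "f (rs r x) - rs r (f x) \<in> EI"
  unfolding EI_def
proof (intro CollectI allI)
  fix z
  have "ip z (f (rs r x) - rs r (f x)) = (ip z (f (rs r x)) - ip (f z) (rs r x)) - r *\<^sub>R (ip z (f x) - ip (f z) x)"
    by (simp add: ip_simps scaleR_diff_right)
  then show "ip z (f (rs r x) - rs r (f x)) \<in> I" using f_ip' I_diff I_scaleR by metis
qed

text \<open>Symmetry replaces continuity of \<open>f\<close>. For a representative \<open>w\<close>
  of the class of \<open>f x\<close>, the square of \<open>w\<close> is congruent to
  \<open>ip (f w) x\<close>, which is close to \<open>ip (f w) (X n)\<close>, and this is congruent
  to \<open>ip w (f (X n))\<close>, bounded modulo \<open>I\<close> by about \<open>k\<close> times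
  the norm of \<open>w\<close>.\<close>

lemma nu_f_closed:
  assumes X: "cv X x" and k: "\<And>n. nu (f (X n)) \<le> k"
  shows "nu (f x) \<le> k"
proof -
  have k0: "0 \<le> k" using k[of 0] nu_nonneg[of "f (X 0)"] by linarith
  let ?v = "nu (f x)"
  have *: "?v\<^sup>2 \<le> e + (?v + e) * (k + e)" if e: "e > 0" for e
  proof -
    obtain z where z: "z \<in> EI" "nrm (f x - z) < ?v + e" using nu_approx[of "f x" "?v + e"] e by auto
    define w where "w = f x - z"
    have "(\<lambda>n. ip (f w) (X n)) \<longlonglongrightarrow> ip (f w) x" by (rule cv_ip_right[OF X])
    then obtain n where n: "norm (ip (f w) (X n) - ip (f w) x) < e"
      using e unfolding LIMSEQ_iff by blast
    obtain i where i: "i \<in> I" "norm (ip w (f (X n)) - i) \<le> nrm w * (k + e)"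
      using nu_ip[of "f (X n)" "k + e" w] k[of n] e by (metis add_strict_increasing2 less_eq_real_def order_less_le_trans less_add_same_cancel1 order_le_less_trans)
    define j where "j = (ip w (f x) - ip (f w) x) - ip w z - (ip w (f (X n)) - ip (f w) (X n)) + i"
    have j: "j \<in> I" unfolding j_def by (intro I_add I_diff f_ip' EI_ip z i)
    have "ip w w - j = (ip (f w) x - ip (f w) (X n)) + (ip w (f (X n)) - i)"
      by (simp add: j_def w_def ip_simps)
    then have "norm (ip w w - j) \<le> norm (ip (f w) x - ip (f w) (X n)) + norm (ip w (f (X n)) - i)"
      by (metis norm_triangle_ineq)
    also have "\<dots> \<le> e + nrm w * (k + e)" using n i by (simp add: norm_minus_commute)
    also have "\<dots> \<le> e + (?v + e) * (k + e)"
      using z k0 e by (intro add_left_mono mult_right_mono) (auto simp: w_def)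
    finally have "(nu w)\<^sup>2 \<le> e + (?v + e) * (k + e)" using nu_sq_le[OF j, of w] by simp
    moreover have "nu w = ?v" using z by (intro nu_cong) (simp add: w_def EI_minus)
    ultimately show ?thesis by simp
  qed
  have "?v\<^sup>2 \<le> 0 + (?v + 0) * (k + 0)"
  proof (rule LIMSEQ_le_const)
    show "(\<lambda>n. inverse (real (Suc n)) + (?v + inverse (real (Suc n))) * (k + inverse (real (Suc n))))
       \<longlonglongrightarrow> 0 + (?v + 0) * (k + 0)"
      by (intro tendsto_intros LIMSEQ_inverse_real_of_nat)
    show "\<exists>N. \<forall>n\<ge>N. ?v\<^sup>2 \<le> inverse (real (Suc n)) + (?v + inverse (real (Suc n))) * (k + inverse (real (Suc n)))"
      using * by simp
  qed
  then have "?v * ?v \<le> k * ?v" by (simp add: power2_eq_square mult.commute)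
  then show ?thesis using k0 nu_nonneg[of "f x"] by (cases "?v = 0") auto
qed

text \<open>The Hellinger-Toeplitz theorem modulo \<open>I\<close>. The sets where
  \<open>nu (f x) \<le> k\<close> are closed by \<open>nu_f_closed\<close> and cover the complete
  module, so one of them contains a ball, and additivity moves the ball to the origin.\<close>

lemma f_bounded: "\<exists>C>0. \<forall>x. nu (f x) \<le> C * nrm x"
proof -
  interpret B: Metric_space UNIV "\<lambda>x y. nrm (x - y)"
  proof
    show "nrm (x - y) = 0 \<longleftrightarrow> x = y" for x y using nrm_eq_zero[of "x - y"] by auto
  qed (auto simp: nrm_minus_commute nrm_triangle3)
  have lim: "limitin B.mtopology X x sequentially \<longleftrightarrow> cv X x" for X x
    by (simp add: B.limitin_metric_dist_null cv_def)
  have "B.mcomplete"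
    unfolding B.mcomplete_def
  proof (intro allI impI)
    fix X assume "B.MCauchy X"
    then have "\<exists>N. \<forall>m\<ge>N. \<forall>n\<ge>m. nrm (X n - X m) < e" if "e > 0" for e
      using that unfolding B.MCauchy_def by (meson order_trans)
    then obtain L where "cv X L" using cv_complete[of X] by blast
    then show "\<exists>x. limitin B.mtopology X x sequentially" using lim by blast
  qed
  define F where "F k = {x. nu (f x) \<le> real k}" for k
  have "\<exists>k. B.mtopology interior_of F k \<noteq> {}"
  proof (rule ccontr)
    assume "\<not> ?thesis"
    then have "B.mtopology interior_of \<Union>(range F) = {}"
    proof (intro B.metric_Baire_category_alt \<open>B.mcomplete\<close>)
      fix T assume "T \<in> range F"
      then obtain k where T: "T = F k" by blast
      have "closedin B.mtopology T"
        unfolding B.metric_closedin_iff_sequentially_closed T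
      proof (intro conjI allI impI)
        fix X l assume "range X \<subseteq> F k \<and> limitin B.mtopology X l sequentially"
        then have X: "\<And>n. X n \<in> F k" "cv X l" using lim by auto
        show "l \<in> F k" using nu_f_closed[OF X(2)] X(1) by (simp add: F_def)
      qed simp
      then show "closedin B.mtopology T \<and> B.mtopology interior_of T = {}"
        using T \<open>\<not> (\<exists>k. B.mtopology interior_of F k \<noteq> {})\<close> by blast
    qed simp
    moreover have "\<Union>(range F) = UNIV"
      using real_arch_simple by (force simp: F_def)
    moreover have "B.mtopology interior_of UNIV = UNIV"
      using interior_of_topspace[of B.mtopology] by simp
    ultimately show False by simp
  qed
  then obtain k x0 where "x0 \<in> B.mtopology interior_of F k" by blast
  then obtain r where r: "r > 0" "B.mball x0 r \<subseteq> F k"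
    unfolding B.metric_interior_of by auto
  have small: "nu (f x) \<le> 2 * real k" if "nrm x < r" for x
  proof -
    have "x0 + x \<in> F k" "x0 \<in> F k" using that r by (auto simp: subset_iff nrm_minus_commute)
    then have "nu (f (x0 + x)) \<le> k" "nu (f x0) \<le> k" by (auto simp: F_def)
    moreover have "nu (f x) = nu (f (x0 + x) - f x0)"
      using f_diff[of "x0 + x" x0] by (intro nu_cong) simp
    moreover have "nu (- f x0) = nu (f x0)"
    proof -
      have le: "nu (- y) \<le> nu y" for y
        using nu_obd[OF obd_uminus[OF obd_id], of "uminus" y] by (simp add: adj_def ip_simps)
      show ?thesis using le[of "f x0"] le[of "- f x0"] by simp
    qed
    ultimately show ?thesis using nu_triangle[of "f (x0 + x)" "- f x0"] by simp
  qed
  \<comment> \<open>Scaling \<open>x\<close> to norm \<open>r / 2\<close> turns the bound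
    \<open>2 k\<close> on the ball into \<open>4 k / r\<close>; the added 1 keeps \<open>C\<close>
    positive when \<open>k = 0\<close>.\<close>
  define C where "C = (4 * real k + 1) / r"
  have "nu (f x) \<le> C * nrm x" for x
  proof (cases "x = 0")
    case True
    have "f 0 - (f 0 - f 0) \<in> EI" using f_diff[of 0 0] by simp
    then show ?thesis using True nu_EI by simp
  next
    case False
    then have n: "nrm x > 0" using nrm_eq_zero[of x] nrm_nonneg[of x] by linarith
    define t where "t = r / (2 * nrm x)"
    have t: "t > 0" using r n by (simp add: t_def)
    have "nrm (rs t x) < r" using r n t by (simp add: nrm_rs t_def)
    then have s: "nu (f (rs t x)) \<le> 2 * real k" by (rule small)
    have "rs (1/t) (f (rs t x)) - f (rs (1/t) (rs t x)) \<in> EI"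
      using EI_minus[OF f_rs[of "1/t" "rs t x"]] by simp
    then have "nu (f x) = nu (rs (1/t) (f (rs t x)))" using nu_cong t by fastforce
    also have "\<dots> \<le> 1/t * nu (f (rs t x))"
      using nu_obd[OF obd_rs[OF obd_id] adj_rs[OF adj_id], of "1/t"] t by simp
    also have "\<dots> \<le> 1/t * (2 * real k)" using s t by (intro mult_left_mono) auto
    also have "\<dots> = (4 * real k) / r * nrm x" using r n by (simp add: t_def)
    also have "\<dots> \<le> C * nrm x" using r n by (intro mult_right_mono) (auto simp: C_def divide_right_mono)
    finally show ?thesis .
  qed
  moreover have "C > 0" using r by (simp add: C_def add_nonneg_pos)
  ultimately show ?thesis by blast
qed

end

section \<open>Strict convergence of block sums\<close>

context hmod
begin

text \<open>For 0 \<le> q \<le> 1 the difference q - q^2 equals q (1 - q) q + (1 - q) q (1 - q), a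
  sum of two positive terms.\<close>

lemma contraction_square:
  assumes q: "adj q q" and p: "\<And>x. pos (ip x (q x))" "\<And>x. pos (ip x x - ip x (q x))"
  shows "pos (ip x (q x) - ip (q x) (q x))" "obd q 1"
proof -
  have sq: "pos (ip x (q x) - ip (q x) (q x))" for x
  proof -
    have "pos ((ip (q x) (q x) - ip (q x) (q (q x))) + ip (x - q x) (q (x - q x)))"
      by (intro pos_add p)
    moreover have "ip x (q (q x)) = ip (q x) (q x)" by (simp add: adjD[OF q])
    ultimately show ?thesis by (simp add: ip_simps adj_op_diff[OF q])
  qed
  show "pos (ip x (q x) - ip (q x) (q x))" by (rule sq)
  show "obd q 1"
    unfolding obd_def
  proof (intro conjI allI)
    show "pos (1\<^sup>2 *\<^sub>R ip x x - ip (q x) (q x))" for x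
      using pos_add[OF sq[of x] p(2)[of x]] by simp
  qed simp
qed

text \<open>The squares of the blocks are bounded by the increments of a strongly convergent
  sequence \<open>s\<close>. This telescoping control covers overlapping blocks as well as
  consecutive ones.\<close>

definition dominated :: "(nat \<Rightarrow> 'e \<Rightarrow> 'e) \<Rightarrow> (nat \<Rightarrow> 'e \<Rightarrow> 'e) \<Rightarrow> real \<Rightarrow> bool" where
  "dominated B s M \<longleftrightarrow> 0 \<le> M \<and> (\<forall>l. adj (B l) (B l)) \<and>
     (\<forall>l x. pos (ip x (s (Suc l) x - s l x) - ip (B l x) (B l x))) \<and>
     (\<forall>n x. nrm (s n x) \<le> M * nrm x) \<and> (\<forall>x. \<exists>L. cv (\<lambda>n. s n x) L)"

lemma dominated_sum:
  assumes "dominated B s M" "m \<le> n"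
  shows "norm (\<Sum>l\<in>{m..<n}. ip (B l x) (B l x)) \<le> nrm x * nrm (s n x - s m x)"
proof -
  have "pos (\<Sum>l\<in>{m..<n}. ip x (s (Suc l) x - s l x) - ip (B l x) (B l x))"
    using assms by (intro pos_sum) (auto simp: dominated_def)
  moreover have "(\<Sum>l\<in>{m..<n}. ip x (s (Suc l) x - s l x)) = ip x (s n x - s m x)"
    using sum_Suc_diff'[OF assms(2), of "\<lambda>l. ip x (s l x)"] by (simp add: ip_simps)
  ultimately have "pos (ip x (s n x - s m x) - (\<Sum>l\<in>{m..<n}. ip (B l x) (B l x)))"
    by (simp add: sum_subtractf)
  then have "norm (\<Sum>l\<in>{m..<n}. ip (B l x) (B l x)) \<le> norm (ip x (s n x - s m x))"
    by (rule pos_mono_norm[OF pos_sum[OF ip_pos]])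
  then show ?thesis using cauchy_schwarz order_trans by blast
qed

text \<open>Pairing a partial sum \<open>z\<close> with itself and moving \<open>A l\<close> to the
  left gives an inner product of two finite families. The family of the \<open>A l z\<close> is
  bounded by a multiple of the norm of \<open>z\<close>, which cancels; the family of the
  \<open>T l (B l x)\<close> is controlled by an increment of \<open>t\<close> at \<open>x\<close>,
  hence by a Cauchy sequence.\<close>

lemma block_sum_convergent:
  assumes A: "dominated A s M" and B: "dominated B t K" and T: "\<And>l. obd (T l) c"
  shows "\<exists>L. cv (\<lambda>n. \<Sum>l<n. A l (T l (B l x))) L"
proof -
  have M0: "0 \<le> M" using A by (simp add: dominated_def)
  define w where "w l = T l (B l x)" for l
  have main: "(nrm (\<Sum>l\<in>{m..<n}. A l (w l)))\<^sup>2 \<le> 2 * M * c\<^sup>2 * (nrm x * nrm (t n x - t m x))" if "m \<le> n" for m n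
  proof -
    define z where "z = (\<Sum>l\<in>{m..<n}. A l (w l))"
    show ?thesis
    proof (cases "nrm z = 0")
      case True
      have "0 \<le> 2 * M * c\<^sup>2 * (nrm x * nrm (t n x - t m x))" using M0 by simp
      then show ?thesis using True by (auto simp: z_def)
    next
      case False
      then have nz: "nrm z > 0" using nrm_nonneg[of z] by linarith
      have "ip z z = (\<Sum>l\<in>{m..<n}. ip z (A l (w l)))" by (subst (2) z_def) (simp add: ip_sum_right)
      also have "\<dots> = (\<Sum>l\<in>{m..<n}. ip (A l z) (w l))"
        using A by (intro sum.cong) (auto simp: dominated_def adj_def)
      finally have zz: "ip z z = (\<Sum>l\<in>{m..<n}. ip (A l z) (w l))" .
      have a: "norm (\<Sum>l\<in>{m..<n}. ip (A l z) (A l z)) \<le> 2 * M * (nrm z)\<^sup>2"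
      proof -
        have "nrm (s n z) \<le> M * nrm z" "nrm (s m z) \<le> M * nrm z"
          using A by (simp_all add: dominated_def)
        then have "nrm (s n z - s m z) \<le> 2 * M * nrm z"
          using nrm_diff_triangle[of "s n z" "s m z"] by linarith
        then have "nrm z * nrm (s n z - s m z) \<le> nrm z * (2 * M * nrm z)" by (intro mult_left_mono) auto
        then show ?thesis using dominated_sum[OF A that, of z] by (simp add: power2_eq_square mult_ac)
      qed
      have b: "norm (\<Sum>l\<in>{m..<n}. ip (w l) (w l)) \<le> c\<^sup>2 * (nrm x * nrm (t n x - t m x))"
      proof -
        have "pos (\<Sum>l\<in>{m..<n}. c\<^sup>2 *\<^sub>R ip (B l x) (B l x) - ip (w l) (w l))"
          unfolding w_def by (intro pos_sum obdD[OF T])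
        then have "pos (c\<^sup>2 *\<^sub>R (\<Sum>l\<in>{m..<n}. ip (B l x) (B l x)) - (\<Sum>l\<in>{m..<n}. ip (w l) (w l)))"
          by (simp add: sum_subtractf scaleR_sum_right)
        then have "norm (\<Sum>l\<in>{m..<n}. ip (w l) (w l)) \<le> norm (c\<^sup>2 *\<^sub>R (\<Sum>l\<in>{m..<n}. ip (B l x) (B l x)))"
          by (rule pos_mono_norm[OF pos_sum[OF ip_pos]])
        also have "\<dots> = c\<^sup>2 * norm (\<Sum>l\<in>{m..<n}. ip (B l x) (B l x))" by simp
        also have "\<dots> \<le> c\<^sup>2 * (nrm x * nrm (t n x - t m x))"
          by (intro mult_left_mono dominated_sum[OF B that]) simp
        finally show ?thesis .
      qed
      have "(nrm z)\<^sup>2 * (nrm z)\<^sup>2 = (norm (ip z z))\<^sup>2" unfolding nrm_sq by (simp add: power2_eq_square)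
      also have "\<dots> \<le> norm (\<Sum>l\<in>{m..<n}. ip (A l z) (A l z)) * norm (\<Sum>l\<in>{m..<n}. ip (w l) (w l))"
        unfolding zz by (rule cauchy_schwarz_sum)
      also have "\<dots> \<le> (2 * M * (nrm z)\<^sup>2) * (c\<^sup>2 * (nrm x * nrm (t n x - t m x)))"
        using M0 by (intro mult_mono a b) auto
      also have "\<dots> = (2 * M * c\<^sup>2 * (nrm x * nrm (t n x - t m x))) * (nrm z)\<^sup>2" by (simp add: mult_ac)
      finally have "(nrm z)\<^sup>2 \<le> 2 * M * c\<^sup>2 * (nrm x * nrm (t n x - t m x))"
        by (rule mult_right_le_imp_le) (use nz in simp)
      then show ?thesis by (simp add: z_def)
    qed
  qed
  obtain L where L: "cv (\<lambda>n. t n x) L" using B unfolding dominated_def by blast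
  have "\<exists>N. \<forall>m\<ge>N. \<forall>n\<ge>m. nrm ((\<Sum>l<n. A l (w l)) - (\<Sum>l<m. A l (w l))) < e" if e: "e > 0" for e
  proof -
    define D where "D = \<bar>2 * M * c\<^sup>2\<bar> * nrm x + 1"
    have D: "D > 0" by (simp add: D_def add_nonneg_pos)
    then have "e\<^sup>2 / (2 * D) > 0" using e by simp
    then obtain N where N: "\<And>n. n \<ge> N \<Longrightarrow> nrm (t n x - L) < e\<^sup>2 / (2 * D)"
      using L unfolding cv_def lim_sequentially by (auto simp: dist_real_def)
    have "nrm ((\<Sum>l<n. A l (w l)) - (\<Sum>l<m. A l (w l))) < e" if mn: "m \<ge> N" "n \<ge> m" for m n
    proof -
      have "nrm (t n x - t m x) < e\<^sup>2 / (2 * D) + e\<^sup>2 / (2 * D)"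
        using nrm_triangle3[of "t n x" "t m x" L] N[of n] N[of m] mn nrm_minus_commute[of L "t m x"] by simp
      also have "\<dots> = e\<^sup>2 / D" using D by (simp add: field_simps)
      finally have tl: "nrm (t n x - t m x) < e\<^sup>2 / D" .
      have "(\<Sum>l<n. A l (w l)) - (\<Sum>l<m. A l (w l)) = (\<Sum>l\<in>{m..<n}. A l (w l))"
        using mn sum_diff_nat_ivl[of 0 m n "\<lambda>l. A l (w l)"] by (simp add: atLeast0LessThan)
      then have "(nrm ((\<Sum>l<n. A l (w l)) - (\<Sum>l<m. A l (w l))))\<^sup>2 \<le> 2 * M * c\<^sup>2 * (nrm x * nrm (t n x - t m x))"
        using main[OF mn(2)] by simp
      also have "\<dots> \<le> D * nrm (t n x - t m x)"
      proof -
        have "2 * M * c\<^sup>2 * nrm x \<le> D"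
          unfolding D_def by (metis abs_ge_self add_increasing2 mult_right_mono nrm_nonneg zero_le_one)
        then have "2 * M * c\<^sup>2 * nrm x * nrm (t n x - t m x) \<le> D * nrm (t n x - t m x)"
          by (rule mult_right_mono) simp
        then show ?thesis by (simp add: mult_ac)
      qed
      also have "\<dots> < e\<^sup>2" using tl D by (simp add: pos_less_divide_eq mult.commute)
      finally show ?thesis by (rule power2_less_imp_less) (use e in simp)
    qed
    then show ?thesis by blast
  qed
  then obtain L where "cv (\<lambda>n. \<Sum>l<n. A l (w l)) L" using cv_complete[of "\<lambda>n. \<Sum>l<n. A l (w l)"] by metis
  then show ?thesis by (auto simp: w_def)
qed

end

context quot_op
begin

text \<open>The blocks $q_l = e_{l+1}-e_l$ and $P_l = e_{l+2}-e_{l-1}$ overlap just enough that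
  $\phi q_l - P_l \phi q_l$ is summably small; the diagonal sum $\sum P_l T_l q_l$ then converges strictly
  for any bounded lifts $T_l$ of $\phi e_{l+2}$.  For $l = 0$ truncated subtraction makes $e_{l-1} = e_0 = 0$.\<close>

lemma block_lift:
  fixes e F F' :: "nat \<Rightarrow> 'e \<Rightarrow> 'e" and K :: "nat \<Rightarrow> real"
  assumes e_adj: "\<And>n. adj (e n) (e n)" and e0: "\<And>x. e 0 x = 0"
    and e_mono: "\<And>n x. pos (ip x (e (Suc n) x - e n x))"
    and e_le: "\<And>n x. pos (ip x x - ip x (e n x))"
    and e_cv: "\<And>x. cv (\<lambda>n. e n x) x"
    and F_adj: "\<And>n. adj (F n) (F' n)" and F_obd: "\<And>n. obd (F n) (K n)"
    and F0: "\<And>x. F 0 x = 0" and F_f: "\<And>n x. F n x - f (e n x) \<in> EI"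
    and e_small: "\<And>j n. j < n \<Longrightarrow> obd (\<lambda>x. e j x - e n (e j x)) ((1/2) ^ n)"
    and F_small: "\<And>j n. j < n \<Longrightarrow> obd (\<lambda>x. F j x - e n (F j x)) ((1/2) ^ n)"
  shows "\<exists>\<Phi> \<Phi>'. adj \<Phi> \<Phi>' \<and> (\<forall>x. \<Phi> x - f x \<in> EI)"
proof -
  obtain C where C: "C > 0" "\<And>x. nu (f x) \<le> C * nrm x" using f_bounded by blast
  have mono: "pos (ip x (e n x - e m x))" if "m \<le> n" for m n x
    using that
  proof (induction n rule: dec_induct)
    case (step n)
    then show ?case using pos_add[OF e_mono[of x n] step.IH] by (simp add: ip_simps)
  qed simp
  have D: "adj (\<lambda>x. e n x - e m x) (\<lambda>x. e n x - e m x)"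
    "pos (ip x (e n x - e m x) - ip (e n x - e m x) (e n x - e m x))"
    "obd (\<lambda>x. e n x - e m x) 1" if "m \<le> n" for m n x
  proof -
    show a: "adj (\<lambda>x. e n x - e m x) (\<lambda>x. e n x - e m x)" by (rule adj_minus[OF e_adj e_adj])
    have "pos (ip x x - ip x (e n x - e m x))" for x
      using pos_add[OF e_le[of x n] mono[of 0 m x]] by (simp add: e0 ip_simps algebra_simps)
    then show "pos (ip x (e n x - e m x) - ip (e n x - e m x) (e n x - e m x))" "obd (\<lambda>x. e n x - e m x) 1"
      using contraction_square[OF a mono[OF that]] by blast+
  qed
  have e1: "obd (e n) 1" for n using D(3)[of 0 n] by (simp add: e0)
  define q where "q = (\<lambda>l x. e (Suc l) x - e l x)"
  define P where "P = (\<lambda>l x. e (l + 2) x - e (l - 1) x)"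
  have q: "adj (q l) (q l)" "obd (q l) 1" for l unfolding q_def by (intro D; simp)+
  have P: "adj (P l) (P l)" "obd (P l) 1" for l unfolding P_def by (intro D; simp)+
  have nrm_e: "nrm (e n x) \<le> nrm x" for n x using obd_nrm[OF e1, of n x] by simp
  have gq: "dominated q e 1"
    unfolding dominated_def
  proof (intro conjI allI)
    show "\<exists>L. cv (\<lambda>n. e n x) L" for x using e_cv by (rule exI)
    show "pos (ip x (e (Suc l) x - e l x) - ip (q l x) (q l x))" for l x
      unfolding q_def by (rule D(2)) simp
  qed (use q nrm_e in auto)
  \<comment> \<open>The increment of this threefold sum is exactly \<open>P l\<close>; the bound 3
    counts its terms.\<close>
  define s where "s = (\<lambda>n x. e (n + 1) x + (e n x + e (n - 1) x))"
  have gP: "dominated P s 3"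
    unfolding dominated_def
  proof (intro conjI allI)
    show "pos (ip x (s (Suc l) x - s l x) - ip (P l x) (P l x))" for l x
      using D(2)[of "l - 1" "l + 2" x] by (simp add: s_def P_def)
    show "nrm (s n x) \<le> 3 * nrm x" for n x
      using nrm_triangle[of "e (n + 1) x" "e n x + e (n - 1) x"] nrm_triangle[of "e n x" "e (n - 1) x"]
        nrm_e[of "n + 1" x] nrm_e[of n x] nrm_e[of "n - 1" x] unfolding s_def by linarith
    have "cv (\<lambda>n. e (n - 1) x) x" for x
      unfolding cv_def by (rule LIMSEQ_imp_Suc) (use e_cv[of x] in \<open>simp add: cv_def\<close>)
    then have "cv (\<lambda>n. s n x) (x + (x + x))" for x
      unfolding s_def using cv_Suc[OF e_cv] by (intro cv_add e_cv) simp_all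
    then show "\<exists>L. cv (\<lambda>n. s n x) L" for x by blast
  qed (use P in auto)
  \<comment> \<open>Uniform in \<open>n\<close>, in contrast to the bounds \<open>K n\<close>; this
    is what \<open>lift_bounded\<close> turns into the common bound \<open>2 * C\<close> for the
    \<open>T l\<close>.\<close>
  have nuF: "nu (F n x) \<le> C * nrm x" for n x
  proof -
    have "nu (F n x) = nu (f (e n x))" by (rule nu_cong[OF F_f])
    also have "\<dots> \<le> C * nrm (e n x)" by (rule C)
    also have "\<dots> \<le> C * nrm x" using C nrm_e by (intro mult_left_mono) auto
    finally show ?thesis .
  qed
  have "\<exists>T T'. adj T T' \<and> obd T (2 * C) \<and> (\<forall>x. F (l + 2) x - T x \<in> EI)" for l
    by (rule lift_bounded[OF F_adj F_obd nuF C(1)])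
  then obtain T T' where T: "\<And>l. adj (T l) (T' l)" "\<And>l. obd (T l) (2 * C)" "\<And>l x. F (l + 2) x - T l x \<in> EI"
    by metis
  define W where "W = (\<lambda>l x. (F (Suc l) x - F l x) - P l (T l (q l x)))"
  have W: "adj (W l) (\<lambda>x. (F' (Suc l) x - F' l x) - q l (T' l (P l x)))" for l
    unfolding W_def by (intro adj_minus F_adj adj_comp[OF P(1) adj_comp[OF T(1) q(1)]])
  have W_obd: "obd (W l) ((K (Suc l) + K l) + 1 * (2 * C * 1))" for l
    unfolding W_def by (intro obd_diff F_obd obd_comp[OF P(2) obd_comp[OF T(2) q(2)]])
  \<comment> \<open>With \<open>y = q l x\<close>, modulo \<open>EI\<close> the discrepancy is the
    sum of (1 - e_{l+2}) \<phi> y, e_{l-1} \<phi> y and P_l \<phi> (1 - e_{l+2}) y. These contribute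
    2, 2 and \<open>2 * C\<close> to the constant.\<close>
  have nuW: "nu (W l x) \<le> (4 + 2 * C) * (1/2) ^ l * nrm x" for l x
  proof -
    define y where "y = q l x"
    define d where "d = F (Suc l) x - F l x"
    define w where "w = y - e (l + 2) y"
    define j where "j = l - 1"
    have dy: "d - f y \<in> EI"
    proof -
      have "d - f y = (F (Suc l) x - f (e (Suc l) x)) - (F l x - f (e l x))
          - (f (e (Suc l) x - e l x) - (f (e (Suc l) x) - f (e l x)))"
        by (simp add: d_def y_def q_def)
      then show ?thesis using EI_diff[OF EI_diff[OF F_f F_f] f_diff] by metis
    qed
    have Ty: "T l y - (f y - f w) \<in> EI"
    proof -
      have "f (e (l + 2) y) - (f y - f w) \<in> EI" using f_diff[of y w] by (simp add: w_def)
      moreover have "T l y - (f y - f w) = - (F (l + 2) y - T l y) + (F (l + 2) y - f (e (l + 2) y))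
          + (f (e (l + 2) y) - (f y - f w))" by simp
      ultimately show ?thesis using EI_add[OF EI_add[OF EI_minus[OF T(3)] F_f]] by metis
    qed
    have "T l y - (d - f w) \<in> EI"
    proof -
      have "T l y - (d - f w) = (T l y - (f y - f w)) - (d - f y)" by simp
      then show ?thesis using EI_diff[OF Ty dy] by metis
    qed
    then have PT: "P l (T l y) - (P l d - P l (f w)) \<in> EI"
      using EI_op[OF P(1)] adj_op_diff[OF P(1)] by metis
    \<comment> \<open>Since \<phi> and \<open>e j\<close> are self-adjoint, \<open>F' j\<close>
      lifts the product of \<open>e j\<close> and \<phi> in the reverse order.\<close>
    have ed: "e j d - F' j y \<in> EI"
    proof -
      have "e j (f y) - F' j y \<in> EI"
        unfolding EI_def
      proof (intro CollectI allI)
        fix z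
        have "ip z (e j (f y) - F' j y) = (ip (e j z) (f y) - ip (f (e j z)) y) - ip (F j z - f (e j z)) y"
          by (simp add: ip_simps adjD[OF e_adj] adjD[OF F_adj])
        then show "ip z (e j (f y) - F' j y) \<in> I" using I_diff[OF f_ip' EI_ip'[OF F_f]] by metis
      qed
      moreover have "e j d - e j (f y) \<in> EI" using EI_op[OF e_adj dy] adj_op_diff[OF e_adj] by metis
      moreover have "e j d - F' j y = (e j d - e j (f y)) + (e j (f y) - F' j y)" by simp
      ultimately show ?thesis using EI_add by metis
    qed
    have "W l x - ((d - e (l + 2) d) + (F' j y + P l (f w))) \<in> EI"
    proof -
      have "W l x - ((d - e (l + 2) d) + (F' j y + P l (f w)))
        = - (P l (T l y) - (P l d - P l (f w))) + (e j d - F' j y)"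
        by (simp add: W_def d_def y_def P_def j_def)
      then show ?thesis using EI_add[OF EI_minus[OF PT] ed] by metis
    qed
    then have "nu (W l x) \<le> nu (d - e (l + 2) d) + (nu (F' j y) + nu (P l (f w)))"
      using nu_cong nu_triangle[of "d - e (l + 2) d" "F' j y + P l (f w)"] nu_triangle[of "F' j y" "P l (f w)"]
      by fastforce
    moreover have "nu (d - e (l + 2) d) \<le> 2 * (1/2) ^ l * nrm x"
    proof -
      have "d - e (l + 2) d = (F (Suc l) x - e (l + 2) (F (Suc l) x)) - (F l x - e (l + 2) (F l x))"
        by (simp add: d_def adj_op_diff[OF e_adj])
      then have "nrm (d - e (l + 2) d) \<le> nrm (F (Suc l) x - e (l + 2) (F (Suc l) x)) + nrm (F l x - e (l + 2) (F l x))"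
        by (metis nrm_diff_triangle)
      also have "\<dots> \<le> (1/2) ^ (l + 2) * nrm x + (1/2) ^ (l + 2) * nrm x"
        by (intro add_mono obd_nrm[OF F_small]) auto
      also have "\<dots> \<le> 2 * (1/2) ^ l * nrm x" by (simp add: field_simps)
      finally show ?thesis using nu_le_nrm order_trans by blast
    qed
    moreover have "nu (F' j y) \<le> 2 * (1/2) ^ l * nrm x"
    proof -
      \<comment> \<open>The required product of \<open>F' j\<close> and \<open>q l\<close> is the
        adjoint of this one, so \<open>F_small\<close> applies through \<open>obd_adj\<close>. For
        \<open>l = 0\<close> also \<open>j = 0\<close>, and \<open>F 0\<close> vanishes.\<close>
      have "obd (\<lambda>x. q l (F j x)) (2 * (1/2) ^ l)"
      proof (cases "l = 0")
        case True
        then have "q l (F j x) = 0" for x by (simp add: j_def F0 adj_op_zero[OF q(1)])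
        then show ?thesis using obd_mono[OF obd_zero] by simp
      next
        case False
        then have "obd (\<lambda>x. (F j x - e l (F j x)) - (F j x - e (Suc l) (F j x))) ((1/2) ^ l + (1/2) ^ Suc l)"
          by (intro obd_diff F_small) (auto simp: j_def)
        then have "obd (\<lambda>x. q l (F j x)) ((1/2) ^ l + (1/2) ^ Suc l)" by (simp add: q_def)
        then show ?thesis by (rule obd_mono) simp
      qed
      then have "obd (\<lambda>x. F' j (q l x)) (2 * (1/2) ^ l)"
        using obd_adj adj_comp[OF q(1) F_adj] by blast
      then show ?thesis using obd_nrm nu_le_nrm order_trans unfolding y_def by blast
    qed
    moreover have "nu (P l (f w)) \<le> 2 * C * (1/2) ^ l * nrm x"
    proof -
      have w: "w = (e (Suc l) x - e (l + 2) (e (Suc l) x)) - (e l x - e (l + 2) (e l x))"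
        by (simp add: w_def y_def q_def adj_op_diff[OF e_adj])
      have "nrm w \<le> nrm (e (Suc l) x - e (l + 2) (e (Suc l) x)) + nrm (e l x - e (l + 2) (e l x))"
        unfolding w by (rule nrm_diff_triangle)
      also have "\<dots> \<le> (1/2) ^ (l + 2) * nrm x + (1/2) ^ (l + 2) * nrm x"
        by (intro add_mono obd_nrm[OF e_small]) auto
      also have "\<dots> \<le> 2 * (1/2) ^ l * nrm x" by (simp add: field_simps)
      finally have "C * nrm w \<le> C * (2 * (1/2) ^ l * nrm x)" using C by (intro mult_left_mono) auto
      moreover have "nu (P l (f w)) \<le> nu (f w)" using nu_obd[OF P(2) P(1)] by simp
      ultimately show ?thesis using C(2)[of w] by (simp add: mult_ac)
    qed
    ultimately show ?thesis by (simp add: algebra_simps)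
  qed
  define b where "b l = 2 * ((4 + 2 * C) * (1/2) ^ l)" for l :: nat
  have "\<exists>V V'. adj V V' \<and> obd V (b l) \<and> (\<forall>x. W l x - V x \<in> EI)" for l
    unfolding b_def using C(1) by (intro lift_bounded[OF W W_obd nuW]) simp
  then obtain V V' where V: "\<And>l. adj (V l) (V' l)" "\<And>l. obd (V l) (b l)" "\<And>l x. W l x - V l x \<in> EI"
    by metis
  have "summable b" unfolding b_def by (intro summable_mult summable_geometric) simp
  then obtain S S' where S: "adj S S'" "\<And>x. cv (\<lambda>n. \<Sum>k<n. V k x) (S x)"
    using op_series[of V V' b, OF V(1,2)] by blast
  have "\<exists>L. cv (\<lambda>n. \<Sum>l<n. P l (T l (q l x))) L" for x
    by (rule block_sum_convergent[OF gP gq T(2)])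
  then obtain A where A: "\<And>x. cv (\<lambda>n. \<Sum>l<n. P l (T l (q l x))) (A x)" by metis
  have "\<exists>L. cv (\<lambda>n. \<Sum>l<n. q l (T' l (P l x))) L" for x
    by (rule block_sum_convergent[OF gq gP obd_adj[OF T(2,1)]])
  then obtain A' where A': "\<And>x. cv (\<lambda>n. \<Sum>l<n. q l (T' l (P l x))) (A' x)" by metis
  have "adj (\<lambda>x. \<Sum>l<n. P l (T l (q l x))) (\<lambda>x. \<Sum>l<n. q l (T' l (P l x)))" for n
    by (intro adj_sum adj_comp[OF P(1) adj_comp[OF T(1) q(1)]])
  then have AA: "adj A A'" using A A' by (rule adj_limit)
  \<comment> \<open>Modulo \<open>EI\<close> the increments of \<open>Ps\<close> are those of
    \<open>F\<close>; so \<open>Ps n\<close> lifts \<phi> e_n, and unlike \<open>F n\<close> it is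
    known to converge at every vector.\<close>
  define Ps where "Ps n x = (\<Sum>l<n. P l (T l (q l x))) + (\<Sum>l<n. V l x)" for n x
  have Ps_F: "Ps n x - F n x \<in> EI" for n x
  proof (induction n)
    case 0
    then show ?case by (simp add: Ps_def F0 EI_zero)
  next
    case (Suc n)
    have "Ps (Suc n) x - F (Suc n) x = (Ps n x - F n x) - (W n x - V n x)"
      by (simp add: Ps_def W_def)
    then show ?case using EI_diff[OF Suc V(3)] by metis
  qed
  have "A x + S x - f x \<in> EI" for x
    unfolding EI_def
  proof (intro CollectI allI)
    fix y
    \<comment> \<open>The limit is taken with \<open>f\<close> moved to the fixed vector
      \<open>y\<close>, where only continuity of the inner product and closedness of
      \<open>I\<close> are involved.\<close>
    have "ip y (A x + S x) - ip (f y) x \<in> I"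
    proof (rule I_limit)
      show "(\<lambda>n. ip y (Ps n x) - ip (f y) (e n x)) \<longlonglongrightarrow> ip y (A x + S x) - ip (f y) x"
        unfolding Ps_def by (intro tendsto_diff cv_ip_right cv_add A S e_cv)
      fix n
      have "ip y (Ps n x) - ip (f y) (e n x) = ip y (Ps n x - F n x) + ip y (F n x - f (e n x))
          + (ip y (f (e n x)) - ip (f y) (e n x))" by (simp add: ip_simps)
      then show "ip y (Ps n x) - ip (f y) (e n x) \<in> I"
        using I_add[OF I_add[OF EI_ip[OF Ps_F] EI_ip[OF F_f]] f_ip'] by metis
    qed
    from I_diff[OF this f_ip'[of y x]] show "ip y (A x + S x - f x) \<in> I" by (simp add: ip_simps)
  qed
  then show ?thesis using adj_plus[OF AA S(1)] by blast
qed

end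

section \<open>Approximate units from a strictly positive operator\<close>

context hmod
begin

text \<open>The rank-one operator usually written \<theta> with indices u, v.\<close>

definition rk :: "'e \<Rightarrow> 'e \<Rightarrow> 'e \<Rightarrow> 'e" where "rk u v x = act u (ip v x)"

lemma rk_adj: "adj (rk u v) (rk v u)"
proof -
  have "st (ip v x) = ip x v" for x by (simp flip: ip_st)
  then show ?thesis by (simp add: adj_def rk_def ip_simps)
qed

lemma rk_obd: "obd (rk u v) (nrm u * nrm v)"
  unfolding obd_def
proof (intro conjI allI)
  fix x
  let ?a = "ip v x"
  have 1: "pos (norm (ip u u) *\<^sub>R (st ?a * ?a) - st ?a * ip u u * ?a)" by (rule pos_congruence[OF ip_pos])
  have "pos (norm (ip v v) *\<^sub>R ip x x - st ?a * ?a)"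
    using cauchy_schwarz_order[of "\<lambda>_. v" "{()}" "\<lambda>_. x"] by simp
  then have 2: "pos (norm (ip u u) *\<^sub>R (norm (ip v v) *\<^sub>R ip x x - st ?a * ?a))" by (rule pos_scale) simp
  have "(nrm u * nrm v)\<^sup>2 = norm (ip u u) * norm (ip v v)" by (simp add: power_mult_distrib nrm_sq)
  then show "pos ((nrm u * nrm v)\<^sup>2 *\<^sub>R ip x x - ip (rk u v x) (rk u v x))"
    using pos_add[OF 1 2] by (simp add: rk_def ip_simps scaleR_diff_right mult.assoc)
qed simp

lemma adj_op_scE: assumes "adj T T'" shows "T (scE c x) = scE c (T x)"
  by (rule ip_eqI) (simp add: ip_scE_right flip: adjD'[OF assms])

lemma nrm_scE: "nrm (scE c x) = cmod c * nrm x"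
proof -
  have "ip (scE c x) (scE c x) = sc (c * cnj c) (ip x x)"
    using ip_st[of "scE c x" x] by (simp add: ip_scE_right st_sc sc_sc flip: ip_st)
  then show ?thesis by (simp add: hnorm_def norm_sc norm_mult real_sqrt_mult)
qed

section \<open>The approximate unit of a positive operator\<close>

definition eu :: "('e \<Rightarrow> 'e) \<Rightarrow> real \<Rightarrow> 'e \<Rightarrow> 'e" where "eu H e x = H (res H e x)"

definition unital_at :: "('e \<Rightarrow> 'e) \<Rightarrow> 'e \<Rightarrow> bool" where
  "unital_at H x \<longleftrightarrow> ((\<lambda>e. nrm (x - eu H e x)) \<longlongrightarrow> 0) (at_right 0)"

context
  fixes H :: "'e \<Rightarrow> 'e" and K :: real
  assumes H: "posop H" and HK: "obd H K"
begin

lemma adjH: "adj H H" using H by (simp add: posop_def)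

lemma eu_compl: "e > 0 \<Longrightarrow> x - eu H e x = rs e (res H e x)"
  using res_right[OF H HK, of e x] by (simp add: eu_def algebra_simps)

lemma res_commute: assumes e: "e > 0" shows "res H e (H x) = H (res H e x)"
proof -
  let ?v = "res H e x"
  have "H (H ?v) + rs e (H ?v) = H x"
    using res_right[OF H HK e, of x] adj_op_add[OF adjH, of "H ?v" "rs e ?v"] adj_op_rs[OF adjH] by simp
  then show ?thesis using res_left[OF H HK e, of "H ?v"] by simp
qed

lemma eu_adj: assumes e: "e > 0" shows "adj (eu H e) (eu H e)"
  unfolding adj_def eu_def by (simp add: adjD[OF adjH] adjD[OF res_adj[OF H HK e]] res_commute[OF e])

lemma eu_compl_obd: assumes e: "e > 0" shows "obd (\<lambda>x. x - eu H e x) 1"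
  using obd_rs[OF res_obd[OF H HK e], of e] e by (simp add: eu_compl)

lemma eu_pos: assumes e: "e > 0" shows "pos (ip x (eu H e x))" "pos (ip x x - ip x (eu H e x))"
proof -
  define w where "w = res H e x"
  have x: "x = H w + rs e w" using res_right[OF H HK e, of x] by (simp add: w_def)
  have "pos (ip (H w) (H w) + e *\<^sub>R ip w (H w))" "pos (e *\<^sub>R ip w (H w) + e *\<^sub>R (e *\<^sub>R ip w w))"
    using H e by (intro pos_add pos_scale ip_pos; simp add: posop_def)+
  moreover have "ip x (eu H e x) = ip (H w) (H w) + e *\<^sub>R ip w (H w)"
    unfolding eu_def w_def[symmetric] by (subst x) (simp add: ip_simps)
  moreover have "ip x (x - eu H e x) = e *\<^sub>R ip w (H w) + e *\<^sub>R (e *\<^sub>R ip w w)"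
    unfolding eu_compl[OF e] w_def[symmetric] by (subst x) (simp add: ip_simps adjD[OF adjH] scaleR_add_right)
  ultimately show "pos (ip x (eu H e x))" "pos (ip x x - ip x (eu H e x))" by (simp_all add: ip_simps)
qed

lemma eu_obd: "e > 0 \<Longrightarrow> obd (eu H e) 1"
  by (rule contraction_square(2)[OF eu_adj eu_pos])

text \<open>By the resolvent identity the difference is \<open>(e - d) H w\<close>, where
  \<open>w\<close> is the product of both resolvents applied to \<open>x\<close>. Writing
  \<open>x\<close> as (H + d)(H + e) w makes every term of the inner product positive.\<close>

lemma eu_mono:
  assumes d: "0 < d" "d \<le> e"
  shows "pos (ip x (eu H d x - eu H e x))"
proof -
  have e: "e > 0" using d by simp
  define w where "w = res H d (res H e x)"
  have we: "H w + rs d w = res H e x" unfolding w_def by (rule res_right[OF H HK d(1)])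
  have x: "x = H (H w) + (rs (d + e) (H w) + rs (e * d) w)"
    using res_right[OF H HK e, of x, symmetric] unfolding we[symmetric]
    by (simp add: adj_op_add[OF adjH] adj_op_rs[OF adjH] rs_add rs_add_left add_ac)
  have "H (H w + rs e w) + rs d (H w + rs e w) = x"
    by (subst x) (simp add: adj_op_add[OF adjH] adj_op_rs[OF adjH] rs_add rs_add_left add_ac mult.commute)
  then have wd: "res H d x = H w + rs e w" using res_left[OF H HK d(1)] by metis
  have "eu H d x - eu H e x = rs (e - d) (H w)"
    unfolding eu_def wd we[symmetric] using rs_add_left[of "e - d" d "H w"]
    by (simp add: adj_op_add[OF adjH] adj_op_rs[OF adjH])
  then have "ip x (eu H d x - eu H e x) = (e - d) *\<^sub>R (ip (H w) (H (H w)) + ((d + e) *\<^sub>R ip (H w) (H w) + (e * d) *\<^sub>R ip w (H w)))"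
    by (subst x) (simp add: ip_simps adjD[OF adjH])
  also have "pos \<dots>" using d e H by (intro pos_scale pos_add ip_pos) (auto simp: posop_def)
  finally show ?thesis .
qed

lemma eu_compl_H: assumes e: "e > 0" shows "obd (\<lambda>x. H x - eu H e (H x)) e"
proof -
  have "H x - eu H e (H x) = rs e (eu H e x)" for x
    by (simp add: eu_compl[OF e] res_commute[OF e]) (simp add: eu_def)
  then show ?thesis using obd_rs[OF eu_obd[OF e], of e] e by simp
qed

text \<open>The bound \<open>e\<close> for (1 - eu) H meets the factor \<open>1/d\<close> of the
  resolvent. The ratio explains why the parameters must decrease fast.\<close>

lemma eu_compl_eu: assumes e: "e > 0" and d: "d > 0" shows "obd (\<lambda>x. eu H d x - eu H e (eu H d x)) (e / d)"
  using obd_comp[OF eu_compl_H[OF e] res_obd[OF H HK d]] by (simp add: eu_def)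

text \<open>Put \<open>v = res H e u\<close> and \<open>s = ip v u\<close>. The hypothesis gives
  \<open>c s^2 \<le> s\<close>, hence \<open>norm s \<le> 1/c\<close>. As
  \<open>e ip v v \<le> s\<close> and \<open>u - eu H e u = e v\<close>, the square of its norm is
  at most \<open>e / c\<close>.\<close>

lemma eu_generator:
  assumes c: "c > 0" "\<And>x. pos (ip x (H x) - c *\<^sub>R (st (ip u x) * ip u x))" and e: "e > 0"
  shows "(nrm (u - eu H e u))\<^sup>2 \<le> e / c"
proof -
  define v where "v = res H e u"
  define s where "s = ip v u"
  have "ip v (H v + rs e v) = s" unfolding v_def s_def res_right[OF H HK e] ..
  then have s: "s = ip v (H v) + e *\<^sub>R ip v v" by (simp add: ip_simps)
  have ps: "pos s" unfolding s using H e by (intro pos_add pos_scale ip_pos) (auto simp: posop_def)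
  have us: "ip u v = s" using ip_st[of u v] pos_st[OF ps] by (simp add: s_def)
  have "pos (s - c *\<^sub>R (st s * s))"
    using pos_add[OF c(2)[of v] pos_scale[OF ip_pos[of v], of e]] e unfolding us by (simp add: s algebra_simps)
  then have "norm (c *\<^sub>R (st s * s)) \<le> norm s"
    using c by (intro pos_mono_norm pos_scale pos_st_mult) auto
  then have "c * norm s * norm s \<le> 1 * norm s" using c by (simp add: norm_st_mult power2_eq_square)
  then have ns: "c * norm s \<le> 1" by (cases "s = 0") (auto dest: mult_right_le_imp_le)
  have "norm (e *\<^sub>R ip v v) \<le> norm s"
    using H e by (intro pos_mono_norm pos_scale ip_pos) (auto simp: s posop_def)
  then have "e * (nrm v)\<^sup>2 \<le> norm s" using e by (simp add: nrm_sq)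
  also have "\<dots> \<le> 1 / c" using ns c by (simp add: field_simps)
  finally have "e * (e * (nrm v)\<^sup>2) \<le> e * (1 / c)" using e by (intro mult_left_mono) auto
  then show ?thesis using e by (simp add: eu_compl[OF e] nrm_rs power_mult_distrib v_def power2_eq_square mult_ac)
qed

lemma unital_at_transform:
  assumes "(g \<longlongrightarrow> 0) (at_right (0::real))" "\<And>e. e > 0 \<Longrightarrow> nrm (x - eu H e x) \<le> g e"
  shows "unital_at H x"
  unfolding unital_at_def
proof (rule tendsto_sandwich[OF _ _ tendsto_const assms(1)])
  show "\<forall>\<^sub>F e in at_right 0. nrm (x - eu H e x) \<le> g e"
    using assms(2) by (auto simp: eventually_at_right_field intro!: exI[of _ 1])
qed simp

lemma unital_at_generator:
  assumes c: "c > 0" "\<And>x. pos (ip x (H x) - c *\<^sub>R (st (ip u x) * ip u x))"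
  shows "unital_at H u"
proof (rule unital_at_transform)
  have "((\<lambda>e. sqrt (e / c)) \<longlongrightarrow> sqrt (0 / c)) (at_right 0)" using c by (intro tendsto_intros) auto
  then show "((\<lambda>e. sqrt (e / c)) \<longlongrightarrow> 0) (at_right 0)" by simp
  show "nrm (u - eu H e u) \<le> sqrt (e / c)" if "e > 0" for e
    using eu_generator[OF c that] by (rule real_le_rsqrt)
qed

text \<open>The complements of \<open>eu H e\<close> are module maps bounded by one uniformly in
  \<open>e\<close>, so convergence extends from generators to their span and then to its
  closure.\<close>

lemma unital_at_dense:
  assumes g: "\<And>k. unital_at H (g k)"
    and dense: "hclosure ip (cspan scE (range g \<union> {act u a | u a. u \<in> range g})) = UNIV"
  shows "unital_at H x"
proof -
  have span: "unital_at H y" if "y \<in> cspan scE (range g \<union> {act u a | u a. u \<in> range g})" for y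
    using that
  proof induction
    case cspan_zero
    show ?case by (rule unital_at_transform[OF tendsto_const]) (simp add: adj_op_zero[OF eu_adj])
  next
    case (cspan_base x)
    then consider k where "x = g k" | k a where "x = act (g k) a" by auto
    then show ?case
    proof cases
      case 2
      show ?thesis
      proof (rule unital_at_transform)
        show "((\<lambda>e. nrm (g k - eu H e (g k)) * norm a) \<longlongrightarrow> 0) (at_right 0)"
          using g[of k] unfolding unital_at_def by (rule tendsto_mult_left_zero)
        show "nrm (x - eu H e x) \<le> nrm (g k - eu H e (g k)) * norm a" if "e > 0" for e
        proof -
          have "adj (\<lambda>x. x - eu H e x) (\<lambda>x. x - eu H e x)" by (rule adj_minus[OF adj_id eu_adj[OF that]])
          from adj_op_act[OF this, of "g k" a] show ?thesis using 2 nrm_act by simp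
        qed
      qed
    qed (use g in simp)
  next
    case (cspan_add x y)
    show ?case
    proof (rule unital_at_transform)
      show "((\<lambda>e. nrm (x - eu H e x) + nrm (y - eu H e y)) \<longlongrightarrow> 0) (at_right 0)"
        using tendsto_add[OF cspan_add.IH[unfolded unital_at_def]] by simp
      show "nrm (x + y - eu H e (x + y)) \<le> nrm (x - eu H e x) + nrm (y - eu H e y)" if "e > 0" for e
        using nrm_triangle[of "x - eu H e x" "y - eu H e y"] adj_op_add[OF eu_adj[OF that], of x y]
        by (simp add: algebra_simps)
    qed
  next
    case (cspan_scale x c)
    show ?case
    proof (rule unital_at_transform)
      show "((\<lambda>e. cmod c * nrm (x - eu H e x)) \<longlongrightarrow> 0) (at_right 0)"
        using cspan_scale.IH unfolding unital_at_def by (rule tendsto_mult_right_zero)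
      show "nrm (scE c x - eu H e (scE c x)) \<le> cmod c * nrm (x - eu H e x)" if "e > 0" for e
      proof -
        have "adj (\<lambda>x. x - eu H e x) (\<lambda>x. x - eu H e x)" by (rule adj_minus[OF adj_id eu_adj[OF that]])
        from adj_op_scE[OF this, of c x] show ?thesis by (simp add: nrm_scE)
      qed
    qed
  qed
  show ?thesis
    unfolding unital_at_def
  proof (rule tendstoI)
    fix d :: real assume d: "d > 0"
    have "x \<in> hclosure ip (cspan scE (range g \<union> {act u a | u a. u \<in> range g}))" using dense by simp
    then obtain y where y: "y \<in> cspan scE (range g \<union> {act u a | u a. u \<in> range g})" "nrm (x - y) < d / 2"
      unfolding hclosure_def using d half_gt_zero by blast
    have "\<forall>\<^sub>F e in at_right 0. dist (nrm (y - eu H e y)) 0 < d / 2"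
      using tendstoD[OF span[OF y(1), unfolded unital_at_def], of "d / 2"] d by simp
    moreover have "\<forall>\<^sub>F e in at_right 0. (e::real) > 0" by (simp add: eventually_at_right_less)
    ultimately show "\<forall>\<^sub>F e in at_right 0. dist (nrm (x - eu H e x)) 0 < d"
    proof eventually_elim
      case (elim e)
      have "x - eu H e x = (y - eu H e y) + ((x - y) - eu H e (x - y))"
        by (simp add: adj_op_diff[OF eu_adj[OF elim(2)]])
      then have "nrm (x - eu H e x) \<le> nrm (y - eu H e y) + nrm ((x - y) - eu H e (x - y))"
        by (metis nrm_triangle)
      also have "nrm ((x - y) - eu H e (x - y)) \<le> nrm (x - y)"
        using obd_nrm[OF eu_compl_obd[OF elim(2)], of "x - y"] by simp
      finally show ?case using elim(1) y(2) by simp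
    qed
  qed
qed

text \<open>Convergence at single vectors becomes convergence in norm on limits of finite-rank
  operators: applying \<open>1 - eu\<close> to a rank-one operator changes only its first vector,
  and the tail is not enlarged.\<close>

lemma eu_compl_compact:
  assumes unit: "\<And>x. unital_at H x" and sm: "summable b"
    and F: "\<And>n. obd (\<lambda>x. F x - (\<Sum>k<n. rk (u k) (v k) x)) (\<Sum>k. b (k + n))" and r: "r > 0"
  shows "\<forall>\<^sub>F e in at_right 0. obd (\<lambda>x. F x - eu H e (F x)) r"
proof -
  obtain n where n: "norm (\<Sum>k. b (k + n)) < r / 2"
    using suminf_exist_split[OF _ sm, of "r / 2"] r by auto
  have "((\<lambda>e. \<Sum>k<n. nrm (u k - eu H e (u k)) * nrm (v k)) \<longlongrightarrow> (\<Sum>k<n. 0 * nrm (v k))) (at_right 0)"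
    using unit unfolding unital_at_def by (intro tendsto_intros)
  then have "\<forall>\<^sub>F e in at_right 0. dist (\<Sum>k<n. nrm (u k - eu H e (u k)) * nrm (v k)) 0 < r / 2"
    using r by (intro tendstoD) auto
  moreover have "\<forall>\<^sub>F e in at_right 0. (e::real) > 0" by (simp add: eventually_at_right_less)
  ultimately show ?thesis
  proof eventually_elim
    case (elim e)
    define Q where "Q = (\<lambda>x. x - eu H e x)"
    define G where "G = (\<lambda>x. \<Sum>k<n. rk (u k) (v k) x)"
    have Q: "adj Q Q" "obd Q 1"
      unfolding Q_def using adj_minus[OF adj_id eu_adj[OF elim(2)]] eu_compl_obd[OF elim(2)] by auto
    have 1: "obd (\<lambda>x. Q (F x - G x)) (1 * (\<Sum>k. b (k + n)))"
      unfolding G_def by (rule obd_comp[OF Q(2) F])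
    have "Q (G x) = (\<Sum>k<n. rk (Q (u k)) (v k) x)" for x
      unfolding G_def rk_def by (simp add: adj_op_sum[OF Q(1)] adj_op_act[OF Q(1)])
    then have 2: "obd (\<lambda>x. Q (G x)) (\<Sum>k<n. nrm (Q (u k)) * nrm (v k))"
      using obd_sum[of n "\<lambda>k. rk (Q (u k)) (v k)" "\<lambda>k. nrm (Q (u k)) * nrm (v k)"] rk_obd by simp
    have "Q (F x - G x) + Q (G x) = Q (F x)" for x
      by (simp flip: adj_op_add[OF Q(1)])
    then have "obd (\<lambda>x. Q (F x)) (1 * (\<Sum>k. b (k + n)) + (\<Sum>k<n. nrm (Q (u k)) * nrm (v k)))"
      using obd_add[OF 1 2] by simp
    then have "obd (\<lambda>x. F x - eu H e (F x)) (1 * (\<Sum>k. b (k + n)) + (\<Sum>k<n. nrm (u k - eu H e (u k)) * nrm (v k)))"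
      by (simp add: Q_def)
    then show ?case by (rule obd_mono) (use n elim(1) in \<open>simp add: abs_less_iff\<close>)
  qed
qed

end

end

section \<open>Lifting on a countably generated module\<close>

lemma (in hmod) rk_rs: "rk (rs c u) u = rk u (rs c u)"
  by (rule ext, rule ip_eqI) (simp add: rk_def ip_simps)

lemma (in quot_op) lift_selfadjoint:
  fixes g :: "nat \<Rightarrow> 'e"
  assumes dense: "hclosure ip (cspan scE (range g \<union> {act u a | u a. u \<in> range g})) = UNIV"
  shows "\<exists>\<Phi> \<Phi>'. adj \<Phi> \<Phi>' \<and> (\<forall>x. \<Phi> x - f x \<in> EI)"
proof -
  define b where "b k = (1/2 :: real) ^ k" for k :: nat
  \<comment> \<open>The weights must make both the series for \<open>h\<close>, built from
    \<open>g k\<close>, and the series for \<open>F\<close>, built from \<open>f (g k)\<close>,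
    summable; the leading 1 keeps the divisor away from zero.\<close>
  define N where "N k = 1 + nrm (g k) * nrm (g k) + nrm (f (g k)) * nrm (g k)" for k
  define c where "c k = b k / N k" for k
  have N: "N k \<ge> 1" for k by (simp add: N_def)
  have b: "b k > 0" "summable b" for k unfolding b_def by (simp_all add: summable_geometric)
  have c: "c k > 0" for k using b(1)[of k] N[of k] by (simp add: c_def)
  have c_le: "nrm (rs (c k) u) * nrm (g k) \<le> b k" if "nrm u * nrm (g k) \<le> N k" for k u
  proof -
    have "nrm (rs (c k) u) * nrm (g k) = c k * (nrm u * nrm (g k))" using c[of k] by (simp add: nrm_rs)
    also have "\<dots> \<le> c k * N k" using c[of k] that by (intro mult_left_mono) auto
    also have "\<dots> = b k" using N[of k] by (simp add: c_def)
    finally show ?thesis .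
  qed
  have cg: "nrm (rs (c k) (g k)) * nrm (g k) \<le> b k" for k by (rule c_le) (simp add: N_def)
  have cf: "nrm (rs (c k) (f (g k))) * nrm (g k) \<le> b k" for k by (rule c_le) (simp add: N_def)

  obtain h h' where h: "adj h h'" "\<And>n. obd (\<lambda>x. h x - (\<Sum>k<n. rk (rs (c k) (g k)) (g k) x)) (\<Sum>k. b (k + n))"
    "\<And>x. cv (\<lambda>n. \<Sum>k<n. rk (rs (c k) (g k)) (g k) x) (h x)"
    "\<And>x. cv (\<lambda>n. \<Sum>k<n. rk (g k) (rs (c k) (g k)) x) (h' x)"
    using op_series[of "\<lambda>k. rk (rs (c k) (g k)) (g k)" "\<lambda>k. rk (g k) (rs (c k) (g k))" b,
        OF rk_adj obd_mono[OF rk_obd cg] b(2)] by blast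
  have "h' x = h x" for x using cv_unique[OF h(3)[of x]] h(4)[of x] by (simp add: rk_rs)
  then have "h' = h" by auto
  then have hadj: "adj h h" using h(1) by simp
  obtain K where hK: "obd h K" using h(2)[of 0] by auto
  define t where "t x k = c k *\<^sub>R (st (ip (g k) x) * ip (g k) x)" for x k
  have t: "pos (t x k)" for x k unfolding t_def using c[of k] by (intro pos_scale pos_st_mult) simp
  have ht: "(\<lambda>n. \<Sum>k<n. t x k) \<longlonglongrightarrow> ip x (h x)" for x
  proof -
    have "ip x (rk (rs (c k) (g k)) (g k) x) = t x k" for k
      using ip_st[of x "g k"] by (simp add: rk_def ip_simps t_def)
    then show ?thesis using cv_ip_right[OF h(3)[of x], of x] by (simp add: ip_sum_right)
  qed
  have "pos (ip x (h x))" for x by (rule pos_limit[OF pos_sum[OF t] ht])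
  then have hpos: "posop h" using hadj by (simp add: posop_def)
  \<comment> \<open>The partial sums start beyond index \<open>k\<close>, so the term to be
    subtracted is among the summands and the rest is positive.\<close>
  have gen: "pos (ip x (h x) - c k *\<^sub>R (st (ip (g k) x) * ip (g k) x))" for k x
  proof (rule pos_limit)
    show "(\<lambda>n. (\<Sum>j<n + Suc k. t x j) - t x k) \<longlonglongrightarrow> ip x (h x) - c k *\<^sub>R (st (ip (g k) x) * ip (g k) x)"
      unfolding t_def[of x k, symmetric]
      by (intro tendsto_diff tendsto_const LIMSEQ_ignore_initial_segment[OF ht])
    have "(\<Sum>j<n + Suc k. t x j) - t x k = (\<Sum>j\<in>{..<n + Suc k} - {k}. t x j)" for n
      by (subst sum.remove[of _ k]) auto
    then show "pos ((\<Sum>j<n + Suc k. t x j) - t x k)" for n using t by (simp add: pos_sum del: sum.lessThan_Suc)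
  qed
  have unit: "unital_at h x" for x
    by (rule unital_at_dense[OF hpos hK unital_at_generator[OF hpos hK c gen] dense])

  obtain F F' where F: "adj F F'" "\<And>n. obd (\<lambda>x. F x - (\<Sum>k<n. rk (rs (c k) (f (g k))) (g k) x)) (\<Sum>k. b (k + n))"
    "\<And>x. cv (\<lambda>n. \<Sum>k<n. rk (rs (c k) (f (g k))) (g k) x) (F x)"
    using op_series[of "\<lambda>k. rk (rs (c k) (f (g k))) (g k)" "\<lambda>k. rk (g k) (rs (c k) (f (g k)))" b,
        OF rk_adj obd_mono[OF rk_obd cf] b(2)] by blast
  obtain L where FL: "obd F L" using F(2)[of 0] by auto
  have F_fh: "F x - f (h x) \<in> EI" for x
    unfolding EI_def
  proof (intro CollectI allI)
    fix y
    \<comment> \<open>As \<open>f\<close> need not be continuous, the comparison is made at the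
      partial sums with \<open>f\<close> applied to \<open>y\<close>.\<close>
    have "ip y (F x) - ip (f y) (h x) \<in> I"
    proof (rule I_limit)
      show "(\<lambda>n. ip y (\<Sum>k<n. rk (rs (c k) (f (g k))) (g k) x) - ip (f y) (\<Sum>k<n. rk (rs (c k) (g k)) (g k) x))
        \<longlonglongrightarrow> ip y (F x) - ip (f y) (h x)"
        by (intro tendsto_diff cv_ip_right F h)
      fix n
      have "ip y (\<Sum>k<n. rk (rs (c k) (f (g k))) (g k) x) - ip (f y) (\<Sum>k<n. rk (rs (c k) (g k)) (g k) x)
        = (\<Sum>k<n. c k *\<^sub>R ((ip y (f (g k)) - ip (f y) (g k)) * ip (g k) x))"
        unfolding ip_sum_right sum_subtractf[symmetric]
        by (intro sum.cong refl) (simp add: rk_def ip_simps algebra_simps)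
      also have "\<dots> \<in> I"
        by (induction n) (auto simp: I_zero intro!: I_add I_scaleR I_right f_ip')
      finally show "ip y (\<Sum>k<n. rk (rs (c k) (f (g k))) (g k) x) - ip (f y) (\<Sum>k<n. rk (rs (c k) (g k)) (g k) x) \<in> I" .
    qed
    from I_diff[OF this f_ip'[of y "h x"]] show "ip y (F x - f (h x)) \<in> I" by (simp add: ip_simps)
  qed

  \<comment> \<open>The factor \<open>a\<close> compensates the norm \<open>1 / a\<close> of the
    resolvent in earlier members, both of the approximate unit and of the lifts. The exponent
    \<open>n + 2\<close> anticipates two index shifts: from \<open>a n\<close> to
    \<open>a (Suc n)\<close>, and from \<open>a m\<close> to \<open>e (Suc m)\<close>.\<close>
  define Q where "Q n a a' \<longleftrightarrow> a' \<le> (1/2) ^ (n + 2) * a \<and> obd (\<lambda>x. F x - eu h a' (F x)) ((1/2) ^ (n + 2) * a)"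
    for n :: nat and a a' :: real
  have "\<exists>a. \<forall>n. (a n > 0 \<and> (n = 0 \<longrightarrow> a n = 1)) \<and> Q n (a n) (a (Suc n))"
  proof (rule dependent_nat_choice)
    show "\<exists>x. 0 < x \<and> ((0::nat) = 0 \<longrightarrow> x = (1::real))" by (intro exI[of _ 1]) simp
    fix a :: real and n :: nat assume a: "0 < a \<and> (n = 0 \<longrightarrow> a = 1)"
    let ?r = "(1/2) ^ (n + 2) * a"
    have r: "?r > 0" using a by simp
    have "\<forall>\<^sub>F e in at_right 0. obd (\<lambda>x. F x - eu h e (F x)) ?r"
      by (rule eu_compl_compact[OF hpos hK unit b(2) F(2) r])
    moreover have "\<forall>\<^sub>F e in at_right (0::real). 0 < e \<and> e \<le> ?r"
      unfolding eventually_at_right_field using r by (intro exI[of _ ?r]) auto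
    ultimately have "\<forall>\<^sub>F e in at_right (0::real). obd (\<lambda>x. F x - eu h e (F x)) ?r \<and> 0 < e \<and> e \<le> ?r"
      by (rule eventually_conj)
    then obtain e where "obd (\<lambda>x. F x - eu h e (F x)) ?r" "0 < e" "e \<le> ?r"
      using eventually_happens'[OF trivial_limit_at_right_real] by blast
    then show "\<exists>y. (0 < y \<and> (Suc n = 0 \<longrightarrow> y = 1)) \<and> Q n a y" by (intro exI[of _ e]) (simp add: Q_def)
  qed
  then obtain a where a: "\<And>n. a n > 0" "a 0 = 1" and aQ: "\<And>n. Q n (a n) (a (Suc n))" by blast
  have a_step: "a (Suc n) \<le> (1/2) ^ (n + 2) * a n" for n using aQ[of n] by (simp add: Q_def)
  have pow_le: "(1/2 :: real) ^ n * y \<le> y" if "y \<ge> 0" for n y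
    using that by (simp add: mult_left_le_one_le power_le_one)
  have a_dec: "a (Suc n) \<le> a n" for n
    using a_step[of n] pow_le[of "a n" "n + 2"] a(1)[of n] by linarith
  have a_anti: "a m \<le> a i" if "i \<le> m" for i m
    using lift_Suc_antimono_le[of a, OF a_dec that] .
  have a_small: "a m \<le> (1/2) ^ Suc m * a i \<and> obd (\<lambda>x. F x - eu h (a m) (F x)) ((1/2) ^ Suc m * a i)" if im: "i < m" for i m
  proof -
    obtain m' where m: "m = Suc m'" using im by (cases m) auto
    have le: "(1/2) ^ (m' + 2) * a m' \<le> (1/2) ^ Suc m * a i"
      using a_anti[of i m'] im by (simp add: m)
    have "a m \<le> (1/2) ^ (m' + 2) * a m'" "obd (\<lambda>x. F x - eu h (a m) (F x)) ((1/2) ^ (m' + 2) * a m')"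
      using aQ[of m'] unfolding Q_def m by blast+
    then show ?thesis using order_trans[OF _ le] obd_mono[OF _ le] by blast
  qed
  have a_pow: "a n \<le> (1/2) ^ n" for n
  proof (cases n)
    case (Suc m)
    have "a n \<le> (1/2) ^ Suc n * a 0" using a_small[of 0 n] Suc by blast
    also have "\<dots> \<le> (1/2) ^ n" by (simp add: a)
    finally show ?thesis .
  qed (simp add: a)
  have "a \<longlonglongrightarrow> 0"
  proof (rule tendsto_sandwich[OF _ _ tendsto_const])
    show "(\<lambda>n. (1/2 :: real) ^ n) \<longlonglongrightarrow> 0" by (rule LIMSEQ_power_zero) simp
  qed (use less_imp_le[OF a(1)] a_pow in simp_all)
  then have a_lim: "filterlim a (at_right 0) sequentially"
    using a(1) by (simp add: filterlim_at less_imp_neq[symmetric])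

  \<comment> \<open>The shift by one puts the zero operator in front, so that telescoping sums start
    at zero; for positive \<open>n\<close> the parameter of \<open>e n\<close> is
    \<open>a (n - 1)\<close>.\<close>
  define e where "e n x = (case n of 0 \<Rightarrow> 0 | Suc m \<Rightarrow> eu h (a m) x)" for n x
  define G where "G n x = (case n of 0 \<Rightarrow> 0 | Suc m \<Rightarrow> F (res h (a m) x))" for n x
  define G' where "G' n x = (case n of 0 \<Rightarrow> 0 | Suc m \<Rightarrow> res h (a m) (F' x))" for n x
  define KG where "KG n = (case n of 0 \<Rightarrow> 0 | Suc m \<Rightarrow> L * (1 / a m))" for n
  have es: "e 0 = (\<lambda>x. 0)" "e (Suc m) = eu h (a m)" "G 0 = (\<lambda>x. 0)" "G (Suc m) = (\<lambda>x. F (res h (a m) x))"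
    "G' 0 = (\<lambda>x. 0)" "G' (Suc m) = (\<lambda>x. res h (a m) (F' x))" for m
    by (auto simp: e_def G_def G'_def)
  note eu_adj' = eu_adj[OF hpos hK a(1)] and res_adj' = res_adj[OF hpos hK a(1)] and res_obd' = res_obd[OF hpos hK a(1)]
  have e_adj: "adj (e n) (e n)" for n by (cases n) (simp_all add: es adj_zero eu_adj')
  show ?thesis
  proof (rule block_lift[of e G G' KG])
    show "adj (e n) (e n)" for n by (rule e_adj)
    show "e 0 x = 0" "G 0 x = 0" for x by (simp_all add: es)
    show "pos (ip x (e (Suc n) x - e n x))" for n x
    proof (cases n)
      case 0
      then show ?thesis by (simp add: es eu_pos(1)[OF hpos hK a(1)])
    next
      case (Suc m)
      show ?thesis unfolding Suc es by (rule eu_mono[OF hpos hK a(1) a_dec])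
    qed
    show "pos (ip x x - ip x (e n x))" for n x
      by (cases n) (simp_all add: es ip_pos eu_pos(2)[OF hpos hK a(1)])
    show "cv (\<lambda>n. e n x) x" for x
      unfolding cv_def
    proof (rule LIMSEQ_imp_Suc)
      have "(\<lambda>n. nrm (x - eu h (a n) x)) \<longlonglongrightarrow> 0"
        using unit[of x] unfolding unital_at_def by (rule filterlim_compose[OF _ a_lim])
      then show "(\<lambda>n. nrm (e (Suc n) x - x)) \<longlonglongrightarrow> 0" unfolding es using nrm_minus_commute by simp
    qed
    show "adj (G n) (G' n)" for n
      by (cases n) (simp_all add: es adj_zero adj_comp[OF F(1) res_adj'])
    show "obd (G n) (KG n)" for n
      by (cases n) (simp_all only: es KG_def nat.case obd_zero obd_comp[OF FL res_obd'])
    show "G n x - f (e n x) \<in> EI" for n x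
    proof (cases n)
      case 0
      have "f 0 \<in> EI" using f_diff[of 0 0] by simp
      then show ?thesis using 0 EI_minus by (simp add: es)
    next
      case (Suc m)
      show ?thesis unfolding Suc es eu_def by (rule F_fh)
    qed
    show "obd (\<lambda>x. e j x - e n (e j x)) ((1/2) ^ n)" if jn: "j < n" for j n
    proof (cases j)
      case 0
      then show ?thesis using obd_mono[OF obd_zero] by (simp add: es adj_op_zero[OF e_adj])
    next
      case (Suc i)
      then obtain m where n: "n = Suc m" "i < m" using jn by (cases n) auto
      have "a m / a i \<le> (1/2) ^ Suc m" using a_small[OF n(2)] a(1)[of i] by (simp add: pos_divide_le_eq)
      then show ?thesis
        unfolding Suc n es by (rule obd_mono[OF eu_compl_eu[OF hpos hK a(1) a(1)]])
    qed
    show "obd (\<lambda>x. G j x - e n (G j x)) ((1/2) ^ n)" if jn: "j < n" for j n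
    proof (cases j)
      case 0
      then show ?thesis using obd_mono[OF obd_zero] by (simp add: es adj_op_zero[OF e_adj])
    next
      case (Suc i)
      then obtain m where n: "n = Suc m" "i < m" using jn by (cases n) auto
      have "obd (\<lambda>x. F (res h (a i) x) - eu h (a m) (F (res h (a i) x))) ((1/2) ^ Suc m * a i * (1 / a i))"
        by (rule obd_comp[OF conjunct2[OF a_small[OF n(2)]] res_obd'])
      then show ?thesis unfolding Suc n es using a(1)[of i] by simp
    qed
  qed
qed

section \<open>Reduction to a self-adjoint operator on the direct sum\<close>

locale hmod_pair = M: hmod sc st scM actM ipM + N: hmod sc st scN actN ipN
  for sc :: "complex \<Rightarrow> 'a::{real_normed_algebra,banach} \<Rightarrow> 'a" and st
    and scM :: "complex \<Rightarrow> 'm::ab_group_add \<Rightarrow> 'm" and actM ipM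
    and scN :: "complex \<Rightarrow> 'n::ab_group_add \<Rightarrow> 'n" and actN ipN
begin

definition scP :: "complex \<Rightarrow> 'm \<times> 'n \<Rightarrow> 'm \<times> 'n" where "scP c x = (scM c (fst x), scN c (snd x))"
definition actP :: "'m \<times> 'n \<Rightarrow> 'a \<Rightarrow> 'm \<times> 'n" where "actP x a = (actM (fst x) a, actN (snd x) a)"
definition ipP :: "'m \<times> 'n \<Rightarrow> 'm \<times> 'n \<Rightarrow> 'a" where "ipP x y = ipM (fst x) (fst y) + ipN (snd x) (snd y)"

lemma hnorm_components: "hnorm ipM (fst x) \<le> hnorm ipP x" "hnorm ipN (snd x) \<le> hnorm ipP x"
  unfolding hnorm_def ipP_def
  by (auto intro!: M.pos_mono_norm M.ip_pos N.ip_pos)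

lemma hnorm_pair_le: "hnorm ipP x \<le> hnorm ipM (fst x) + hnorm ipN (snd x)"
proof (rule power2_le_imp_le)
  have "(hnorm ipP x)\<^sup>2 \<le> (hnorm ipM (fst x))\<^sup>2 + (hnorm ipN (snd x))\<^sup>2"
    by (simp add: hnorm_def ipP_def norm_triangle_ineq)
  also have "\<dots> \<le> (hnorm ipM (fst x) + hnorm ipN (snd x))\<^sup>2"
    by (simp add: power2_sum)
  finally show "(hnorm ipP x)\<^sup>2 \<le> (hnorm ipM (fst x) + hnorm ipN (snd x))\<^sup>2" .
qed simp

sublocale P: hmod sc st scP actP ipP
proof
  fix x y z :: "'m \<times> 'n" and c a
  show "ipP x (y + z) = ipP x y + ipP x z" by (simp add: ipP_def M.ip_simps N.ip_simps)
  show "ipP x (scP c y) = sc c (ipP x y)"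
    by (simp add: ipP_def scP_def M.ip_scE_right N.ip_scE_right M.sc_add)
  show "ipP x (actP y a) = ipP x y * a" by (simp add: ipP_def actP_def M.ip_simps N.ip_simps distrib_right)
  show "ipP y x = st (ipP x y)"
    unfolding ipP_def by (simp add: M.st_add flip: M.ip_st N.ip_st)
  show "M.pos (ipP x x)" unfolding ipP_def by (intro M.pos_add M.ip_pos N.ip_pos)
  show "x = 0" if "ipP x x = 0"
  proof -
    have "hnorm ipP x = 0" using that by (simp add: hnorm_def)
    then have "hnorm ipM (fst x) = 0" "hnorm ipN (snd x) = 0"
      using hnorm_components[of x] M.nrm_nonneg[of "fst x"] N.nrm_nonneg[of "snd x"] by simp_all
    then show ?thesis using M.nrm_eq_zero N.nrm_eq_zero by (simp add: prod_eq_iff)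
  qed
next
  fix X :: "nat \<Rightarrow> 'm \<times> 'n"
  assume X: "\<And>e. e > 0 \<Longrightarrow> \<exists>N. \<forall>m\<ge>N. \<forall>n\<ge>N. hnorm ipP (X m - X n) < e"
  have "\<exists>N. \<forall>m\<ge>N. \<forall>n\<ge>N. hnorm ipM (fst (X m) - fst (X n)) < e" if "e > 0" for e
    using X[OF that] hnorm_components(1) by (metis fst_diff order_le_less_trans)
  from M.complete_ex[of "\<lambda>n. fst (X n)", OF this]
  obtain L where L: "\<forall>e>0. \<exists>N. \<forall>n\<ge>N. hnorm ipM (fst (X n) - L) < e" by blast
  have "\<exists>N. \<forall>m\<ge>N. \<forall>n\<ge>N. hnorm ipN (snd (X m) - snd (X n)) < e" if "e > 0" for e
    using X[OF that] hnorm_components(2) by (metis snd_diff order_le_less_trans)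
  from N.complete_ex[of "\<lambda>n. snd (X n)", OF this]
  obtain K where K: "\<forall>e>0. \<exists>N. \<forall>n\<ge>N. hnorm ipN (snd (X n) - K) < e" by blast
  show "\<exists>L. \<forall>e>0. \<exists>N. \<forall>n\<ge>N. hnorm ipP (X n - L) < e"
  proof (rule exI[of _ "(L, K)"], intro allI impI)
    fix e :: real assume "e > 0"
    then have "e / 2 > 0" by simp
    then obtain N1 N2 where N: "\<forall>n\<ge>N1. hnorm ipM (fst (X n) - L) < e / 2" "\<forall>n\<ge>N2. hnorm ipN (snd (X n) - K) < e / 2"
      using L K by meson
    have "hnorm ipP (X n - (L, K)) < e" if "n \<ge> max N1 N2" for n
    proof -
      have "hnorm ipM (fst (X n) - L) < e / 2" "hnorm ipN (snd (X n) - K) < e / 2" using N that by auto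
      then show ?thesis using hnorm_pair_le[of "X n - (L, K)"] by simp
    qed
    then show "\<exists>N. \<forall>n\<ge>N. hnorm ipP (X n - (L, K)) < e" by blast
  qed
qed

lemma dense_pair:
  assumes M: "hclosure ipM (cspan scM (GM \<union> {actM g a | g a. g \<in> GM})) = UNIV"
    and N: "hclosure ipN (cspan scN (GN \<union> {actN g a | g a. g \<in> GN})) = UNIV"
    and GM: "\<And>g. g \<in> GM \<Longrightarrow> (g, 0) \<in> G" and GN: "\<And>g. g \<in> GN \<Longrightarrow> (0, g) \<in> G"
  shows "hclosure ipP (cspan scP (G \<union> {actP g a | g a. g \<in> G})) = UNIV"
proof -
  let ?S = "cspan scP (G \<union> {actP g a | g a. g \<in> G})"
  have "sc c 0 = 0" for c using M.sc_add[of c 0 0] by simp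
  then have zero: "scM c 0 = 0" "scN c 0 = 0" "actM 0 a = 0" "actN 0 a = 0" for c a
    by - (rule M.ip_eqI N.ip_eqI, simp add: M.ip_scE_right N.ip_scE_right M.ip_act_right N.ip_act_right)+
  have l: "(x, 0) \<in> ?S" if "x \<in> cspan scM (GM \<union> {actM g a | g a. g \<in> GM})" for x
    using that
  proof induction
    case cspan_zero
    show ?case using cspan.cspan_zero[of scP] by (simp add: zero_prod_def)
  next
    case (cspan_base x)
    then consider "x \<in> GM" | g a where "g \<in> GM" "x = actM g a" by blast
    then show ?case
    proof cases
      case 2
      then have "(x, 0) = actP (g, 0) a" by (simp add: actP_def zero)
      then show ?thesis using GM[OF 2(1)] by (intro cspan.cspan_base) blast
    qed (use GM in \<open>auto intro: cspan.cspan_base\<close>)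
  next
    case (cspan_add x y)
    then show ?case using cspan.cspan_add[of "(x, 0)" scP _ "(y, 0)"] by simp
  next
    case (cspan_scale x c)
    have "(scM c x, 0) = scP c (x, 0)" by (simp add: scP_def zero)
    then show ?case using cspan.cspan_scale[OF cspan_scale.IH, of c] by simp
  qed
  have r: "(0, x) \<in> ?S" if "x \<in> cspan scN (GN \<union> {actN g a | g a. g \<in> GN})" for x
    using that
  proof induction
    case cspan_zero
    show ?case using cspan.cspan_zero[of scP] by (simp add: zero_prod_def)
  next
    case (cspan_base x)
    then consider "x \<in> GN" | g a where "g \<in> GN" "x = actN g a" by blast
    then show ?case
    proof cases
      case 2
      then have "(0, x) = actP (0, g) a" by (simp add: actP_def zero)
      then show ?thesis using GN[OF 2(1)] by (intro cspan.cspan_base) blast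
    qed (use GN in \<open>auto intro: cspan.cspan_base\<close>)
  next
    case (cspan_add x y)
    then show ?case using cspan.cspan_add[of "(0, x)" scP _ "(0, y)"] by simp
  next
    case (cspan_scale x c)
    have "(0, scN c x) = scP c (0, x)" by (simp add: scP_def zero)
    then show ?case using cspan.cspan_scale[OF cspan_scale.IH, of c] by simp
  qed
  have "z \<in> hclosure ipP ?S" for z
    unfolding hclosure_def
  proof (intro CollectI allI impI)
    fix e :: real assume "e > 0"
    then have e: "e / 2 > 0" by simp
    have "fst z \<in> hclosure ipM (cspan scM (GM \<union> {actM g a | g a. g \<in> GM}))"
      "snd z \<in> hclosure ipN (cspan scN (GN \<union> {actN g a | g a. g \<in> GN}))" using M N by auto
    then obtain x y where x: "x \<in> cspan scM (GM \<union> {actM g a | g a. g \<in> GM})" "hnorm ipM (fst z - x) < e / 2"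
      and y: "y \<in> cspan scN (GN \<union> {actN g a | g a. g \<in> GN})" "hnorm ipN (snd z - y) < e / 2"
      using e unfolding hclosure_def by blast
    have "(x, y) \<in> ?S" using cspan.cspan_add[OF l[OF x(1)] r[OF y(1)]] by simp
    moreover have "hnorm ipP (z - (x, y)) < e" using hnorm_pair_le[of "z - (x, y)"] x(2) y(2) by simp
    ultimately show "\<exists>y\<in>?S. hnorm ipP (z - y) < e" by blast
  qed
  then show ?thesis by blast
qed

end

theorem theorem2p1:
  fixes sc :: "complex \<Rightarrow> 'a::{real_normed_algebra,banach} \<Rightarrow> 'a"
    and st :: "'a \<Rightarrow> 'a"
    and I :: "'a set"
    and scM :: "complex \<Rightarrow> 'm::ab_group_add \<Rightarrow> 'm" and actM :: "'m \<Rightarrow> 'a \<Rightarrow> 'm"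
    and ipM :: "'m \<Rightarrow> 'm \<Rightarrow> 'a"
    and scN :: "complex \<Rightarrow> 'n::ab_group_add \<Rightarrow> 'n" and actN :: "'n \<Rightarrow> 'a \<Rightarrow> 'n"
    and ipN :: "'n \<Rightarrow> 'n \<Rightarrow> 'a"
    and f :: "'m \<Rightarrow> 'n"
  assumes "cstar_algebra sc st"
    and "closed_ideal sc I"
    and "hilbert_module sc st scM actM ipM"
    and "hilbert_module sc st scN actN ipN"
    and "countably_generated scM actM ipM"
    and "countably_generated scN actN ipN"
    and "quot_adjointable I (submodI scM actM ipM I) (submodI scN actN ipN I) ipM ipN f"
  shows "\<exists>\<Phi>. adjointable ipM ipN \<Phi> \<and>
           (\<forall>m. \<Phi> m - f m \<in> submodI scN actN ipN I)"
proof -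
  interpret cstar_ideal sc st I by unfold_locales (rule assms(1), rule assms(2))
  interpret M: hmod sc st scM actM ipM by (rule hilbert_module_hmod[OF assms(3)])
  interpret N: hmod sc st scN actN ipN by (rule hilbert_module_hmod[OF assms(4)])
  interpret MN: hmod_pair sc st scM actM ipM scN actN ipN by unfold_locales
  interpret NI: hmod_ideal sc st scN actN ipN I by unfold_locales
  obtain g where g: "\<And>x y. ipN (f x) y - ipM x (g y) \<in> I"
    using assms(7) unfolding quot_adjointable_def by blast
  define F where "F x = (g (snd x), f (fst x))" for x
  interpret Q: quot_op sc st MN.scP MN.actP MN.ipP I F
  proof unfold_locales
    fix x y :: "'m \<times> 'n"
    \<comment> \<open>The second bracket is the same defect with the vectors exchanged, which enters
      through its adjoint; so \<open>I\<close> being self-adjoint matters here.\<close>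
    have "MN.ipP (F x) y - MN.ipP x (F y) = (ipN (f (fst x)) (snd y) - ipM (fst x) (g (snd y)))
        - st (ipN (f (fst y)) (snd x) - ipM (fst y) (g (snd x)))"
      by (simp add: MN.ipP_def F_def st_diff flip: M.ip_st N.ip_st)
    then show "MN.ipP (F x) y - MN.ipP x (F y) \<in> I" using I_diff[OF g I_st[OF g]] by metis
  qed
  obtain GM where GM: "countable GM" "hclosure ipM (cspan scM (GM \<union> {actM g a | g a. g \<in> GM})) = UNIV"
    using assms(5) unfolding countably_generated_def by blast
  obtain GN where GN: "countable GN" "hclosure ipN (cspan scN (GN \<union> {actN g a | g a. g \<in> GN})) = UNIV"
    using assms(6) unfolding countably_generated_def by blast
  \<comment> \<open>Inserting 0 makes the set nonempty, hence the range of a sequence, even if both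
    generating sets are empty.\<close>
  define G where "G = insert 0 ((\<lambda>x. (x, 0 :: 'n)) ` GM \<union> (\<lambda>y. (0 :: 'm, y)) ` GN)"
  have "countable G" "G \<noteq> {}" unfolding G_def using GM(1) GN(1) by auto
  then obtain \<gamma> :: "nat \<Rightarrow> 'm \<times> 'n" where \<gamma>: "range \<gamma> = G"
    using range_from_nat_into by metis
  have "hclosure MN.ipP (cspan MN.scP (range \<gamma> \<union> {MN.actP u a | u a. u \<in> range \<gamma>})) = UNIV"
    unfolding \<gamma> by (rule MN.dense_pair[OF GM(2) GN(2)]) (auto simp: G_def)
  then obtain \<Psi> \<Psi>' where \<Psi>: "MN.P.adj \<Psi> \<Psi>'" "\<And>x. \<Psi> x - F x \<in> Q.EI"
    using Q.lift_selfadjoint by blast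
  \<comment> \<open>The corner of \<Psi> from the first to the second summand; its adjoint is the
    opposite corner of \<Psi>'.\<close>
  define \<Phi> where "\<Phi> m = snd (\<Psi> (m, 0))" for m
  have "ipN (\<Phi> m) n = ipM m (fst (\<Psi>' (0, n)))" for m n
    using MN.P.adjD[OF \<Psi>(1), of "(m, 0)" "(0, n)"] by (simp add: MN.ipP_def \<Phi>_def)
  then have "adjointable ipM ipN \<Phi>" unfolding adjointable_def by (intro exI[of _ "\<lambda>n. fst (\<Psi>' (0, n))"]) simp
  moreover have "\<Phi> m - f m \<in> submodI scN actN ipN I" for m
  proof (rule NI.EI_subset_submodI)
    have "ipN n (\<Phi> m - f m) = MN.ipP (0, n) (\<Psi> (m, 0) - F (m, 0))" for n
      by (simp add: MN.ipP_def \<Phi>_def F_def)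
    then show "\<Phi> m - f m \<in> NI.EI" unfolding NI.EI_def using Q.EI_ip[OF \<Psi>(2)] by simp
  qed
  ultimately show ?thesis by blast
qed

end
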